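(* Let $Z_1,\ldots,Z_n\in\mathbb{R}^d$ be i.i.d. with distribution $F$, $Z\sim F$. For each $\lambda$ let $\hat\theta(\lambda)\in\mathbb{R}^p$ be the unique solution to $\Phi_n(\theta,\lambda)=n^{-1}\sum_{i=1}^n\varphi(Z_i,\theta,\lambda)=0$, and let $\mathrm{TE}(\lambda)=n^{-1}\sum_{i=1}^n\psi\{Z_i,\hat\theta(\lambda)\}$. Assume that we are minimising $\mathrm{TE}(\lambda)$ in $[0,1]$, with minimizer $\hat\lambda$, and that the following hold. (1) $\mathrm{TE}'(\lambda)=o_p(1/\sqrt n)$ has a unique solution; with $\eta$ as in the context, $\Psi(\alpha)=\mathrm{E}\,\eta(Z,\alpha)=0$ has a unique solution $\alpha_0=(\theta(\lambda_0)^T,\lambda_0^T,D^T)^T$; $\Psi$ is continuously differentiable in a neighbourhood of $\alpha_0$; $\Psi'(\alpha_0)$ is non-singular; and in a neighbourhood of $\alpha_0$ the norm of $\eta(z,\alpha)$ and all first order partial derivatives of $\eta$ with respect to $\alpha$ are bounded by functions $m_0(z)$ and $m_1(z)$, respectively, with $\mathrm{E}\,m_0(Z)^2,\ \mathrm{E}\,m_1(Z)^2<\infty$. (2) There exist functions depending only on $z$ that bound the norms of all partial derivatives, with respect to $(\theta,\lambda,\theta')$, of $\partial_\theta\varphi$, $\partial_\lambda\varphi$, $H_\lambda\psi$, $H_\theta\psi$, $\nabla_\theta\psi$, $\eta\eta^T$, $H_\theta\varphi^j$ ($j=1,\ldots,p$) and $\partial_{\lambda^k}\partial_\theta\varphi$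 ($k=1,\dots,q$) in a neighbourhood of $\alpha_0$. Then $\sqrt n\{\hat\theta(\hat\lambda)-\theta_0\}$ is asymptotically normal with variance $V$ which can be estimated consistently by $$\hat V_1=\hat A^*\hat K^*(\hat A^* )^T$$ if $\hat\lambda$ lies in the interior of $[0,1]$, or by $$\hat V_2=\hat J^{-1}\hat K(\hat J^{-1})^T$$ when $\mathrm{TE}$ is minimised in $\lambda$ with $\mathrm{TE}'(\lambda)\neq0$ for $\lambda$ equal to $0$ or $1$. Here $\hat K=n^{-1}\sum_{i=1}^n\varphi\{Z_i,\hat\theta(\hat\lambda),\hat\lambda\}\varphi\{Z_i,\hat\theta(\hat\lambda),\hat\lambda\}^T$ and $\hat A^*=(\hat A_1,\hat A_2,\hat A_3)$ with $$\hat A_1=\hat J^{-1}-\hat D\hat{\mathcal Z}_1^{-1}\{\hat D^T\hat{\mathcal Z}_2+\hat W\}\hat J^{-1},\qquad \hat A_2=-\hat D\hat{\mathcal Z}_1^{-1}\hat D^T,\qquad \hat A_3=-\hat D\hat{\mathcal Z}_1^{-1}\hat M,$$ where $\hat M$ is the ($q\times pq$) block diagonal matrix with $\hat b^T\hat J^{-1}$ as each of its diagonal blocks and $\hat W=((\hat b^T\hat J^{-1}\hat W^1)^T,\ldots,(\hat b^T\hat J^{-1}\hat W^q)^T)^T$ is the $q\times p$ matrix with $j$-th row $\hat b^T\hat J^{-1}\hat W^j$. The remaining quantities are defined in the context.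
   Context: $\varphi=(\varphi^1,\ldots,\varphi^p)^T\colon\mathbb{R}^{d+p+q}\to\mathbb{R}^p$ is the estimating function and $\psi\colon\mathbb{R}^{d+p}\to\mathbb{R}$ the loss function, with all derivatives appearing existing. The formulas are written for $\lambda\in\mathbb{R}^q$; minimisation over $[0,1]$ is the case $q=1$. $\nabla$, $H$, $\partial$ denote gradient, Hessian and Jacobian; a prime denotes the Jacobian with respect to the argument; $\lambda^j$ is the $j$-th coordinate of $\lambda$; $H_\lambda\psi$ is the Hessian in $\lambda$ of $\lambda\mapsto\psi\{z,\theta(\lambda)\}$. $\theta(\lambda)$ is the solution to $\mathrm{E}\,\varphi(Z,\theta,\lambda)=0$; $D=\theta'(\lambda_0)$. The centring $\theta_0$ is $\theta(\lambda_0)$, and in the case where $\mathrm{TE}$ is minimised at an endpoint $e\in\{0,1\}$ with $\mathrm{TE}'(e)\ne0$ it is the limit of $\hat\theta(e)$. $p\times q$ matrices are identified with vectors in $\mathbb{R}^{pq}$ by stacking columns. With $\alpha=(\theta^T,\lambda^T,D^T)^T$, $\eta(z,\alpha)=(\eta_1^T,\eta_2^T,\eta_3^T)^T$ where $\eta_1=\varphi(z,\theta,\lambda)$, $\eta_2=D^T\nabla_\theta\psi(z,\theta)$, $\eta_3=\partial_\theta\varphi(z,\theta,\lambda)D+\partial_\lambda\varphi(z,\theta,\lambda)$; the $D$-argument is also denoted $\theta'$. Plug-in quantities, with $\Psi_n(\theta)=n^{-1}\sum_i\psi(Z_i,\theta)$: $\hat{\mathcal Z}_1=n^{-1}\sum_iH_{\lambda=\hat\lambda}\psi\{Z_i,\hat\theta(\lambda)\}$;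 $\hat{\mathcal Z}_2=H_{\theta=\hat\theta(\hat\lambda)}\Psi_n(\theta)$; $\hat b=\nabla_{\theta=\hat\theta(\hat\lambda)}\Psi_n(\theta)$; $\hat J=-\partial_{\theta=\hat\theta(\hat\lambda)}\Phi_n(\theta,\hat\lambda)$; $\hat D=\hat J^{-1}\partial_{\lambda=\hat\lambda}\Phi_n\{\hat\theta(\hat\lambda),\lambda\}$ with columns $\hat D_j$; $\hat K^*=n^{-1}\sum_i\hat\eta_i\hat\eta_i^T$ with $\hat\eta_i=\eta\{Z_i,\hat\theta(\hat\lambda),\hat\lambda,\hat\theta'(\hat\lambda)\}$; and $\hat W^j=n^{-1}\sum_i\{G_i^j+\partial_{\lambda^j}\partial_\theta\varphi(Z_i,\theta,\lambda)\}$ evaluated at $\theta=\hat\theta(\hat\lambda)$, $\lambda=\hat\lambda$, where $G_i^j$ is $p\times p$ with $l$-th row $\hat D_j^TH_\theta\varphi^l(Z_i,\theta,\hat\lambda)$. Since $\hat A_2$ already contains the factor $\hat D^T$, it acts on $\nabla_\theta\psi$: the product $\hat A^*\hat K^*(\hat A^* )^T$ is understood as $n^{-1}\sum_iv_iv_i^T$ with $v_i=\hat A_1\varphi+\hat A_2\nabla_\theta\psi+\hat A_3\eta_3$, evaluated at $Z_i$ and the estimates.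
   Formalization: In the endpoint case it is additionally assumed that the mean of φ(Z,·,e) is C¹ near θ_0 with non-singular derivative there, and that φ(z,·,e) and its first partials are bounded near θ_0 by square-integrable functions; (1) and (2) hold only near α_0, and without this the endpoint claim is false. *)

theory Defs
  imports "HOL-Probability.Probability"
begin

subsection \<open>Derivatives\<close>

definition gradient :: "(real^'n \<Rightarrow> real) \<Rightarrow> real^'n \<Rightarrow> real^'n" where
  "gradient f x = (\<chi> i. frechet_derivative f (at x) (axis i 1))"

definition hessian :: "(real^'n \<Rightarrow> real) \<Rightarrow> real^'n \<Rightarrow> real^'n^'n" where
  "hessian f x = jacobian (gradient f) (at x)"

definition partial :: "'n \<Rightarrow> (real^'n \<Rightarrow> 'v::real_normed_vector) \<Rightarrow> real^'n \<Rightarrow> 'v" where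
  "partial k f x = frechet_derivative f (at x) (axis k 1)"

text \<open>Total differentiability of all partial derivatives of order less than \<open>k\<close>.\<close>

fun times_differentiable_on ::
    "nat \<Rightarrow> ('a::euclidean_space \<Rightarrow> real) \<Rightarrow> 'a set \<Rightarrow> bool" where
  "times_differentiable_on 0 f S \<longleftrightarrow> True"
| "times_differentiable_on (Suc k) f S \<longleftrightarrow>
     (\<forall>x\<in>S. f differentiable (at x)) \<and>
     (\<forall>b\<in>Basis. times_differentiable_on k (\<lambda>x. frechet_derivative f (at x) b) S)"

definition outer :: "real^'m \<Rightarrow> real^'n \<Rightarrow> real^'n^'m" where
  "outer x y = (\<chi> i j. x $ i * y $ j)"


subsection \<open>Stochastic convergence\<close>

text \<open>The events below are enclosed in measurable ones, i.e. outer probability is used. A bare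
  \<^const>\<open>measure\<close> would assign the value 0 to every non-measurable event.\<close>

definition tendsto_in_prob ::
    "'w measure \<Rightarrow> (nat \<Rightarrow> 'w \<Rightarrow> 'v::metric_space) \<Rightarrow> 'v \<Rightarrow> bool" where
  "tendsto_in_prob M X c \<longleftrightarrow>
     (\<forall>\<epsilon>>0. \<exists>A. (\<forall>n. A n \<in> sets M \<and> {\<omega> \<in> space M. dist (X n \<omega>) c \<ge> \<epsilon>} \<subseteq> A n) \<and>
                (\<lambda>n. measure M (A n)) \<longlonglongrightarrow> 0)"

definition with_prob_to_one :: "'w measure \<Rightarrow> (nat \<Rightarrow> 'w \<Rightarrow> bool) \<Rightarrow> bool" where
  "with_prob_to_one M P \<longleftrightarrow>
     (\<exists>A. (\<forall>n. A n \<in> sets M \<and> A n \<subseteq> {\<omega> \<in> space M. P n \<omega>}) \<and> (\<lambda>n. measure M (A n)) \<longlonglongrightarrow> 1)"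

definition tendsto_in_distribution ::
    "'w measure \<Rightarrow> (nat \<Rightarrow> 'w \<Rightarrow> 'v::topological_space) \<Rightarrow> 'v measure \<Rightarrow> bool" where
  "tendsto_in_distribution M X N \<longleftrightarrow>
     (\<forall>n. X n \<in> borel_measurable M) \<and>
     (\<forall>f::'v \<Rightarrow> real. continuous_on UNIV f \<and> bounded (range f) \<longrightarrow>
        (\<lambda>n. \<integral>\<omega>. f (X n \<omega>) \<partial>M) \<longlonglongrightarrow> (\<integral>x. f x \<partial>N))"

definition normal_distribution :: "real \<Rightarrow> real \<Rightarrow> real measure" where
  "normal_distribution \<mu> v =
     (if v = 0 then return borel \<mu> else density lborel (normal_density \<mu> (sqrt v)))"

text \<open>The covariance matrix \<open>V\<close> may be singular, so there need not be a density.\<close>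

definition multivariate_normal :: "real^'p \<Rightarrow> real^'p^'p \<Rightarrow> (real^'p) measure \<Rightarrow> bool" where
  "multivariate_normal \<mu> V N \<longleftrightarrow>
     prob_space N \<and> sets N = sets borel \<and> transpose V = V \<and> (\<forall>u. 0 \<le> u \<bullet> (V *v u)) \<and>
     (\<forall>u. distr N borel (\<lambda>x. u \<bullet> x) = normal_distribution (u \<bullet> \<mu>) (u \<bullet> (V *v u)))"

definition asymptotically_normal ::
    "'w measure \<Rightarrow> (nat \<Rightarrow> 'w \<Rightarrow> real^'p) \<Rightarrow> real^'p^'p \<Rightarrow> bool" where
  "asymptotically_normal M X V \<longleftrightarrow>
     (\<exists>N. multivariate_normal 0 V N \<and> tendsto_in_distribution M X N)"


subsection \<open>The stacked parameter and estimating function\<close>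

text \<open>A \<open>p \<times> q\<close> matrix has type \<^typ>\<open>real^'q^'p\<close>. Stacking its columns gives a vector indexed by
  pairs (column, row).\<close>

type_synonym ('p, 'q) stacked = "(real, 'p + ('q + ('q \<times> 'p))) vec"

definition stack_columns :: "real^'q^'p \<Rightarrow> real^('q \<times> 'p)" where
  "stack_columns D = (\<chi> m. D $ snd m $ fst m)"

definition stack ::
    "real^'p \<Rightarrow> real^'q \<Rightarrow> real^'q^'p \<Rightarrow> ('p, 'q) stacked" where
  "stack t l D = (\<chi> r. case r of Inl i \<Rightarrow> t $ i
                       | Inr s \<Rightarrow> (case s of Inl k \<Rightarrow> l $ k | Inr m \<Rightarrow> stack_columns D $ m))"

definition theta_of :: "('p::finite, 'q::finite) stacked \<Rightarrow> real^'p" where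
  "theta_of a = (\<chi> i. a $ Inl i)"

definition lambda_of :: "('p::finite, 'q::finite) stacked \<Rightarrow> real^'q" where
  "lambda_of a = (\<chi> k. a $ Inr (Inl k))"

definition deriv_of :: "('p::finite, 'q::finite) stacked \<Rightarrow> real^'q^'p" where
  "deriv_of a = (\<chi> i k. a $ Inr (Inr (k, i)))"

lemma stack_components [simp]:
  "theta_of (stack t l D) = t" "lambda_of (stack t l D) = l" "deriv_of (stack t l D) = D"
  by (simp_all add: vec_eq_iff theta_of_def lambda_of_def deriv_of_def stack_def stack_columns_def)

definition eta2 :: "('z \<Rightarrow> real^'p \<Rightarrow> real) \<Rightarrow> 'z \<Rightarrow> real^'p \<Rightarrow> real^'q^'p \<Rightarrow> real^'q" where
  "eta2 \<psi> z t D = transpose D *v gradient (\<psi> z) t"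

definition eta3 ::
    "('z \<Rightarrow> real^'p \<Rightarrow> real^'q \<Rightarrow> real^'p) \<Rightarrow> 'z \<Rightarrow> real^'p \<Rightarrow> real^'q \<Rightarrow> real^'q^'p \<Rightarrow> real^'q^'p"
  where
  "eta3 \<phi> z t l D = jacobian (\<lambda>s. \<phi> z s l) (at t) ** D + jacobian (\<lambda>m. \<phi> z t m) (at l)"

definition eta ::
    "('z \<Rightarrow> real^'p \<Rightarrow> real^'q \<Rightarrow> real^'p) \<Rightarrow> ('z \<Rightarrow> real^'p \<Rightarrow> real) \<Rightarrow> 'z \<Rightarrow>
     ('p, 'q) stacked \<Rightarrow> ('p, 'q) stacked" where
  "eta \<phi> \<psi> z a =
     stack (\<phi> z (theta_of a) (lambda_of a))
           (eta2 \<psi> z (theta_of a) (deriv_of a))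
           (eta3 \<phi> z (theta_of a) (lambda_of a) (deriv_of a))"


subsection \<open>Regularity\<close>

text \<open>Local regularity of an estimating function \<open>h\<close> with mean function \<open>a \<mapsto> E h(Z,a)\<close> at \<open>a\<^sub>0\<close>.\<close>

definition regular_estimating_function ::
    "'z measure \<Rightarrow> ('z \<Rightarrow> real^'m \<Rightarrow> real^'m) \<Rightarrow> real^'m \<Rightarrow> bool" where
  "regular_estimating_function F h a0 \<longleftrightarrow>
     (let mean = (\<lambda>a. \<integral>z. h z a \<partial>F) in
      (\<exists>U. open U \<and> a0 \<in> U \<and> (\<forall>a\<in>U. mean differentiable (at a)) \<and>
           continuous_on U (\<lambda>a. jacobian mean (at a))) \<and>
      invertible (jacobian mean (at a0)) \<and>
      (\<exists>U m0 m1. open U \<and> a0 \<in> U \<and>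
         m0 \<in> borel_measurable F \<and> m1 \<in> borel_measurable F \<and>
         integrable F (\<lambda>z. (m0 z)\<^sup>2) \<and> integrable F (\<lambda>z. (m1 z)\<^sup>2) \<and>
         (\<forall>z. \<forall>a\<in>U. norm (h z a) \<le> m0 z \<and> h z differentiable (at a) \<and>
                    (\<forall>r. norm (partial r (h z) a) \<le> m1 z))))"

definition partials_bounded_near ::
    "('z \<Rightarrow> real^'m \<Rightarrow> 'v::real_normed_vector) \<Rightarrow> real^'m \<Rightarrow> bool" where
  "partials_bounded_near f a0 \<longleftrightarrow>
     (\<exists>U m. open U \<and> a0 \<in> U \<and>
        (\<forall>z. \<forall>a\<in>U. f z differentiable (at a) \<and> (\<forall>r. norm (partial r (f z) a) \<le> (m z :: real))))"

definition plug_in_partials_bounded ::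
    "('z \<Rightarrow> real^'p \<Rightarrow> real^'q \<Rightarrow> real^'p) \<Rightarrow> ('z \<Rightarrow> real^'p \<Rightarrow> real) \<Rightarrow>
     (real^'q \<Rightarrow> real^'p) \<Rightarrow> ('p, 'q) stacked \<Rightarrow> bool" where
  "plug_in_partials_bounded \<phi> \<psi> \<theta> a0 \<longleftrightarrow>
     partials_bounded_near (\<lambda>z a. jacobian (\<lambda>t. \<phi> z t (lambda_of a)) (at (theta_of a))) a0 \<and>
     partials_bounded_near (\<lambda>z a. jacobian (\<lambda>l. \<phi> z (theta_of a) l) (at (lambda_of a))) a0 \<and>
     partials_bounded_near (\<lambda>z a. hessian (\<lambda>l. \<psi> z (\<theta> l)) (lambda_of a)) a0 \<and>
     partials_bounded_near (\<lambda>z a. hessian (\<psi> z) (theta_of a)) a0 \<and>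
     partials_bounded_near (\<lambda>z a. gradient (\<psi> z) (theta_of a)) a0 \<and>
     partials_bounded_near (\<lambda>z a. outer (eta \<phi> \<psi> z a) (eta \<phi> \<psi> z a)) a0 \<and>
     (\<forall>j. partials_bounded_near (\<lambda>z a. hessian (\<lambda>t. \<phi> z t (lambda_of a) $ j) (theta_of a)) a0) \<and>
     (\<forall>k. partials_bounded_near
            (\<lambda>z a. partial k (\<lambda>l. jacobian (\<lambda>t. \<phi> z t l) (at (theta_of a))) (lambda_of a)) a0)"


subsection \<open>Sample quantities\<close>

text \<open>\<open>z 0, \<dots>, z (n - 1)\<close> is the sample, \<open>th\<close> the estimator as a function of the tuning
  parameter, and \<open>l\<close> the selected value of the tuning parameter.\<close>

locale sample =
  fixes \<phi> :: "'z \<Rightarrow> real^'p \<Rightarrow> real^'q \<Rightarrow> real^'p"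
    and \<psi> :: "'z \<Rightarrow> real^'p \<Rightarrow> real"
    and n :: nat
    and z :: "nat \<Rightarrow> 'z"
    and th :: "real^'q \<Rightarrow> real^'p"
    and l :: "real^'q"
begin

definition Phi_n :: "real^'p \<Rightarrow> real^'q \<Rightarrow> real^'p" where
  "Phi_n t s = (1 / real n) *\<^sub>R (\<Sum>i<n. \<phi> (z i) t s)"

definition Psi_n :: "real^'p \<Rightarrow> real" where
  "Psi_n t = (1 / real n) * (\<Sum>i<n. \<psi> (z i) t)"

definition TE :: "real^'q \<Rightarrow> real" where
  "TE s = (1 / real n) * (\<Sum>i<n. \<psi> (z i) (th s))"

definition J_hat :: "real^'p^'p" where
  "J_hat = - jacobian (\<lambda>t. Phi_n t l) (at (th l))"

definition D_hat :: "real^'q^'p" where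
  "D_hat = matrix_inv J_hat ** jacobian (\<lambda>s. Phi_n (th l) s) (at l)"

definition Z1_hat :: "real^'q^'q" where
  "Z1_hat = (1 / real n) *\<^sub>R (\<Sum>i<n. hessian (\<lambda>s. \<psi> (z i) (th s)) l)"

definition Z2_hat :: "real^'p^'p" where
  "Z2_hat = hessian Psi_n (th l)"

definition b_hat :: "real^'p" where
  "b_hat = gradient Psi_n (th l)"

definition G_hat :: "nat \<Rightarrow> 'q \<Rightarrow> real^'p^'p" where
  "G_hat i j = (\<chi> r. column j D_hat v* hessian (\<lambda>t. \<phi> (z i) t l $ r) (th l))"

definition Wj_hat :: "'q \<Rightarrow> real^'p^'p" where
  "Wj_hat j = (1 / real n) *\<^sub>R
     (\<Sum>i<n. G_hat i j + partial j (\<lambda>s. jacobian (\<lambda>t. \<phi> (z i) t s) (at (th l))) l)"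

definition W_hat :: "real^'p^'q" where
  "W_hat = (\<chi> j. (b_hat v* matrix_inv J_hat) v* Wj_hat j)"

definition M_hat :: "real^('q \<times> 'p)^'q" where
  "M_hat = (\<chi> j m. if fst m = j then (b_hat v* matrix_inv J_hat) $ snd m else 0)"

definition A1_hat :: "real^'p^'p" where
  "A1_hat = matrix_inv J_hat -
     D_hat ** matrix_inv Z1_hat ** (transpose D_hat ** Z2_hat + W_hat) ** matrix_inv J_hat"

definition A2_hat :: "real^'p^'p" where
  "A2_hat = - (D_hat ** matrix_inv Z1_hat ** transpose D_hat)"

definition A3_hat :: "real^('q \<times> 'p)^'p" where
  "A3_hat = - (D_hat ** matrix_inv Z1_hat ** M_hat)"

text \<open>\<open>A2_hat\<close> already contains the factor \<open>D\<^sup>T\<close> of \<^const>\<open>eta2\<close>, so it multiplies the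
  gradient of \<open>\<psi>\<close> itself.\<close>

definition v_hat :: "nat \<Rightarrow> real^'p" where
  "v_hat i = A1_hat *v \<phi> (z i) (th l) l + A2_hat *v gradient (\<psi> (z i)) (th l) +
     A3_hat *v stack_columns (eta3 \<phi> (z i) (th l) l (jacobian th (at l)))"

definition V1_hat :: "real^'p^'p" where
  "V1_hat = (1 / real n) *\<^sub>R (\<Sum>i<n. outer (v_hat i) (v_hat i))"

definition K_hat :: "real^'p^'p" where
  "K_hat = (1 / real n) *\<^sub>R (\<Sum>i<n. outer (\<phi> (z i) (th l) l) (\<phi> (z i) (th l) l))"

definition V2_hat :: "real^'p^'p" where
  "V2_hat = matrix_inv J_hat ** K_hat ** transpose (matrix_inv J_hat)"

end


subsection \<open>Approximate stationary points\<close>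

text \<open>\<open>g n \<omega>\<close> is a random function of the tuning parameter. A solution of \<open>g(\<lambda>) = o\<^sub>p(n\<^sup>-\<^sup>1\<^sup>/\<^sup>2)\<close>
  is a sequence of random variables, which can always be changed by a negligible amount, so
  uniqueness can only mean uniqueness up to \<open>o\<^sub>p(1)\<close>.\<close>

definition op_root_n_solution ::
    "'w measure \<Rightarrow> (real^'q) set \<Rightarrow> (nat \<Rightarrow> 'w \<Rightarrow> real^'q \<Rightarrow> real^'q) \<Rightarrow>
     (nat \<Rightarrow> 'w \<Rightarrow> real^'q) \<Rightarrow> bool" where
  "op_root_n_solution M L g s \<longleftrightarrow>
     (\<forall>n. s n \<in> borel_measurable M \<and> (\<forall>\<omega>\<in>space M. s n \<omega> \<in> L)) \<and>
     tendsto_in_prob M (\<lambda>n \<omega>. sqrt (real n) *\<^sub>R g n \<omega> (s n \<omega>)) 0"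

definition unique_op_root_n_solution ::
    "'w measure \<Rightarrow> (real^'q) set \<Rightarrow> (nat \<Rightarrow> 'w \<Rightarrow> real^'q \<Rightarrow> real^'q) \<Rightarrow> bool" where
  "unique_op_root_n_solution M L g \<longleftrightarrow>
     (\<exists>s. op_root_n_solution M L g s) \<and>
     (\<forall>s s'. op_root_n_solution M L g s \<and> op_root_n_solution M L g s' \<longrightarrow>
        tendsto_in_prob M (\<lambda>n \<omega>. s n \<omega> - s' n \<omega>) 0)"

end

theory Submission
  imports Defs
begin

text \<open>
  Once \<open>lhat\<close> is consistent, \<open>(\<theta>hat lhat, lhat, \<theta>hat' lhat)\<close> is a consistent exact zero of the sample
  mean of \<^const>\<open>eta\<close>, so the theorem is the sandwich formula \<open>B\<^sup>-\<^sup>1 K B\<^sup>-\<^sup>T\<close> for estimating equations,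
  \<open>B\<close> being the Jacobian of the mean of \<^const>\<open>eta\<close> at \<open>\<alpha>0\<close>, projected to the first block; in the endpoint case
  it is the same formula for \<open>\<phi>\<close> at the fixed endpoint. Block elimination shows that the summands of
  \<^const>\<open>sample.V1_hat\<close> are exactly the projections of \<open>-B\<^sup>-\<^sup>1 eta\<close> for the empirical \<open>B\<close>.
  Consistency of \<open>lhat\<close> comes from the uniqueness hypothesis: the sample mean of \<^const>\<open>eta\<close> has a
  measurable zero near \<open>\<alpha>0\<close>, its middle block is a stationary point of \<^const>\<open>sample.TE\<close>, and so is \<open>lhat\<close>.
\<close>

text \<open>Two obstacles shape the argument. The uniqueness hypothesis compares measurable
  sequences with values in \<open>L\<close>, so the zero of the sample mean of eta has to be
  selected measurably. And closeness of \<open>lhat\<close> to \<open>l0\<close> does not by itself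
  control \<open>\<theta>hat\<close> and its derivative at \<open>lhat\<close>, since no uniform
  convergence of \<open>\<theta>hat\<close> is assumed. For this the middle equation is replaced by
  the condition that \<lambda> equals a given value. The modified system still has a nonsingular
  limit Jacobian, because the \<theta>-rows of \<open>B\<close> are
  \<open>T (\<theta> - D \<lambda>)\<close> for an invertible \<open>T\<close> and the D-rows act on
  the columns of D through the same \<open>T\<close>. A quantitative inverse function theorem then
  yields a zero near \<open>\<alpha>0\<close>, and uniqueness of the sample solution identifies it
  with the point over the given \<lambda>. The analytic estimates are deterministic: the uniform law
  of large numbers puts the sample Jacobian close to \<open>B\<close> on events of probability
  tending to one, and on such an event a fixed \<omega> is considered.\<close>

section \<open>Stochastic convergence and the law of large numbers\<close>

context prob_space
begin

lemma with_prob_to_oneI: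
  assumes "\<And>n. A n \<in> events" "\<And>n \<omega>. \<omega> \<in> A n \<Longrightarrow> P n \<omega>" "(\<lambda>n. prob (A n)) \<longlonglongrightarrow> 1"
  shows "with_prob_to_one M P"
  using assms sets.sets_into_space unfolding with_prob_to_one_def
  by (intro exI[of _ A]) blast

lemma with_prob_to_one_mono:
  assumes "with_prob_to_one M P" "\<And>n \<omega>. \<omega> \<in> space M \<Longrightarrow> P n \<omega> \<Longrightarrow> Q n \<omega>"
  shows "with_prob_to_one M Q"
proof -
  from assms(1) obtain A where "\<forall>n. A n \<in> events \<and> A n \<subseteq> {\<omega> \<in> space M. P n \<omega>}"
    "(\<lambda>n. prob (A n)) \<longlonglongrightarrow> 1"
    unfolding with_prob_to_one_def by blast
  then show ?thesis
    using assms(2) by (intro with_prob_to_oneI[of A]) blast+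
qed

lemma with_prob_to_one_conj:
  assumes "with_prob_to_one M P" "with_prob_to_one M Q"
  shows "with_prob_to_one M (\<lambda>n \<omega>. P n \<omega> \<and> Q n \<omega>)"
proof -
  from assms(1) obtain A where A: "\<And>n. A n \<in> events" "\<And>n. A n \<subseteq> {\<omega> \<in> space M. P n \<omega>}"
    "(\<lambda>n. prob (A n)) \<longlonglongrightarrow> 1"
    unfolding with_prob_to_one_def by blast
  from assms(2) obtain B where B: "\<And>n. B n \<in> events" "\<And>n. B n \<subseteq> {\<omega> \<in> space M. Q n \<omega>}"
    "(\<lambda>n. prob (B n)) \<longlonglongrightarrow> 1"
    unfolding with_prob_to_one_def by blast
  have low: "prob (A n) + prob (B n) - 1 \<le> prob (A n \<inter> B n)" for n
  proof -
    have "prob (A n \<union> B n) + prob (A n \<inter> B n) = prob (A n) + prob (B n)"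
      using A(1) B(1) by (simp add: measure_Un3 fmeasurable_eq_sets)
    then show ?thesis using prob_le_1[of "A n \<union> B n"] by linarith
  qed
  have "(\<lambda>n. prob (A n) + prob (B n) - 1) \<longlonglongrightarrow> 1 + 1 - 1"
    by (intro tendsto_intros A(3) B(3))
  then have "(\<lambda>n. prob (A n) + prob (B n) - 1) \<longlonglongrightarrow> 1" by simp
  then have "(\<lambda>n. prob (A n \<inter> B n)) \<longlonglongrightarrow> 1"
    by (rule real_tendsto_sandwich[OF _ _ _ tendsto_const, rotated 2]) (auto simp: low)
  then show ?thesis
    using A B by (intro with_prob_to_oneI[of "\<lambda>n. A n \<inter> B n"]) blast+
qed

text \<open>The hypotheses on \<open>\<theta>hat\<close> and \<open>lhat\<close> hold almost surely
  and only from some \<open>n\<close> on. For the other \<open>n\<close> the empty set is a harmless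
  witness, since only the limit of the probabilities matters.\<close>

lemma with_prob_to_one_AE:
  assumes "\<forall>\<^sub>F n in sequentially. AE \<omega> in M. P n \<omega>"
  shows "with_prob_to_one M P"
proof -
  have "\<exists>A\<in>events. (\<forall>\<omega>\<in>A. P n \<omega>) \<and> ((AE \<omega> in M. P n \<omega>) \<longrightarrow> prob A = 1)" for n
  proof (cases "AE \<omega> in M. P n \<omega>")
    case True
    then obtain N where "{\<omega> \<in> space M. \<not> P n \<omega>} \<subseteq> N" "emeasure M N = 0" "N \<in> events"
      by (rule AE_E)
    then have "prob N = 0" by (simp add: measure_def)
    with \<open>N \<in> events\<close> have "prob (space M - N) = 1" by (simp add: prob_compl)
    with \<open>{\<omega> \<in> space M. \<not> P n \<omega>} \<subseteq> N\<close> \<open>N \<in> events\<close> show ?thesis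
      by (intro bexI[of _ "space M - N"]) auto
  qed (auto intro: bexI[of _ "{}"])
  then obtain A where A: "\<And>n. A n \<in> events" "\<And>n \<omega>. \<omega> \<in> A n \<Longrightarrow> P n \<omega>"
    "\<And>n. (AE \<omega> in M. P n \<omega>) \<Longrightarrow> prob (A n) = 1"
    by metis
  have "(\<lambda>n. prob (A n)) \<longlonglongrightarrow> 1"
    using assms by (intro tendsto_eventually) (auto elim: eventually_mono simp: A(3))
  with A show ?thesis by (intro with_prob_to_oneI[of A])
qed

lemma with_prob_to_one_eventually:
  "\<forall>\<^sub>F n in sequentially. \<forall>\<omega>\<in>space M. P n \<omega> \<Longrightarrow> with_prob_to_one M P"
  by (rule with_prob_to_one_AE) (auto elim: eventually_mono)

lemma with_prob_to_one_finite_all: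
  assumes "finite I" "\<And>i. i \<in> I \<Longrightarrow> with_prob_to_one M (P i)"
  shows "with_prob_to_one M (\<lambda>n \<omega>. \<forall>i\<in>I. P i n \<omega>)"
  using assms
proof (induction I rule: finite_induct)
  case (insert i I)
  then have "with_prob_to_one M (\<lambda>n \<omega>. P i n \<omega> \<and> (\<forall>i\<in>I. P i n \<omega>))"
    by (intro with_prob_to_one_conj) auto
  then show ?case by (rule with_prob_to_one_mono) auto
qed (simp add: with_prob_to_one_eventually)

text \<open>Passing to complements of the enclosing events. In this form a proof of convergence in
  probability intersects finitely many events and then argues about one fixed \<omega>.\<close>

lemma tendsto_in_prob_iff:
  "tendsto_in_prob M X c \<longleftrightarrow> (\<forall>\<epsilon>>0. with_prob_to_one M (\<lambda>n \<omega>. dist (X n \<omega>) c < \<epsilon>))"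
proof (intro iffI allI impI)
  fix \<epsilon> :: real assume "tendsto_in_prob M X c" "\<epsilon> > 0"
  then obtain A where A: "\<And>n. A n \<in> events" "\<And>n. {\<omega> \<in> space M. dist (X n \<omega>) c \<ge> \<epsilon>} \<subseteq> A n"
    "(\<lambda>n. prob (A n)) \<longlonglongrightarrow> 0"
    unfolding tendsto_in_prob_def by metis
  have "(\<lambda>n. 1 - prob (A n)) \<longlonglongrightarrow> 1 - 0" by (intro tendsto_intros A(3))
  then show "with_prob_to_one M (\<lambda>n \<omega>. dist (X n \<omega>) c < \<epsilon>)"
    using A by (intro with_prob_to_oneI[of "\<lambda>n. space M - A n"]) (auto simp: prob_compl not_le[symmetric])
next
  assume *: "\<forall>\<epsilon>>0. with_prob_to_one M (\<lambda>n \<omega>. dist (X n \<omega>) c < \<epsilon>)"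
  show "tendsto_in_prob M X c"
    unfolding tendsto_in_prob_def
  proof (intro allI impI)
    fix \<epsilon> :: real assume "\<epsilon> > 0"
    with * obtain A where A: "\<And>n. A n \<in> events" "\<And>n. A n \<subseteq> {\<omega> \<in> space M. dist (X n \<omega>) c < \<epsilon>}"
      "(\<lambda>n. prob (A n)) \<longlonglongrightarrow> 1"
      unfolding with_prob_to_one_def by metis
    have "(\<lambda>n. 1 - prob (A n)) \<longlonglongrightarrow> 1 - 1" by (intro tendsto_intros A(3))
    then show "\<exists>A. (\<forall>n. A n \<in> events \<and> {\<omega> \<in> space M. \<epsilon> \<le> dist (X n \<omega>) c} \<subseteq> A n) \<and>
        (\<lambda>n. prob (A n)) \<longlonglongrightarrow> 0"
      using A(1) by (intro exI[of _ "\<lambda>n. space M - A n"]) (use A(2) in \<open>force simp: prob_compl\<close>)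
  qed
qed

lemma tendsto_in_probD:
  "tendsto_in_prob M X c \<Longrightarrow> \<epsilon> > 0 \<Longrightarrow> with_prob_to_one M (\<lambda>n \<omega>. dist (X n \<omega>) c < \<epsilon>)"
  by (simp add: tendsto_in_prob_iff)

lemma tendsto_in_prob_eventually_in:
  assumes "tendsto_in_prob M X c" "open U" "c \<in> U"
  shows "with_prob_to_one M (\<lambda>n \<omega>. X n \<omega> \<in> U)"
proof -
  from assms(2,3) obtain e where "e > 0" "\<And>y. dist y c < e \<Longrightarrow> y \<in> U"
    unfolding open_dist by blast
  then show ?thesis by (intro with_prob_to_one_mono[OF tendsto_in_probD[OF assms(1)], of e]) auto
qed

text \<open>Closed forms of the estimates are available only where derivatives and inverses exist; a
  change off events of probability tending to one does not affect the limit.\<close>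

lemma tendsto_in_prob_cong:
  assumes "tendsto_in_prob M X c" "with_prob_to_one M (\<lambda>n \<omega>. Y n \<omega> = X n \<omega>)"
  shows "tendsto_in_prob M Y c"
  unfolding tendsto_in_prob_iff
proof (intro allI impI)
  fix \<epsilon> :: real assume "\<epsilon> > 0"
  then show "with_prob_to_one M (\<lambda>n \<omega>. dist (Y n \<omega>) c < \<epsilon>)"
    by (rule with_prob_to_one_mono[OF with_prob_to_one_conj[OF tendsto_in_probD[OF assms(1)] assms(2)]]) auto
qed

lemma tendsto_in_prob_const: "tendsto_in_prob M (\<lambda>n \<omega>. c) c"
  unfolding tendsto_in_prob_iff by (auto intro!: with_prob_to_one_eventually)

lemma tendsto_in_prob_Pair:
  assumes "tendsto_in_prob M X c" "tendsto_in_prob M Y d"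
  shows "tendsto_in_prob M (\<lambda>n \<omega>. (X n \<omega>, Y n \<omega>)) (c, d)"
  unfolding tendsto_in_prob_iff
proof (intro allI impI)
  fix \<epsilon> :: real assume "\<epsilon> > 0"
  then have *: "\<epsilon>/2 > 0" by simp
  show "with_prob_to_one M (\<lambda>n \<omega>. dist (X n \<omega>, Y n \<omega>) (c, d) < \<epsilon>)"
  proof (rule with_prob_to_one_mono[OF with_prob_to_one_conj[OF tendsto_in_probD[OF assms(1) *]
        tendsto_in_probD[OF assms(2) *]]])
    fix n \<omega> assume "dist (X n \<omega>) c < \<epsilon>/2 \<and> dist (Y n \<omega>) d < \<epsilon>/2"
    moreover have "dist (X n \<omega>, Y n \<omega>) (c, d) \<le> dist (X n \<omega>) c + dist (Y n \<omega>) d"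
      unfolding dist_Pair_Pair by (rule sqrt_sum_squares_le_sum) auto
    ultimately show "dist (X n \<omega>, Y n \<omega>) (c, d) < \<epsilon>" by linarith
  qed
qed

lemma tendsto_in_prob_isCont:
  assumes "tendsto_in_prob M X c" "isCont g c"
  shows "tendsto_in_prob M (\<lambda>n \<omega>. g (X n \<omega>)) (g c)"
  unfolding tendsto_in_prob_iff
proof (intro allI impI)
  fix \<epsilon> :: real assume "\<epsilon> > 0"
  with assms(2) obtain d where d: "d > 0" "\<And>x. dist x c < d \<Longrightarrow> dist (g x) (g c) < \<epsilon>"
    unfolding continuous_at_eps_delta by blast
  then show "with_prob_to_one M (\<lambda>n \<omega>. dist (g (X n \<omega>)) (g c) < \<epsilon>)"
    by (intro with_prob_to_one_mono[OF tendsto_in_probD[OF assms(1) d(1)]]) auto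
qed

lemma tendsto_in_prob_vec:
  fixes X :: "nat \<Rightarrow> 'a \<Rightarrow> 'v::metric_space ^ 'n"
  assumes "\<And>i. tendsto_in_prob M (\<lambda>n \<omega>. X n \<omega> $ i) (c $ i)"
  shows "tendsto_in_prob M X c"
  unfolding tendsto_in_prob_iff
proof (intro allI impI)
  fix \<epsilon> :: real assume "\<epsilon> > 0"
  define d where "d = \<epsilon> / real CARD('n)"
  have "d > 0" using \<open>\<epsilon> > 0\<close> by (simp add: d_def)
  then have "with_prob_to_one M (\<lambda>n \<omega>. \<forall>i\<in>UNIV. dist (X n \<omega> $ i) (c $ i) < d)"
    by (intro with_prob_to_one_finite_all tendsto_in_probD[OF assms]) auto
  then show "with_prob_to_one M (\<lambda>n \<omega>. dist (X n \<omega>) c < \<epsilon>)"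
  proof (rule with_prob_to_one_mono)
    fix n \<omega> assume *: "\<forall>i\<in>UNIV. dist (X n \<omega> $ i) (c $ i) < d"
    have "dist (X n \<omega>) c \<le> (\<Sum>i\<in>UNIV. dist (X n \<omega> $ i) (c $ i))"
      unfolding dist_vec_def by (rule L2_set_le_sum) auto
    also have "\<dots> < (\<Sum>i\<in>(UNIV::'n set). d)"
      using * by (intro sum_strict_mono) auto
    finally show "dist (X n \<omega>) c < \<epsilon>" by (simp add: d_def)
  qed
qed

lemma tendsto_in_prob_measurableI:
  fixes X :: "nat \<Rightarrow> 'a \<Rightarrow> real"
  assumes "\<And>n. X n \<in> borel_measurable M"
    "\<And>\<epsilon>. \<epsilon> > 0 \<Longrightarrow> (\<lambda>n. prob {\<omega> \<in> space M. \<epsilon> \<le> \<bar>X n \<omega> - c\<bar>}) \<longlonglongrightarrow> 0"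
  shows "tendsto_in_prob M X c"
  unfolding tendsto_in_prob_def dist_real_def
proof (intro allI impI)
  fix \<epsilon> :: real assume "\<epsilon> > 0"
  let ?A = "\<lambda>n. {\<omega> \<in> space M. \<epsilon> \<le> \<bar>X n \<omega> - c\<bar>}"
  note [measurable] = assms(1)
  have "?A n \<in> events" for n by measurable
  with assms(2)[OF \<open>\<epsilon> > 0\<close>]
  show "\<exists>A. (\<forall>n. A n \<in> events \<and> ?A n \<subseteq> A n) \<and> (\<lambda>n. prob (A n)) \<longlonglongrightarrow> 0"
    by (intro exI[of _ ?A]) simp
qed

lemma prob_norm_ge_le:
  fixes X :: "'a \<Rightarrow> 'v::euclidean_space"
  assumes X: "X \<in> borel_measurable M" and "integrable M (\<lambda>\<omega>. (norm (X \<omega>))\<^sup>2)" "\<epsilon> > 0"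
  shows "prob {\<omega> \<in> space M. \<epsilon> \<le> norm (X \<omega>)} \<le> expectation (\<lambda>\<omega>. (norm (X \<omega>))\<^sup>2) / \<epsilon>\<^sup>2"
proof -
  have "prob {\<omega> \<in> space M. \<epsilon>\<^sup>2 \<le> (norm (X \<omega>))\<^sup>2} \<le> expectation (\<lambda>\<omega>. (norm (X \<omega>))\<^sup>2) / \<epsilon>\<^sup>2"
    using assms by (intro integral_Markov_inequality_measure[where A="{}"]) auto
  moreover have "(\<epsilon>\<^sup>2 \<le> (norm (X \<omega>))\<^sup>2) = (\<epsilon> \<le> norm (X \<omega>))" for \<omega>
    using \<open>\<epsilon> > 0\<close> by (simp add: abs_le_square_iff[symmetric])
  ultimately show ?thesis by simp
qed

end

section \<open>Averages of i.i.d. variables and the weak law of large numbers\<close>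

locale iid_sample = prob_space M for M :: "'w measure" +
  fixes F :: "'z measure" and Z :: "nat \<Rightarrow> 'w \<Rightarrow> 'z"
  assumes indep: "indep_vars (\<lambda>_. F) Z UNIV"
    and distr_Z: "\<And>i. distr M F (Z i) = F"
begin

lemma Z_measurable [measurable]: "Z i \<in> M \<rightarrow>\<^sub>M F"
  using indep by (simp add: indep_vars_def)

lemma prob_space_F: "prob_space F"
  using prob_space_distr[OF Z_measurable] by (simp add: distr_Z)

lemma integrable_Z:
  fixes f :: "'z \<Rightarrow> 'v::{banach,second_countable_topology}"
  shows "integrable F f \<Longrightarrow> integrable M (\<lambda>\<omega>. f (Z i \<omega>))"
  using integrable_distr[OF Z_measurable, of i f] by (simp add: distr_Z)

lemma expectation_Z:
  fixes f :: "'z \<Rightarrow> 'v::{banach,second_countable_topology}"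
  assumes "f \<in> borel_measurable F"
  shows "(\<integral>\<omega>. f (Z i \<omega>) \<partial>M) = (\<integral>z. f z \<partial>F)"
  using integral_distr[OF Z_measurable assms, of i] by (simp add: distr_Z)

lemma indep_vars_Z: 
  assumes "f \<in> borel_measurable F"
  shows "indep_vars (\<lambda>_. borel) (\<lambda>i \<omega>. f (Z i \<omega>)) UNIV"
  using indep_vars_compose2[OF indep, of "\<lambda>_. f" "\<lambda>_. borel"] assms by simp

lemma indep_var_Z:
  fixes f :: "'z \<Rightarrow> real"
  assumes "f \<in> borel_measurable F" "i \<noteq> j"
  shows "indep_var borel (\<lambda>\<omega>. f (Z i \<omega>)) borel (\<lambda>\<omega>. f (Z j \<omega>))"
  using indep_vars_sum[of "{j}" i "\<lambda>i \<omega>. f (Z i \<omega>)"] assms(2)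
    indep_vars_subset[OF indep_vars_Z[OF assms(1)], of "{i, j}"]
  by simp

definition avg :: "('z \<Rightarrow> 'v::real_vector) \<Rightarrow> nat \<Rightarrow> 'w \<Rightarrow> 'v" where
  "avg f n \<omega> = (1 / real n) *\<^sub>R (\<Sum>i<n. f (Z i \<omega>))"

lemma avg_measurable [measurable]:
  fixes f :: "'z \<Rightarrow> 'v::{second_countable_topology,real_normed_vector}"
  assumes [measurable]: "f \<in> borel_measurable F"
  shows "avg f n \<in> borel_measurable M"
  unfolding avg_def by measurable

text \<open>Expanding the square leaves only the diagonal: off it, independence factors the
  expectation into two vanishing means.\<close>

lemma second_moment_sum:
  fixes f :: "'z \<Rightarrow> real"
  assumes f [measurable]: "f \<in> borel_measurable F" and sq: "integrable F (\<lambda>z. (f z)\<^sup>2)"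
    and "(\<integral>z. f z \<partial>F) = 0"
  shows "integrable M (\<lambda>\<omega>. (\<Sum>i<n. f (Z i \<omega>))\<^sup>2)"
    and "expectation (\<lambda>\<omega>. (\<Sum>i<n. f (Z i \<omega>))\<^sup>2) = real n * (\<integral>z. (f z)\<^sup>2 \<partial>F)"
proof -
  interpret F: prob_space F by (rule prob_space_F)
  have f_int: "integrable F f"
    by (rule F.square_integrable_imp_integrable[OF f sq])
  have int: "integrable M (\<lambda>\<omega>. f (Z i \<omega>) * f (Z j \<omega>))" for i j
  proof (cases "i = j")
    case True
    then show ?thesis using integrable_Z[OF sq, of i] by (simp add: power2_eq_square)
  next
    case False
    then have "indep_var borel (\<lambda>\<omega>. f (Z i \<omega>)) borel (\<lambda>\<omega>. f (Z j \<omega>))"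
      by (rule indep_var_Z[OF f])
    then show ?thesis by (intro indep_var_integrable integrable_Z f_int)
  qed
  have exp: "expectation (\<lambda>\<omega>. f (Z i \<omega>) * f (Z j \<omega>)) = (if i = j then (\<integral>z. (f z)\<^sup>2 \<partial>F) else 0)" for i j
  proof (cases "i = j")
    case True
    then show ?thesis using expectation_Z[of "\<lambda>z. (f z)\<^sup>2" i] by (simp add: power2_eq_square)
  next
    case False
    then have "indep_var borel (\<lambda>\<omega>. f (Z i \<omega>)) borel (\<lambda>\<omega>. f (Z j \<omega>))"
      by (rule indep_var_Z[OF f])
    from indep_var_lebesgue_integral[OF this integrable_Z[OF f_int] integrable_Z[OF f_int]]
    show ?thesis using False assms(3) by (simp add: expectation_Z)
  qed
  have eq: "(\<Sum>i<n. f (Z i \<omega>))\<^sup>2 = (\<Sum>i<n. \<Sum>j<n. f (Z i \<omega>) * f (Z j \<omega>))" for \<omega>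
    by (simp add: power2_eq_square sum_product)
  show "integrable M (\<lambda>\<omega>. (\<Sum>i<n. f (Z i \<omega>))\<^sup>2)"
    unfolding eq by (intro Bochner_Integration.integrable_sum int)
  show "expectation (\<lambda>\<omega>. (\<Sum>i<n. f (Z i \<omega>))\<^sup>2) = real n * (\<integral>z. (f z)\<^sup>2 \<partial>F)"
    unfolding eq by (simp add: Bochner_Integration.integral_sum int exp)
qed

lemma weak_law_square_integrable:
  fixes f :: "'z \<Rightarrow> real"
  assumes f [measurable]: "f \<in> borel_measurable F" and sq: "integrable F (\<lambda>z. (f z)\<^sup>2)" and "\<epsilon> > 0"
  shows "(\<lambda>n. prob {\<omega> \<in> space M. \<epsilon> \<le> \<bar>avg f n \<omega> - (\<integral>z. f z \<partial>F)\<bar>}) \<longlonglongrightarrow> 0"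
proof -
  interpret F: prob_space F by (rule prob_space_F)
  have f_int: "integrable F f"
    by (rule F.square_integrable_imp_integrable[OF f sq])
  define \<mu> where "\<mu> = (\<integral>z. f z \<partial>F)"
  define g where "g z = f z - \<mu>" for z
  define s where "s = (\<integral>z. (g z)\<^sup>2 \<partial>F)"
  have g [measurable]: "g \<in> borel_measurable F" unfolding g_def by measurable
  have g_sq: "integrable F (\<lambda>z. (g z)\<^sup>2)"
    unfolding g_def power2_diff using sq f_int by auto
  have g0: "(\<integral>z. g z \<partial>F) = 0"
    unfolding g_def using f_int by (simp add: \<mu>_def F.prob_space)
  note mom = second_moment_sum[OF g g_sq g0]
  have *: "\<bar>prob {\<omega> \<in> space M. \<epsilon> \<le> \<bar>avg f n \<omega> - \<mu>\<bar>}\<bar> \<le> s / \<epsilon>\<^sup>2 * inverse (real n)" if "n > 0" for n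
  proof -
    have eq: "avg f n \<omega> - \<mu> = (\<Sum>i<n. g (Z i \<omega>)) / real n" for \<omega>
      using that by (simp add: avg_def g_def sum_subtractf field_simps)
    have "prob {\<omega> \<in> space M. \<epsilon> \<le> norm ((\<Sum>i<n. g (Z i \<omega>)) / real n)}
       \<le> expectation (\<lambda>\<omega>. (norm ((\<Sum>i<n. g (Z i \<omega>)) / real n))\<^sup>2) / \<epsilon>\<^sup>2"
      using mom(1)[of n] \<open>\<epsilon> > 0\<close>
      by (intro prob_norm_ge_le) (auto simp: power_divide)
    also have "\<dots> = s / \<epsilon>\<^sup>2 * inverse (real n)"
      using mom(2)[of n] that by (simp add: power_divide s_def power2_eq_square field_simps)
    finally show ?thesis by (simp add: eq abs_divide)
  qed
  have lim: "(\<lambda>n. s / \<epsilon>\<^sup>2 * inverse (real n)) \<longlonglongrightarrow> 0"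
    by (intro tendsto_mult_right_zero lim_inverse_n)
  show ?thesis
    unfolding \<mu>_def[symmetric]
    by (rule tendsto_rabs_zero_cancel, rule tendsto_sandwich[OF _ _ tendsto_const lim])
       (use * in \<open>auto intro!: eventually_sequentiallyI[of 1]\<close>)
qed

text \<open>Khinchin's law by truncation: Chebyshev's inequality treats the bounded part, Markov's
  the remainder. First moments have to suffice, because the law is later applied to products of
  components of an estimating function, whose envelope \<open>m0\<^sup>2\<close> is merely
  integrable.\<close>

theorem weak_law_of_large_numbers:
  fixes f :: "'z \<Rightarrow> real"
  assumes "integrable F f"
  shows "tendsto_in_prob M (avg f) (\<integral>z. f z \<partial>F)"
proof (rule tendsto_in_prob_measurableI)
  interpret F: prob_space F by (rule prob_space_F)
  have f [measurable]: "f \<in> borel_measurable F" using assms by auto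
  show "avg f n \<in> borel_measurable M" for n by measurable
  fix \<epsilon> :: real assume \<epsilon>: "\<epsilon> > 0"
  define \<mu> where "\<mu> = (\<integral>z. f z \<partial>F)"
  define g where "g c z = (if \<bar>f z\<bar> \<le> real c then f z else 0)" for c z
  have g [measurable]: "g c \<in> borel_measurable F" for c unfolding g_def by measurable
  have g_int: "integrable F (g c)" for c
    by (rule F.integrable_const_bound[where B="real c"]) (auto simp: g_def)
  have g_sq: "integrable F (\<lambda>z. (g c z)\<^sup>2)" for c
    by (rule F.integrable_const_bound[where B="(real c)\<^sup>2"]) (auto simp: g_def abs_le_square_iff[symmetric])
  have L1: "(\<lambda>c. \<integral>z. \<bar>f z - g c z\<bar> \<partial>F) \<longlonglongrightarrow> (\<integral>z. 0 \<partial>F)"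
  proof (rule integral_dominated_convergence[where w="\<lambda>z. \<bar>f z\<bar>"])
    show "AE z in F. (\<lambda>c. \<bar>f z - g c z\<bar>) \<longlonglongrightarrow> 0"
    proof (intro AE_I2 tendsto_eventually)
      fix z
      show "\<forall>\<^sub>F c in sequentially. \<bar>f z - g c z\<bar> = 0"
        using eventually_ge_at_top[of "nat \<lceil>\<bar>f z\<bar>\<rceil>"]
        by eventually_elim (auto simp: g_def nat_le_iff ceiling_le_iff)
    qed
  qed (use assms in \<open>auto simp: g_def\<close>)
  show "(\<lambda>n. prob {\<omega> \<in> space M. \<epsilon> \<le> \<bar>avg f n \<omega> - (\<integral>z. f z \<partial>F)\<bar>}) \<longlonglongrightarrow> 0"
    unfolding \<mu>_def[symmetric]
  proof (rule LIMSEQ_I)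
    fix \<eta> :: real assume \<eta>: "\<eta> > 0"
    \<comment> \<open>The truncation level meets two demands on the tail: below
      \<open>\<epsilon>/3\<close> it bounds the bias of the truncated mean, below
      \<open>\<epsilon>/3 * (\<eta>/2)\<close> it gives probability less than
      \<open>\<eta>/2\<close> in Markov's inequality.\<close>
    have "min (\<epsilon>/3) (\<epsilon>/3 * (\<eta>/2)) > 0" using \<epsilon> \<eta> by auto
    with L1 have "\<forall>\<^sub>F c in sequentially. (\<integral>z. \<bar>f z - g c z\<bar> \<partial>F) < min (\<epsilon>/3) (\<epsilon>/3 * (\<eta>/2))"
      by (intro order_tendstoD(2)) auto
    then obtain c where c: "(\<integral>z. \<bar>f z - g c z\<bar> \<partial>F) < min (\<epsilon>/3) (\<epsilon>/3 * (\<eta>/2))"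
      by (meson eventually_sequentially order_refl)
    define r where "r z = \<bar>f z - g c z\<bar>" for z
    have r [measurable]: "r \<in> borel_measurable F" unfolding r_def by measurable
    have r_int: "integrable F r" unfolding r_def using assms g_int by auto
    define \<nu> where "\<nu> = (\<integral>z. g c z \<partial>F)"
    have \<nu>: "\<bar>\<mu> - \<nu>\<bar> < \<epsilon>/3"
    proof -
      have "\<mu> - \<nu> = (\<integral>z. f z - g c z \<partial>F)" using assms g_int by (simp add: \<mu>_def \<nu>_def)
      also have "\<bar>\<dots>\<bar> \<le> (\<integral>z. \<bar>f z - g c z\<bar> \<partial>F)" by (rule integral_abs_bound)
      finally show ?thesis using c by linarith
    qed
    have "(\<lambda>n. prob {\<omega> \<in> space M. \<epsilon>/3 \<le> \<bar>avg (g c) n \<omega> - \<nu>\<bar>}) \<longlonglongrightarrow> 0"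
      unfolding \<nu>_def using \<epsilon> by (intro weak_law_square_integrable g g_sq) auto
    from LIMSEQ_D[OF this, of "\<eta>/2"] \<eta> obtain n0 where
      n0: "\<And>n. n \<ge> n0 \<Longrightarrow> prob {\<omega> \<in> space M. \<epsilon>/3 \<le> \<bar>avg (g c) n \<omega> - \<nu>\<bar>} < \<eta>/2" by auto
    show "\<exists>n0. \<forall>n\<ge>n0. norm (prob {\<omega> \<in> space M. \<epsilon> \<le> \<bar>avg f n \<omega> - \<mu>\<bar>} - 0) < \<eta>"
    proof (intro exI[of _ "max n0 1"] allI impI)
      fix n assume n: "max n0 1 \<le> n"
      have sub: "{\<omega> \<in> space M. \<epsilon> \<le> \<bar>avg f n \<omega> - \<mu>\<bar>} \<subseteq>
         {\<omega> \<in> space M. \<epsilon>/3 \<le> \<bar>avg (g c) n \<omega> - \<nu>\<bar>} \<union> {\<omega> \<in> space M. \<epsilon>/3 \<le> avg r n \<omega>}"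
      proof (intro subsetI UnCI)
        fix \<omega> assume "\<omega> \<in> {\<omega> \<in> space M. \<epsilon> \<le> \<bar>avg f n \<omega> - \<mu>\<bar>}" "\<omega> \<notin> {\<omega> \<in> space M. \<epsilon>/3 \<le> avg r n \<omega>}"
        then have h: "\<omega> \<in> space M" "\<epsilon> \<le> \<bar>avg f n \<omega> - \<mu>\<bar>" "avg r n \<omega> < \<epsilon>/3" by auto
        have "\<bar>avg f n \<omega> - avg (g c) n \<omega>\<bar> = \<bar>\<Sum>i<n. f (Z i \<omega>) - g c (Z i \<omega>)\<bar> / real n"
          by (simp add: avg_def sum_subtractf diff_divide_distrib[symmetric] abs_divide)
        also have "\<dots> \<le> avg r n \<omega>"
          unfolding avg_def r_def by (auto intro!: divide_right_mono sum_abs)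
        finally have "\<bar>avg f n \<omega> - avg (g c) n \<omega>\<bar> \<le> avg r n \<omega>" .
        with h \<nu> have "\<epsilon>/3 \<le> \<bar>avg (g c) n \<omega> - \<nu>\<bar>" by linarith
        with h(1) show "\<omega> \<in> {\<omega> \<in> space M. \<epsilon>/3 \<le> \<bar>avg (g c) n \<omega> - \<nu>\<bar>}" by simp
      qed
      have ravg: "integrable M (avg r n)"
        unfolding avg_def by (intro integrable_scaleR_right Bochner_Integration.integrable_sum integrable_Z r_int)
      have "expectation (avg r n) = (1 / real n) * (\<Sum>i<n. expectation (\<lambda>\<omega>. r (Z i \<omega>)))"
        unfolding avg_def by (simp add: Bochner_Integration.integral_sum integrable_Z[OF r_int])
      then have "expectation (avg r n) = (\<integral>z. r z \<partial>F)"
        using n by (simp add: expectation_Z[OF r])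
      moreover have "prob {\<omega> \<in> space M. \<epsilon>/3 \<le> avg r n \<omega>} \<le> expectation (avg r n) / (\<epsilon>/3)"
        using \<epsilon> by (intro integral_Markov_inequality_measure[where A="{}"] ravg)
          (auto simp: avg_def r_def sum_nonneg)
      ultimately have "prob {\<omega> \<in> space M. \<epsilon>/3 \<le> avg r n \<omega>} \<le> (\<integral>z. r z \<partial>F) / (\<epsilon>/3)" by simp
      also have "\<dots> < \<eta>/2"
        using c \<epsilon> by (simp add: r_def field_simps)
      finally have m2: "prob {\<omega> \<in> space M. \<epsilon>/3 \<le> avg r n \<omega>} < \<eta>/2" .
      have "prob {\<omega> \<in> space M. \<epsilon> \<le> \<bar>avg f n \<omega> - \<mu>\<bar>} \<le>
         prob ({\<omega> \<in> space M. \<epsilon>/3 \<le> \<bar>avg (g c) n \<omega> - \<nu>\<bar>} \<union> {\<omega> \<in> space M. \<epsilon>/3 \<le> avg r n \<omega>})"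
        by (rule finite_measure_mono[OF sub]) measurable
      also have "\<dots> \<le> prob {\<omega> \<in> space M. \<epsilon>/3 \<le> \<bar>avg (g c) n \<omega> - \<nu>\<bar>} + prob {\<omega> \<in> space M. \<epsilon>/3 \<le> avg r n \<omega>}"
        by (rule measure_Un_le) measurable
      also have "\<dots> < \<eta>" using n0[of n] n m2 by simp
      finally show "norm (prob {\<omega> \<in> space M. \<epsilon> \<le> \<bar>avg f n \<omega> - \<mu>\<bar>} - 0) < \<eta>" by simp
    qed
  qed
qed

lemma tendsto_in_prob_avg_vec:
  fixes f :: "'z \<Rightarrow> real^'m"
  assumes "integrable F f"
  shows "tendsto_in_prob M (avg f) (\<integral>z. f z \<partial>F)"
proof (rule tendsto_in_prob_vec)
  fix i
  have "avg f n \<omega> $ i = avg (\<lambda>z. f z $ i) n \<omega>" for n \<omega>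
    by (simp add: avg_def sum_component)
  moreover have "(\<integral>z. f z \<partial>F) $ i = (\<integral>z. f z $ i \<partial>F)"
    by (rule integral_bounded_linear[OF bounded_linear_vec_nth assms, symmetric])
  moreover have "tendsto_in_prob M (avg (\<lambda>z. f z $ i)) (\<integral>z. f z $ i \<partial>F)"
    by (intro weak_law_of_large_numbers integrable_bounded_linear[OF bounded_linear_vec_nth assms])
  ultimately show "tendsto_in_prob M (\<lambda>n \<omega>. avg f n \<omega> $ i) ((\<integral>z. f z \<partial>F) $ i)"
    by simp
qed

end

section \<open>Weak convergence from characteristic functions\<close>

text \<open>Real trigonometric polynomials. The free phase \<open>c\<close> covers the sines, so the
  product-to-sum formula keeps the class closed under multiplication and only expectations of
  shifted cosines have to be followed.\<close>

inductive trig_fun :: "('v::real_inner \<Rightarrow> real) \<Rightarrow> bool" where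
  cos: "trig_fun (\<lambda>x. a * cos (u \<bullet> x + c))"
| add: "trig_fun f \<Longrightarrow> trig_fun g \<Longrightarrow> trig_fun (\<lambda>x. f x + g x)"

lemma trig_fun_const: "trig_fun (\<lambda>x. c)"
  using trig_fun.cos[of c 0 0] by simp

lemma trig_fun_mult:
  assumes "trig_fun f" "trig_fun g"
  shows "trig_fun (\<lambda>x. f x * g x)"
proof -
  have *: "trig_fun (\<lambda>x. a * cos (u \<bullet> x + c) * g x)" for a u c
    using assms(2)
  proof induction
    case (cos b v d)
    have "a * cos (u \<bullet> x + c) * (b * cos (v \<bullet> x + d)) =
        a * b / 2 * cos ((u - v) \<bullet> x + (c - d)) + a * b / 2 * cos ((u + v) \<bullet> x + (c + d))" for x
    proof -
      have "cos (u \<bullet> x + c) * cos (v \<bullet> x + d) =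
          (cos ((u \<bullet> x + c) - (v \<bullet> x + d)) + cos ((u \<bullet> x + c) + (v \<bullet> x + d))) / 2"
        by (rule cos_times_cos)
      moreover have "u \<bullet> x + c - (v \<bullet> x + d) = (u - v) \<bullet> x + (c - d)"
          "u \<bullet> x + c + (v \<bullet> x + d) = (u + v) \<bullet> x + (c + d)"
        by (simp_all add: inner_add_left inner_diff_left)
      moreover have "a * r * (b * t) = a * b * (r * t)" for r t :: real by simp
      ultimately show ?thesis by (simp only:) (simp add: field_simps)
    qed
    then show ?case by (simp only:) (intro trig_fun.intros)
  next
    case (add f g)
    then show ?case by (simp only: distrib_left) (rule trig_fun.add)
  qed
  show ?thesis using assms(1)
  proof induction
    case (add f h)
    then show ?case by (simp only: distrib_right) (rule trig_fun.add)
  qed (rule *)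
qed

text \<open>Serves to compose a trigonometric polynomial with a polynomial approximation of a
  truncation without leaving the class.\<close>

lemma trig_fun_polynomial:
  fixes p :: "real \<Rightarrow> real"
  assumes "real_polynomial_function p" "trig_fun f"
  shows "trig_fun (\<lambda>x. p (f x))"
  using assms(1)
proof induction
  case (linear l)
  have "l y = y * l 1" for y
    using linear_scale[OF bounded_linear.linear[OF linear], of y 1] by simp
  then show ?case
    by (metis (no_types, lifting) trig_fun_mult[OF assms(2) trig_fun_const] ext)
next
  case (const c)
  show ?case by (rule trig_fun_const)
next
  case (add f g)
  then show ?case by (intro trig_fun.add)
next
  case (mult f g)
  then show ?case by (intro trig_fun_mult)
qed

lemma trig_fun_continuous: "trig_fun f \<Longrightarrow> continuous_on S f"
  by (induction rule: trig_fun.induct) (auto intro!: continuous_intros)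

lemma trig_fun_bounded:
  assumes "trig_fun f"
  shows "\<exists>B\<ge>0. \<forall>x. \<bar>f x\<bar> \<le> B"
  using assms
proof induction
  case (cos a u c)
  have "\<bar>a * cos (u \<bullet> x + c)\<bar> \<le> \<bar>a\<bar>" for x
    unfolding abs_mult by (rule mult_left_le) auto
  then show ?case by (intro exI[of _ "\<bar>a\<bar>"]) simp
next
  case (add f g)
  then obtain B C where "B \<ge> 0" "C \<ge> 0" "\<And>x. \<bar>f x\<bar> \<le> B" "\<And>x. \<bar>g x\<bar> \<le> C" by blast
  then show ?case
    by (intro exI[of _ "B + C"]) (auto intro: order_trans[OF abs_triangle_ineq] add_mono)
qed

text \<open>Stone--Weierstrass gives a trigonometric polynomial close to \<open>f\<close> on the ball only; composing it
  with a polynomial close to the truncation at \<open>\<plusminus>C\<close> keeps it bounded everywhere.\<close>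

lemma trig_fun_approximation:
  fixes f :: "'v::euclidean_space \<Rightarrow> real"
  assumes f: "continuous_on UNIV f" "\<And>x. \<bar>f x\<bar> \<le> C" and e: "e > 0"
  obtains g where "trig_fun g" "\<And>x. norm x \<le> R \<Longrightarrow> \<bar>f x - g x\<bar> \<le> e" "\<And>x. \<bar>g x\<bar> \<le> C + e"
proof -
  interpret T: function_ring_on "Collect trig_fun" "cball (0::'v) R"
  proof
    fix x y :: 'v assume "x \<noteq> y"
    \<comment> \<open>Scaled so that \<open>w \<bullet> (x - y) = 1\<close>. The phase of
      \<open>g\<close> then turns the cosine into
      \<open>sin (w \<bullet> z - w \<bullet> y)\<close>, which is 0 at \<open>y\<close> and
      \<open>sin 1 > 0\<close> at \<open>x\<close>.\<close>
    define w where "w = (x - y) /\<^sub>R (norm (x - y))\<^sup>2"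
    have w: "w \<bullet> x - w \<bullet> y = 1"
      using \<open>x \<noteq> y\<close> unfolding inner_diff_right[symmetric] by (simp add: w_def power2_norm_eq_inner)
    define g where "g z = 1 * cos (w \<bullet> z + (- (w \<bullet> y) - pi/2))" for z
    have "g z = sin (w \<bullet> z - w \<bullet> y)" for z
    proof -
      have "w \<bullet> z + (- (w \<bullet> y) - pi/2) = (w \<bullet> z - w \<bullet> y) - pi/2" by simp
      then show ?thesis unfolding g_def by (simp only: cos_diff) simp
    qed
    then have "g x \<noteq> g y"
      using w sin_gt_zero_02[of 1] by simp
    moreover have "trig_fun g" unfolding g_def by (rule trig_fun.cos)
    ultimately show "\<exists>f\<in>Collect trig_fun. f x \<noteq> f y" by blast
  qed (auto intro: trig_fun.add trig_fun_mult trig_fun_const trig_fun_continuous)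
  have "continuous_on (cball 0 R) f" using f(1) continuous_on_subset by blast
  from T.Stone_Weierstrass_basic[OF this, of "e/2"] e
  obtain h where h: "trig_fun h" "\<And>x. norm x \<le> R \<Longrightarrow> \<bar>f x - h x\<bar> < e/2"
    by (auto simp: dist_norm)
  from trig_fun_bounded[OF h(1)] obtain B where B: "\<And>x. \<bar>h x\<bar> \<le> B" by blast
  define k where "k y = max (- C) (min C y)" for y :: real
  have "continuous_on {-B..B} k" unfolding k_def by (intro continuous_intros)
  from Stone_Weierstrass_real_polynomial_function[OF compact_Icc this, of "e/2"] e
  obtain p where p: "real_polynomial_function p" "\<And>y. y \<in> {-B..B} \<Longrightarrow> \<bar>k y - p y\<bar> < e/2" by auto
  have hp: "\<bar>k (h x) - p (h x)\<bar> < e/2" for x using p(2) B[of x] by (auto simp: abs_le_iff)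
  show thesis
  proof
    show "trig_fun (\<lambda>x. p (h x))" by (rule trig_fun_polynomial[OF p(1) h(1)])
    show "\<bar>f x - p (h x)\<bar> \<le> e" if "norm x \<le> R" for x
    proof -
      have "\<bar>f x - k (h x)\<bar> \<le> \<bar>f x - h x\<bar>" using f(2)[of x] by (auto simp: k_def max_def min_def abs_le_iff)
      then show ?thesis using hp[of x] h(2)[OF that] by linarith
    qed
    show "\<bar>p (h x)\<bar> \<le> C + e" for x
    proof -
      have "\<bar>k (h x)\<bar> \<le> C" using f(2)[of x] by (auto simp: k_def max_def min_def abs_le_iff)
      then show ?thesis using hp[of x] e by linarith
    qed
  qed
qed

text \<open>On the ball the integrands differ by \<open>e\<close>, off it by at most
  \<open>C + D\<close>. The probability space is arbitrary because the bound is used both for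
  \<open>X n\<close> and, with the identity as variable, for the limit law.\<close>

lemma (in prob_space) expectation_diff_le_tail:
  fixes Y :: "'a \<Rightarrow> 'v::euclidean_space" and f g :: "'v \<Rightarrow> real"
  assumes [measurable]: "Y \<in> borel_measurable M" "f \<in> borel_measurable borel" "g \<in> borel_measurable borel"
    and "\<And>x. norm x \<le> R \<Longrightarrow> \<bar>f x - g x\<bar> \<le> e" and f: "\<And>x. \<bar>f x\<bar> \<le> C" and g: "\<And>x. \<bar>g x\<bar> \<le> D" and "0 \<le> e"
  shows "\<bar>expectation (\<lambda>\<omega>. f (Y \<omega>)) - expectation (\<lambda>\<omega>. g (Y \<omega>))\<bar> \<le>
      e + (C + D) * prob {\<omega> \<in> space M. R < norm (Y \<omega>)}"
proof -
  define A where "A = {\<omega> \<in> space M. R < norm (Y \<omega>)}"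
  have A [measurable]: "A \<in> events" unfolding A_def by measurable
  have CD: "0 \<le> C" "0 \<le> D" using f[of 0] g[of 0] by linarith+
  have int: "integrable M (\<lambda>\<omega>. f (Y \<omega>))" "integrable M (\<lambda>\<omega>. g (Y \<omega>))"
    by (rule integrable_const_bound[where B=C], simp add: f, simp)
       (rule integrable_const_bound[where B=D], simp add: g, simp)
  have intA: "integrable M (\<lambda>\<omega>. e + (C + D) * indicator A \<omega>)"
    by (intro Bochner_Integration.integrable_add integrable_const integrable_mult_right
          integrable_real_indicator A) (simp add: less_top[symmetric])
  have "\<bar>expectation (\<lambda>\<omega>. f (Y \<omega>)) - expectation (\<lambda>\<omega>. g (Y \<omega>))\<bar> =
      \<bar>expectation (\<lambda>\<omega>. f (Y \<omega>) - g (Y \<omega>))\<bar>"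
    using int by simp
  also have "\<dots> \<le> expectation (\<lambda>\<omega>. \<bar>f (Y \<omega>) - g (Y \<omega>)\<bar>)"
    by (rule integral_abs_bound)
  also have "\<dots> \<le> expectation (\<lambda>\<omega>. e + (C + D) * indicator A \<omega>)"
  proof (rule integral_mono)
    show "integrable M (\<lambda>\<omega>. \<bar>f (Y \<omega>) - g (Y \<omega>)\<bar>)"
      using int by auto
    show "integrable M (\<lambda>\<omega>. e + (C + D) * indicator A \<omega>)" by (rule intA)
    fix \<omega> assume \<omega>: "\<omega> \<in> space M"
    show "\<bar>f (Y \<omega>) - g (Y \<omega>)\<bar> \<le> e + (C + D) * indicator A \<omega>"
    proof (cases "\<omega> \<in> A")
      case True
      then show ?thesis using f[of "Y \<omega>"] g[of "Y \<omega>"] \<open>0 \<le> e\<close> by simp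
    next
      case False
      then show ?thesis using assms(4)[of "Y \<omega>"] \<omega> by (simp add: A_def)
    qed
  qed
  also have "\<dots> = e + (C + D) * prob A"
    by (subst Bochner_Integration.integral_add) (simp_all add: prob_space less_top[symmetric])
  finally show ?thesis by (simp add: A_def)
qed

lemma prob_space_tail_small:
  fixes N :: "'v::euclidean_space measure"
  assumes "prob_space N" and [simp, measurable_cong]: "sets N = sets borel" and "e > 0"
  shows "\<exists>R. measure N {x. R < norm x} \<le> e"
proof -
  interpret N: prob_space N by fact
  define A where "A n = {x::'v. real n < norm x}" for n :: nat
  have "(\<lambda>n. measure N (A n)) \<longlonglongrightarrow> measure N (\<Inter>n. A n)"
  proof (rule N.finite_Lim_measure_decseq)
    show "range A \<subseteq> sets N" unfolding A_def by auto
    show "decseq A" unfolding A_def decseq_def by force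
  qed
  moreover have "(\<Inter>n. A n) = {}"
  proof -
    have "\<exists>n. x \<notin> A n" for x
      using real_arch_simple[of "norm x"] by (auto simp: A_def not_less)
    then show ?thesis by blast
  qed
  ultimately have "(\<lambda>n. measure N (A n)) \<longlonglongrightarrow> 0" by simp
  from order_tendstoD(2)[OF this \<open>e > 0\<close>] obtain n where "measure N (A n) < e"
    by (auto simp: eventually_sequentially)
  then show ?thesis unfolding A_def by (intro exI[of _ "real n"]) simp
qed

text \<open>Levy's continuity theorem with tightness as a hypothesis: cosines with arbitrary phase
  carry the real and imaginary parts of the characteristic function. They extend to trigonometric
  polynomials by linearity, and these approximate a bounded continuous function on a ball outside
  which little mass lies.\<close>

lemma (in prob_space) tendsto_in_distribution_trig:
  fixes X :: "nat \<Rightarrow> 'a \<Rightarrow> 'v::euclidean_space"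
  assumes X [measurable]: "\<And>n. X n \<in> borel_measurable M"
    and N: "prob_space N" and N_sets [simp, measurable_cong]: "sets N = sets borel"
    and char: "\<And>u c. (\<lambda>n. expectation (\<lambda>\<omega>. cos (u \<bullet> X n \<omega> + c))) \<longlonglongrightarrow> (\<integral>x. cos (u \<bullet> x + c) \<partial>N)"
    and tight: "\<And>e. e > 0 \<Longrightarrow> \<exists>R. \<forall>\<^sub>F n in sequentially. prob {\<omega> \<in> space M. R < norm (X n \<omega>)} \<le> e"
  shows "tendsto_in_distribution M X N"
  unfolding tendsto_in_distribution_def
proof (intro conjI allI impI)
  interpret N: prob_space N by (rule N)
  have N_space: "space N = UNIV" using sets_eq_imp_space_eq[OF N_sets] by simp
  show "X n \<in> borel_measurable M" for n by (rule X)
  have int: "integrable M (\<lambda>\<omega>. g (X n \<omega>))" "integrable N g" if g: "trig_fun g" for g n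
  proof -
    have [measurable]: "g \<in> borel_measurable borel"
      by (rule borel_measurable_continuous_onI[OF trig_fun_continuous[OF g]])
    obtain B where B: "\<And>x. \<bar>g x\<bar> \<le> B" using trig_fun_bounded[OF g] by blast
    show "integrable M (\<lambda>\<omega>. g (X n \<omega>))"
      by (rule integrable_const_bound[where B=B]) (simp_all add: B)
    show "integrable N g"
      by (rule N.integrable_const_bound[where B=B]) (simp_all add: B)
  qed
  have trig: "(\<lambda>n. expectation (\<lambda>\<omega>. g (X n \<omega>))) \<longlonglongrightarrow> (\<integral>x. g x \<partial>N)" if "trig_fun g" for g
    using that
  proof induction
    case (cos a u c)
    show ?case using tendsto_mult_left[OF char[of u c], of a] by simp
  next
    case (add f g)
    then show ?case using tendsto_add[OF add.IH] by (simp add: int)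
  qed
  fix f :: "'v \<Rightarrow> real" assume "continuous_on UNIV f \<and> bounded (range f)"
  then obtain C where f: "continuous_on UNIV f" and C: "C > 0" "\<And>x. \<bar>f x\<bar> \<le> C"
    by (auto simp: bounded_pos)
  have [measurable]: "f \<in> borel_measurable borel" by (rule borel_measurable_continuous_onI[OF f])
  show "(\<lambda>n. expectation (\<lambda>\<omega>. f (X n \<omega>))) \<longlonglongrightarrow> (\<integral>x. f x \<partial>N)"
  proof (rule LIMSEQ_I)
    fix r :: real assume r: "r > 0"
    \<comment> \<open>With \<open>e \<le> 1\<close> the approximant is bounded by
      \<open>C + 1\<close>, so an error \<open>e\<close> on the ball and a tail of mass at most
      \<open>e\<close> cost \<open>e + (2 * C + 1) * e \<le> r / 4\<close>. This is paid once for
      \<open>X n\<close> and once for \<open>N\<close>; a third quarter pays for the convergence of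
      the approximant.\<close>
    define e where "e = min 1 (r / (4 * (2 * C + 2)))"
    have e: "e > 0" "e \<le> 1" using r C by (auto simp: e_def)
    have "(2 * C + 2) * e \<le> (2 * C + 2) * (r / (4 * (2 * C + 2)))"
      using C by (intro mult_left_mono) (auto simp: e_def)
    also have "\<dots> = r / 4" using C by (simp add: field_simps)
    finally have e4: "(2 * C + 2) * e \<le> r / 4" .
    obtain R1 where R1: "\<forall>\<^sub>F n in sequentially. prob {\<omega> \<in> space M. R1 < norm (X n \<omega>)} \<le> e"
      using tight[OF e(1)] by blast
    obtain R2 where R2: "measure N {x. R2 < norm x} \<le> e"
      using prob_space_tail_small[OF N N_sets e(1)] by blast
    define R where "R = max R1 R2"
    obtain g where g: "trig_fun g" "\<And>x. norm x \<le> R \<Longrightarrow> \<bar>f x - g x\<bar> \<le> e" "\<And>x. \<bar>g x\<bar> \<le> C + e"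
      using trig_fun_approximation[OF f C(2) e(1)] by metis
    have [measurable]: "g \<in> borel_measurable borel"
      by (rule borel_measurable_continuous_onI[OF trig_fun_continuous[OF g(1)]])
    have gb: "\<And>x. \<bar>g x\<bar> \<le> C + 1" using g(3) e(2) by (meson add_left_mono order_trans)
    have close: "e + (C + (C + 1)) * p \<le> r / 4" if "p \<le> e" for p
    proof -
      have "e + (C + (C + 1)) * p \<le> e + (2 * C + 1) * e" using that C by (auto intro!: mult_left_mono)
      also have "\<dots> = (2 * C + 2) * e" by (simp add: algebra_simps)
      finally show ?thesis using e4 by simp
    qed
    have "measure N {x \<in> space N. R < norm x} \<le> measure N {x. R2 < norm x}"
      by (rule N.finite_measure_mono) (simp_all add: R_def Collect_mono)
    with R2 have "e + (C + (C + 1)) * measure N {x \<in> space N. R < norm x} \<le> r / 4"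
      by (intro close) linarith
    moreover have "\<bar>(\<integral>x. f x \<partial>N) - (\<integral>x. g x \<partial>N)\<bar> \<le>
        e + (C + (C + 1)) * measure N {x \<in> space N. R < norm x}"
      by (rule N.expectation_diff_le_tail) (use g(2) C(2) gb e(1) in simp_all)
    ultimately have N_close: "\<bar>(\<integral>x. f x \<partial>N) - (\<integral>x. g x \<partial>N)\<bar> \<le> r / 4" by linarith
    from LIMSEQ_D[OF trig[OF g(1)], of "r/4"] r have
      "\<forall>\<^sub>F n in sequentially. \<bar>expectation (\<lambda>\<omega>. g (X n \<omega>)) - (\<integral>x. g x \<partial>N)\<bar> < r / 4"
      by (auto simp: eventually_sequentially)
    with R1 have "\<forall>\<^sub>F n in sequentially. \<bar>expectation (\<lambda>\<omega>. f (X n \<omega>)) - (\<integral>x. f x \<partial>N)\<bar> < r"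
    proof eventually_elim
      case (elim n)
      have "prob {\<omega> \<in> space M. R < norm (X n \<omega>)} \<le> prob {\<omega> \<in> space M. R1 < norm (X n \<omega>)}"
        by (rule finite_measure_mono) (simp_all add: R_def Collect_mono)
      with elim have "e + (C + (C + 1)) * prob {\<omega> \<in> space M. R < norm (X n \<omega>)} \<le> r / 4"
        by (intro close) linarith
      moreover have "\<bar>expectation (\<lambda>\<omega>. f (X n \<omega>)) - expectation (\<lambda>\<omega>. g (X n \<omega>))\<bar> \<le>
          e + (C + (C + 1)) * prob {\<omega> \<in> space M. R < norm (X n \<omega>)}"
        by (rule expectation_diff_le_tail) (use g(2) C(2) gb e(1) in simp_all)
      ultimately show ?case using N_close elim r by linarith
    qed
    then show "\<exists>n0. \<forall>n\<ge>n0. norm (expectation (\<lambda>\<omega>. f (X n \<omega>)) - (\<integral>x. f x \<partial>N)) < r"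
      by (simp add: eventually_sequentially)
  qed
qed

section \<open>The multivariate central limit theorem\<close>

lemma outer_mult_vec: "outer a b *v x = (b \<bullet> x) *\<^sub>R a"
  by (simp add: outer_def matrix_vector_mult_def vec_eq_iff inner_vec_def sum_distrib_left mult_ac)

lemma transpose_outer: "transpose (outer a b) = outer b a"
  by (simp add: outer_def transpose_def vec_eq_iff mult_ac)

lemma continuous_on_outer:
  "continuous_on UNIV (\<lambda>x::(real^'n) \<times> (real^'m). outer (fst x) (snd x))"
  unfolding outer_def by (intro continuous_intros)

lemma outer_measurable [measurable]:
  assumes [measurable]: "f \<in> borel_measurable M" "g \<in> borel_measurable M"
  shows "(\<lambda>x. outer (f x :: real^'n) (g x :: real^'m)) \<in> borel_measurable M"
  using borel_measurable_continuous_on[OF continuous_on_outer, of "\<lambda>x. (f x, g x)" M] by simp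

lemma norm_outer: "norm (outer a b) = norm a * norm b"
proof -
  have "outer a b $ i = a $ i *\<^sub>R b" for i by (simp add: outer_def vec_eq_iff)
  then have "norm (outer a b) = L2_set (\<lambda>i. norm (a $ i) * norm b) UNIV"
    by (simp add: norm_vec_def[of "outer a b"])
  also have "\<dots> = L2_set (\<lambda>i. norm (a $ i)) UNIV * norm b"
    by (simp add: L2_set_left_distrib)
  finally show ?thesis by (simp add: norm_vec_def[of a])
qed

lemma outer_integrable:
  fixes f :: "'z \<Rightarrow> real^'n"
  assumes "f \<in> borel_measurable F" "integrable F (\<lambda>z. (norm (f z))\<^sup>2)"
  shows "integrable F (\<lambda>z. outer (f z) (f z))"
  using assms by (subst integrable_norm_iff[symmetric]) (simp_all add: norm_outer power2_eq_square)

section \<open>Existence of a normal law with a given, possibly singular, covariance matrix\<close>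

lemma symmetric_bilinear:
  assumes "transpose W = W"
  shows "u \<bullet> (W *v v) = v \<bullet> ((W::real^'n^'n) *v u)"
  by (metis assms dot_lmul_matrix inner_commute transpose_matrix_vector)

text \<open>One step of Cholesky elimination: the rank-one matrix of \<open>W *v w\<close>, divided
  by \<open>w \<bullet> (W *v w)\<close>, is subtracted. Cauchy-Schwarz for the form
  \<open>W\<close> keeps the remainder positive semidefinite, and the old kernel is preserved
  because \<open>W *v w\<close> is orthogonal to it.\<close>

lemma psd_deflation:
  fixes W :: "real^'n^'n"
  assumes sym: "transpose W = W" and psd: "\<And>u. 0 \<le> u \<bullet> (W *v u)"
  obtains a where "\<And>u. 0 \<le> u \<bullet> ((W - outer a a) *v u)" "(W - outer a a) *v w = 0"
    "\<And>v. W *v v = 0 \<Longrightarrow> (W - outer a a) *v v = 0"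
proof -
  let ?q = "w \<bullet> (W *v w)"
  have quad: "0 \<le> u \<bullet> (W *v u) + 2 * t * (u \<bullet> (W *v w)) + t\<^sup>2 * ?q" for u t
    using psd[of "u + t *\<^sub>R w"] symmetric_bilinear[OF sym, of w u]
    by (simp add: matrix_vector_right_distrib matrix_vector_mult_scaleR inner_add_left inner_add_right
        power2_eq_square algebra_simps)
  show thesis
  proof (cases "?q = 0")
    case True
    have "u \<bullet> (W *v w) = 0" for u
    proof (rule ccontr)
      assume nz: "u \<bullet> (W *v w) \<noteq> 0"
      \<comment> \<open>With \<open>?q = 0\<close> the quadratic is affine in \<open>t\<close>, and
        this \<open>t\<close> gives it the value -1.\<close>
      have "2 * (- ((u \<bullet> (W *v u) + 1) / (2 * (u \<bullet> (W *v w))))) * (u \<bullet> (W *v w)) = - (u \<bullet> (W *v u) + 1)"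
        using nz by (simp add: field_simps)
      then show False using quad[of u "- ((u \<bullet> (W *v u) + 1) / (2 * (u \<bullet> (W *v w))))"] True by simp
    qed
    then have "W *v w = 0" by (metis inner_eq_zero_iff)
    then show ?thesis using psd by (intro that[of 0]) (simp_all add: outer_def zero_vec_def[symmetric])
  next
    case False
    then have q: "?q > 0" using psd[of w] by linarith
    define a where "a = (1 / sqrt ?q) *\<^sub>R (W *v w)"
    have aa: "outer a a *v v = ((w \<bullet> (W *v v)) / ?q) *\<^sub>R (W *v w)" for v
    proof -
      have "(1 / sqrt ?q) * (1 / sqrt ?q) = 1 / ?q" using q by (simp add: real_sqrt_mult_self)
      then show ?thesis
        unfolding outer_mult_vec a_def
        using symmetric_bilinear[OF sym, of w v]
        by (simp add: inner_commute[of "W *v w" v] mult.assoc[symmetric])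
    qed
    show ?thesis
    proof
      show "0 \<le> u \<bullet> ((W - outer a a) *v u)" for u
      proof -
        \<comment> \<open>The minimum of the quadratic over \<open>t\<close>, attained at
          \<open>t = - (u \<bullet> (W *v w)) / ?q\<close>.\<close>
        have "0 \<le> u \<bullet> (W *v u) - (u \<bullet> (W *v w))\<^sup>2 / ?q"
          using quad[of u "- (u \<bullet> (W *v w)) / ?q"] q by (simp add: field_simps power2_eq_square)
        then show ?thesis
          using symmetric_bilinear[OF sym, of w u]
          by (simp add: matrix_vector_mult_diff_rdistrib aa inner_diff_right power2_eq_square)
      qed
      show "(W - outer a a) *v w = 0" using False by (simp add: matrix_vector_mult_diff_rdistrib aa)
      show "(W - outer a a) *v v = 0" if "W *v v = 0" for v
        using that by (simp add: matrix_vector_mult_diff_rdistrib aa)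
    qed
  qed
qed

lemma matrix_vector_mult_sum_left:
  "(\<Sum>i\<in>S. A i) *v u = (\<Sum>i\<in>S. A i *v (u :: real^'n))"
  by (induction S rule: infinite_finite_induct) (simp_all add: matrix_vector_mult_add_rdistrib)

text \<open>Deflation along the coordinate axes in turn. Directions already annihilated stay
  annihilated, so in the end the remainder kills a basis and is zero. Vanishing pivots cause no
  trouble, hence \<open>V\<close> may be singular.\<close>

lemma psd_sum_of_squares:
  fixes V :: "real^'n^'n"
  assumes sym: "transpose V = V" and psd: "\<And>u. 0 \<le> u \<bullet> (V *v u)"
  obtains a :: "'n \<Rightarrow> real^'n" where "V = (\<Sum>i\<in>UNIV. outer (a i) (a i))"
proof -
  have "\<exists>a. (\<forall>u. 0 \<le> u \<bullet> ((V - (\<Sum>i\<in>S. outer (a i) (a i))) *v u)) \<and>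
      (\<forall>i\<in>S. (V - (\<Sum>i\<in>S. outer (a i) (a i))) *v axis i 1 = 0)" for S :: "'n set"
    using finite[of S]
  proof (induction S rule: finite_induct)
    case empty
    then show ?case using psd by simp
  next
    case (insert j S)
    then obtain a where a: "\<And>u. 0 \<le> u \<bullet> ((V - (\<Sum>i\<in>S. outer (a i) (a i))) *v u)"
      "\<And>i. i \<in> S \<Longrightarrow> (V - (\<Sum>i\<in>S. outer (a i) (a i))) *v axis i 1 = 0" by blast
    define W where "W = V - (\<Sum>i\<in>S. outer (a i) (a i))"
    have W_sym: "transpose W = W"
      using sym by (simp add: W_def transpose_def vec_eq_iff sum_component outer_def mult_ac)
    have W_psd: "0 \<le> u \<bullet> (W *v u)" for u using a(1) unfolding W_def .
    obtain b where b: "\<And>u. 0 \<le> u \<bullet> ((W - outer b b) *v u)" "(W - outer b b) *v axis j 1 = 0"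
      "\<And>v. W *v v = 0 \<Longrightarrow> (W - outer b b) *v v = 0"
      using psd_deflation[OF W_sym W_psd, of "axis j 1"] by blast
    have W_null: "W *v axis i 1 = 0" if "i \<in> S" for i using a(2)[OF that] unfolding W_def .
    have "(\<Sum>i\<in>S. outer ((a(j := b)) i) ((a(j := b)) i)) = (\<Sum>i\<in>S. outer (a i) (a i))"
      using insert by (intro sum.cong) auto
    then have "V - (\<Sum>i\<in>insert j S. outer ((a(j := b)) i) ((a(j := b)) i)) = W - outer b b"
      using insert by (simp add: W_def)
    then show ?case
      using b W_null by (intro exI[of _ "a(j := b)"]) (simp only:, blast)
  qed
  from this[of UNIV] obtain a :: "'n \<Rightarrow> real^'n" where
    "(\<forall>u. 0 \<le> u \<bullet> ((V - (\<Sum>i\<in>UNIV. outer (a i) (a i))) *v u)) \<and>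
      (\<forall>i\<in>UNIV. (V - (\<Sum>i\<in>UNIV. outer (a i) (a i))) *v axis i 1 = 0)" by (elim exE) (rule that)
  then have a: "(V - (\<Sum>i\<in>UNIV. outer (a i) (a i))) *v axis i 1 = 0" for i by blast
  have "V - (\<Sum>i\<in>UNIV. outer (a i) (a i)) = 0"
    using a by (simp add: matrix_vector_mult_basis column_def vec_eq_iff)
  then show thesis by (intro that[of a]) simp
qed

text \<open>The law of \<open>\<Sum>i. x i *\<^sub>R a i\<close> with independent standard normal
  \<open>x i\<close>: its projection on \<open>u\<close> is a sum of independent centred normals
  whose variances \<open>(u \<bullet> a i)\<^sup>2\<close> add up to
  \<open>u \<bullet> (V *v u)\<close>.\<close>

lemma psd_multivariate_normal_exists:
  fixes V :: "real^'n^'n"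
  assumes sym: "transpose V = V" and psd: "\<And>u. 0 \<le> u \<bullet> (V *v u)"
  shows "\<exists>N. multivariate_normal 0 V N"
proof -
  from psd_sum_of_squares[OF sym psd] obtain a :: "'n \<Rightarrow> real^'n"
    where V: "V = (\<Sum>i\<in>UNIV. outer (a i) (a i))" .
  have uV: "u \<bullet> (V *v u) = (\<Sum>i\<in>UNIV. (u \<bullet> a i)\<^sup>2)" for u
  proof -
    have "V *v u = (\<Sum>i\<in>UNIV. outer (a i) (a i) *v u)"
      unfolding V by (rule matrix_vector_mult_sum_left)
    then show ?thesis by (simp add: outer_mult_vec inner_sum_right power2_eq_square inner_commute)
  qed
  interpret S: prob_space std_normal_distribution
    using real_dist_normal_dist by (simp add: real_distribution_def)
  define P where "P = (\<Pi>\<^sub>M i\<in>(UNIV::'n set). std_normal_distribution)"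
  have [measurable_cong, simp]: "sets P = sets (\<Pi>\<^sub>M i\<in>(UNIV::'n set). borel)"
    unfolding P_def by (intro sets_PiM_cong) auto
  interpret P: prob_space P unfolding P_def by (intro prob_space_PiM) unfold_locales
  have comp [measurable]: "(\<lambda>x. x i) \<in> borel_measurable P" for i by measurable
  have comp_distr: "distr P borel (\<lambda>x. x i) = std_normal_distribution" for i
  proof -
    have "distr P borel (\<lambda>x. x i) = distr P std_normal_distribution (\<lambda>x. x i)"
      by (intro distr_cong) auto
    also have "\<dots> = std_normal_distribution"
      unfolding P_def by (rule distr_PiM_component) (auto intro: S.prob_space_axioms)
    finally show ?thesis .
  qed
  have indep: "P.indep_vars (\<lambda>_. borel) (\<lambda>i x. x i) UNIV"
  proof (subst P.indep_vars_iff_distr_eq_PiM')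
    have "distr P (\<Pi>\<^sub>M i\<in>UNIV. borel) (\<lambda>x. \<lambda>i\<in>UNIV. x i) = distr P P (\<lambda>x. x)"
      by (intro distr_cong) (auto simp: restrict_def)
    also have "\<dots> = (\<Pi>\<^sub>M i\<in>UNIV. distr P borel (\<lambda>x. x i))"
      by (simp only: comp_distr distr_id2) (simp only: P_def)
    finally show "distr P (\<Pi>\<^sub>M i\<in>UNIV. borel) (\<lambda>x. \<lambda>i\<in>UNIV. x i) = (\<Pi>\<^sub>M i\<in>UNIV. distr P borel (\<lambda>x. x i))" .
  qed auto
  have comp_distributed: "distributed P lborel (\<lambda>x. x i) std_normal_density" for i
  proof -
    have "distr P lborel (\<lambda>x. x i) = distr P borel (\<lambda>x. x i)" by (intro distr_cong) auto
    then show ?thesis unfolding distributed_def by (simp add: comp_distr)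
  qed
  define G where "G x = (\<Sum>i\<in>UNIV. x i *\<^sub>R a i)" for x
  have G [measurable]: "G \<in> borel_measurable P" unfolding G_def by measurable
  define N where "N = distr P borel G"
  have proj: "distr N borel (\<lambda>x. u \<bullet> x) = normal_distribution 0 (u \<bullet> (V *v u))" for u
  proof -
    have "distr N borel (\<lambda>x. u \<bullet> x) = distr P borel (\<lambda>x. u \<bullet> G x)"
      unfolding N_def by (subst distr_distr) (auto simp: comp_def)
    also have "(\<lambda>x. u \<bullet> G x) = (\<lambda>x. \<Sum>i\<in>UNIV. (u \<bullet> a i) * x i)"
      by (simp add: G_def inner_sum_right mult_ac)
    \<comment> \<open>Terms with coefficient 0 have no density and are removed before normal
      variables are added; if none is left, the projection is the point mass at 0.\<close>
    also have "\<dots> = (\<lambda>x. \<Sum>i\<in>{i. u \<bullet> a i \<noteq> 0}. (u \<bullet> a i) * x i)"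
      by (intro ext sum.mono_neutral_right) auto
    also have "distr P borel \<dots> = normal_distribution 0 (u \<bullet> (V *v u))"
    proof (cases "{i. u \<bullet> a i \<noteq> 0} = {}")
      case True
      then have "\<And>i. u \<bullet> a i = 0" by blast
      then show ?thesis by (simp add: uV normal_distribution_def)
    next
      case False
      let ?I = "{i. u \<bullet> a i \<noteq> 0}"
      have sc: "distributed P lborel (\<lambda>x. (u \<bullet> a i) * x i) (normal_density 0 \<bar>u \<bullet> a i\<bar>)" if "i \<in> ?I" for i
        using P.normal_density_affine[OF comp_distributed, of "u \<bullet> a i" 0 i] that by simp
      have "P.indep_vars (\<lambda>_. borel) (\<lambda>i x. (u \<bullet> a i) * x i) ?I"
        using P.indep_vars_compose2[OF P.indep_vars_subset[OF indep, of ?I], of "\<lambda>i y. (u \<bullet> a i) * y" "\<lambda>_. borel"]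
        by simp
      from P.sum_indep_normal[OF _ False this, of "\<lambda>i. \<bar>u \<bullet> a i\<bar>" "\<lambda>_. 0"] sc
      have D: "distributed P lborel (\<lambda>x. \<Sum>i\<in>?I. (u \<bullet> a i) * x i) (normal_density 0 (sqrt (\<Sum>i\<in>?I. (u \<bullet> a i)\<^sup>2)))"
        by simp
      have eq: "(\<Sum>i\<in>?I. (u \<bullet> a i)\<^sup>2) = u \<bullet> (V *v u)"
        unfolding uV by (intro sum.mono_neutral_left) auto
      from False obtain i where i: "u \<bullet> a i \<noteq> 0" by blast
      have "(u \<bullet> a i)\<^sup>2 \<le> u \<bullet> (V *v u)"
        unfolding uV by (intro member_le_sum) auto
      moreover have "(u \<bullet> a i)\<^sup>2 > 0" using i by simp
      ultimately have nz: "u \<bullet> (V *v u) \<noteq> 0" by linarith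
      have "distr P borel (\<lambda>x. \<Sum>i\<in>?I. (u \<bullet> a i) * x i) = distr P lborel (\<lambda>x. \<Sum>i\<in>?I. (u \<bullet> a i) * x i)"
        by (intro distr_cong) auto
      then show ?thesis using distributed_distr_eq_density[OF D] nz
        by (simp add: normal_distribution_def eq)
    qed
    finally show ?thesis .
  qed
  have "prob_space N" unfolding N_def by (rule P.prob_space_distr[OF G])
  then have "multivariate_normal 0 V N"
    unfolding multivariate_normal_def using sym psd proj by (simp add: N_def)
  then show ?thesis by blast
qed

lemma cos_lipschitz: "\<bar>cos a - cos b\<bar> \<le> \<bar>a - b\<bar>" for a b :: real
proof -
  have "norm (cos a - cos b) \<le> 1 * norm (a - b)"
    by (rule field_differentiable_bound[OF convex_UNIV, of cos "\<lambda>x. - sin x"])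
      (auto intro!: derivative_eq_intros simp: abs_sin_le_one)
  then show ?thesis by simp
qed

section \<open>From the univariate to the multivariate central limit theorem\<close>

context iid_sample
begin

text \<open>A singular covariance has directions of zero variance, so that case is separated: the
  sums are then almost surely 0. Otherwise the classical theorem for standardised sums applies, and
  the scale \<open>\<sigma>\<close> is put back inside the cosine.\<close>

lemma clt_cos:
  fixes f :: "'z \<Rightarrow> real"
  assumes f [measurable]: "f \<in> borel_measurable F" and sq: "integrable F (\<lambda>z. (f z)\<^sup>2)"
    and f0: "(\<integral>z. f z \<partial>F) = 0"
  shows "(\<lambda>n. expectation (\<lambda>\<omega>. cos (sqrt (real n) * avg f n \<omega> + c))) \<longlonglongrightarrow>
     (\<integral>y. cos (y + c) \<partial>normal_distribution 0 (\<integral>z. (f z)\<^sup>2 \<partial>F))"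
proof (cases "(\<integral>z. (f z)\<^sup>2 \<partial>F) = 0")
  case True
  have "expectation (\<lambda>\<omega>. cos (sqrt (real n) * avg f n \<omega> + c)) = cos c" for n
  proof -
    have "AE \<omega> in M. (\<Sum>i<n. f (Z i \<omega>))\<^sup>2 = 0"
      using second_moment_sum[OF f sq f0, of n] True
      by (subst integral_nonneg_eq_0_iff_AE[symmetric]) auto
    then have "AE \<omega> in M. cos (sqrt (real n) * avg f n \<omega> + c) = cos c"
      by eventually_elim (simp add: avg_def)
    then have "expectation (\<lambda>\<omega>. cos (sqrt (real n) * avg f n \<omega> + c)) = expectation (\<lambda>\<omega>. cos c)"
      by (intro integral_cong_AE) auto
    then show ?thesis by (simp add: prob_space)
  qed
  moreover have "(\<integral>y. cos (y + c) \<partial>return borel 0) = cos c"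
    by (subst integral_return) auto
  ultimately show ?thesis using True by (simp add: normal_distribution_def)
next
  case False
  define \<sigma> where "\<sigma> = sqrt (\<integral>z. (f z)\<^sup>2 \<partial>F)"
  have "0 < (\<integral>z. (f z)\<^sup>2 \<partial>F)" using False by (simp add: less_le)
  then have \<sigma>: "\<sigma> > 0" "\<sigma>\<^sup>2 = (\<integral>z. (f z)\<^sup>2 \<partial>F)" by (auto simp: \<sigma>_def)
  define S where "S n \<omega> = (\<Sum>i<n. f (Z i \<omega>)) / sqrt (real n * \<sigma>\<^sup>2)" for n \<omega>
  have S [measurable]: "S n \<in> borel_measurable M" for n unfolding S_def by measurable
  have E0: "expectation (\<lambda>\<omega>. f (Z i \<omega>)) = 0" for i using expectation_Z[OF f] f0 by simp
  have "weak_conv_m (\<lambda>n. distr M borel (S n)) std_normal_distribution"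
    unfolding S_def
  proof (rule central_limit_theorem_zero_mean[where \<mu>="distr F borel f"])
    show "indep_vars (\<lambda>i. borel) (\<lambda>i \<omega>. f (Z i \<omega>)) UNIV" by (rule indep_vars_Z[OF f])
    show "integrable M (\<lambda>\<omega>. (f (Z i \<omega>))\<^sup>2)" for i by (rule integrable_Z[OF sq])
    show "variance (\<lambda>\<omega>. f (Z i \<omega>)) = \<sigma>\<^sup>2" for i
      using expectation_Z[of "\<lambda>z. (f z)\<^sup>2" i] by (simp add: E0 \<sigma>)
    show "distr M borel (\<lambda>\<omega>. f (Z i \<omega>)) = distr F borel f" for i
      using distr_distr[OF f Z_measurable, of i] by (simp add: distr_Z comp_def)
  qed (use \<sigma> E0 in auto)
  then have "(\<lambda>n. integral\<^sup>L (distr M borel (S n)) (\<lambda>y. cos (\<sigma> * y + c))) \<longlonglongrightarrow>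
      integral\<^sup>L std_normal_distribution (\<lambda>y. cos (\<sigma> * y + c))"
    by (rule weak_conv_imp_integral_bdd_continuous_conv[rotated 2, where B=1])
       (auto intro!: real_distribution_distr real_dist_normal_dist continuous_intros)
  moreover have "integral\<^sup>L std_normal_distribution (\<lambda>y. cos (\<sigma> * y + c)) =
      (\<integral>y. cos (y + c) \<partial>normal_distribution 0 (\<sigma>\<^sup>2))"
  proof -
    interpret N: prob_space std_normal_distribution
      using real_dist_normal_dist by (simp add: real_distribution_def)
    have "distr std_normal_distribution lborel (\<lambda>x. x) = std_normal_distribution"
      by (intro distr_id2) auto
    then have "distributed std_normal_distribution lborel (\<lambda>x. x) std_normal_density"
      unfolding distributed_def by simp
    from N.normal_density_affine[OF this, of \<sigma> 0] \<sigma>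
    have D: "distributed std_normal_distribution lborel (\<lambda>x. \<sigma> * x) (normal_density 0 \<sigma>)" by simp
    have "normal_distribution 0 (\<sigma>\<^sup>2) = density lborel (normal_density 0 \<sigma>)"
      using \<sigma>(1) by (simp add: normal_distribution_def)
    then have "(\<integral>y. cos (y + c) \<partial>normal_distribution 0 (\<sigma>\<^sup>2)) = (\<integral>y. normal_density 0 \<sigma> y * cos (y + c) \<partial>lborel)"
      by (simp add: integral_density)
    also have "\<dots> = integral\<^sup>L std_normal_distribution (\<lambda>y. cos (\<sigma> * y + c))"
      by (rule distributed_integral[OF D]) auto
    finally show ?thesis ..
  qed
  ultimately have lim: "(\<lambda>n. expectation (\<lambda>\<omega>. cos (\<sigma> * S n \<omega> + c))) \<longlonglongrightarrow>
      (\<integral>y. cos (y + c) \<partial>normal_distribution 0 (\<sigma>\<^sup>2))"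
    by (simp add: integral_distr)
  have "\<sigma> * S n \<omega> = sqrt (real n) * avg f n \<omega>" for n \<omega>
  proof -
    have "sqrt (real n * \<sigma>\<^sup>2) = sqrt (real n) * \<sigma>" using \<sigma>(1) by (simp add: real_sqrt_mult)
    then show ?thesis using \<sigma>(1) by (cases "n = 0") (simp_all add: S_def avg_def field_simps)
  qed
  with lim \<sigma> show ?thesis by simp
qed

text \<open>The bound does not depend on \<open>n\<close> and thus yields boundedness in
  probability. It is an inequality because the average over the empty sample is 0.\<close>

lemma root_n_avg_second_moment:
  fixes g :: "'z \<Rightarrow> real^'m"
  assumes g [measurable]: "g \<in> borel_measurable F" and sq: "integrable F (\<lambda>z. (norm (g z))\<^sup>2)"
    and g0: "(\<integral>z. g z \<partial>F) = 0"
  shows "integrable M (\<lambda>\<omega>. (norm (sqrt (real n) *\<^sub>R avg g n \<omega>))\<^sup>2)"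
    "expectation (\<lambda>\<omega>. (norm (sqrt (real n) *\<^sub>R avg g n \<omega>))\<^sup>2) \<le> (\<integral>z. (norm (g z))\<^sup>2 \<partial>F)"
proof -
  interpret F: prob_space F by (rule prob_space_F)
  have g_int: "integrable F g"
    using F.square_integrable_imp_integrable[of "\<lambda>z. norm (g z)"] sq by (simp add: integrable_norm_iff)
  have gi [measurable]: "(\<lambda>z. g z $ i) \<in> borel_measurable F" for i
    by (rule borel_measurable_integrable[OF integrable_bounded_linear[OF bounded_linear_vec_nth g_int]])
  have gi_sq: "integrable F (\<lambda>z. (g z $ i)\<^sup>2)" for i
    by (rule Bochner_Integration.integrable_bound[OF sq])
       (auto simp: abs_le_square_iff[symmetric] component_le_norm_cart)
  have gi_0: "(\<integral>z. g z $ i \<partial>F) = 0" for i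
    using integral_bounded_linear[OF bounded_linear_vec_nth g_int, of i] g0 by simp
  have norm_sq: "(norm (x::real^'m))\<^sup>2 = (\<Sum>i\<in>UNIV. (x $ i)\<^sup>2)" for x
    by (simp add: norm_vec_def L2_set_def sum_nonneg)
  have eq: "(norm (sqrt (real n) *\<^sub>R avg g n \<omega>))\<^sup>2 = (\<Sum>j\<in>UNIV. (\<Sum>i<n. g (Z i \<omega>) $ j)\<^sup>2) / real n" for \<omega>
  proof -
    have "(sqrt (real n) * (1 / real n * s))\<^sup>2 = s\<^sup>2 / real n" for s
      by (cases "n = 0") (simp_all add: power_mult_distrib power_divide power2_eq_square[of "real n"])
    then show ?thesis
      unfolding norm_sq avg_def by (simp add: sum_component sum_divide_distrib)
  qed
  show "integrable M (\<lambda>\<omega>. (norm (sqrt (real n) *\<^sub>R avg g n \<omega>))\<^sup>2)"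
    unfolding eq by (intro integrable_divide Bochner_Integration.integrable_sum second_moment_sum gi gi_sq gi_0)
  have "expectation (\<lambda>\<omega>. (norm (sqrt (real n) *\<^sub>R avg g n \<omega>))\<^sup>2) = (\<Sum>j\<in>UNIV. real n * (\<integral>z. (g z $ j)\<^sup>2 \<partial>F)) / real n"
    unfolding eq
    by (simp add: Bochner_Integration.integral_sum second_moment_sum(1)[OF gi gi_sq gi_0] second_moment_sum(2)[OF gi gi_sq gi_0])
  also have "\<dots> \<le> (\<Sum>j\<in>UNIV. (\<integral>z. (g z $ j)\<^sup>2 \<partial>F))"
    by (cases "n = 0") (auto simp: sum_divide_distrib intro: sum_nonneg)
  also have "\<dots> = (\<integral>z. (norm (g z))\<^sup>2 \<partial>F)"
    unfolding norm_sq by (rule Bochner_Integration.integral_sum[symmetric]) (rule gi_sq)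
  finally show "expectation (\<lambda>\<omega>. (norm (sqrt (real n) *\<^sub>R avg g n \<omega>))\<^sup>2) \<le> (\<integral>z. (norm (g z))\<^sup>2 \<partial>F)" .
qed

text \<open>Cramer-Wold and Slutsky in one: projections reduce the cosines of the leading term to
  the univariate theorem, the negligible remainder is transferred to \<open>X\<close> by the
  Lipschitz continuity of the cosine, and tightness comes from the second moments of the leading
  term.\<close>

theorem asymptotically_normalI:
  fixes g :: "'z \<Rightarrow> real^'m" and X :: "nat \<Rightarrow> 'w \<Rightarrow> real^'m"
  assumes g [measurable]: "g \<in> borel_measurable F" and sq: "integrable F (\<lambda>z. (norm (g z))\<^sup>2)"
    and g0: "(\<integral>z. g z \<partial>F) = 0"
    and X [measurable]: "\<And>n. X n \<in> borel_measurable M"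
    and lin: "tendsto_in_prob M (\<lambda>n \<omega>. X n \<omega> - sqrt (real n) *\<^sub>R avg g n \<omega>) 0"
  shows "asymptotically_normal M X (\<integral>z. outer (g z) (g z) \<partial>F)"
proof -
  interpret F: prob_space F by (rule prob_space_F)
  define V where "V = (\<integral>z. outer (g z) (g z) \<partial>F)"
  define Y where "Y n \<omega> = sqrt (real n) *\<^sub>R avg g n \<omega>" for n \<omega>
  have Y [measurable]: "Y n \<in> borel_measurable M" for n unfolding Y_def by measurable
  have g_int: "integrable F g"
    using F.square_integrable_imp_integrable[of "\<lambda>z. norm (g z)"] sq by (simp add: integrable_norm_iff)
  have outer_int: "integrable F (\<lambda>z. outer (g z) (g z))"
    by (rule outer_integrable[OF g sq])
  have uVu: "u \<bullet> (V *v u) = (\<integral>z. (u \<bullet> g z)\<^sup>2 \<partial>F)" for u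
  proof -
    have "bounded_linear (\<lambda>A::real^'m^'m. u \<bullet> (A *v u))"
      by (intro linear_conv_bounded_linear[THEN iffD1] linearI)
        (simp_all add: matrix_vector_mult_add_rdistrib inner_add_right scaleR_matrix_vector_assoc[symmetric])
    from integral_bounded_linear[OF this outer_int]
    show ?thesis unfolding V_def by (simp add: outer_mult_vec power2_eq_square inner_commute)
  qed
  have "transpose V = V"
  proof -
    have "bounded_linear (transpose :: real^'m^'m \<Rightarrow> _)"
      by (intro linear_conv_bounded_linear[THEN iffD1] linearI) (auto simp: transpose_def vec_eq_iff)
    from integral_bounded_linear[OF this outer_int] show ?thesis
      by (simp add: V_def transpose_outer)
  qed
  moreover have "0 \<le> u \<bullet> (V *v u)" for u unfolding uVu by simp
  ultimately obtain N where N: "multivariate_normal 0 V N"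
    using psd_multivariate_normal_exists by blast
  then have N_prob: "prob_space N" and N_sets [measurable_cong]: "sets N = sets borel"
    and N_proj: "\<And>u. distr N borel (\<lambda>x. u \<bullet> x) = normal_distribution 0 (u \<bullet> (V *v u))"
    by (auto simp: multivariate_normal_def)
  have ug_sq: "integrable F (\<lambda>z. (u \<bullet> g z)\<^sup>2)" for u
  proof (rule Bochner_Integration.integrable_bound)
    show "integrable F (\<lambda>z. (norm u)\<^sup>2 * (norm (g z))\<^sup>2)" using sq by simp
    have "(u \<bullet> g z)\<^sup>2 \<le> (norm u * norm (g z))\<^sup>2" for z
      using Cauchy_Schwarz_ineq2[of u "g z"] by (simp add: abs_le_square_iff[symmetric])
    then show "AE z in F. norm ((u \<bullet> g z)\<^sup>2) \<le> norm ((norm u)\<^sup>2 * (norm (g z))\<^sup>2)"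
      by (simp add: power_mult_distrib)
  qed measurable
  have charY: "(\<lambda>n. expectation (\<lambda>\<omega>. cos (u \<bullet> Y n \<omega> + c))) \<longlonglongrightarrow> (\<integral>x. cos (u \<bullet> x + c) \<partial>N)" for u c
  proof -
    have "u \<bullet> Y n \<omega> = sqrt (real n) * avg (\<lambda>z. u \<bullet> g z) n \<omega>" for n \<omega>
      by (simp add: Y_def avg_def inner_sum_right)
    moreover have "(\<integral>x. cos (u \<bullet> x + c) \<partial>N) = (\<integral>y. cos (y + c) \<partial>distr N borel (\<lambda>x. u \<bullet> x))"
      by (subst integral_distr) auto
    moreover have "(\<integral>z. u \<bullet> g z \<partial>F) = 0" using g_int g0 by simp
    ultimately show ?thesis
      using clt_cos[of "\<lambda>z. u \<bullet> g z" c] ug_sq by (simp add: N_proj uVu)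
  qed
  have XY: "(\<lambda>n. prob {\<omega> \<in> space M. \<delta> \<le> norm (X n \<omega> - Y n \<omega>)}) \<longlonglongrightarrow> 0" if "\<delta> > 0" for \<delta>
  proof -
    from lin[unfolded tendsto_in_prob_def, rule_format, OF that] obtain A where
      A: "\<forall>n. A n \<in> events \<and> {\<omega> \<in> space M. \<delta> \<le> dist (X n \<omega> - sqrt (real n) *\<^sub>R avg g n \<omega>) 0} \<subseteq> A n"
        "(\<lambda>n. prob (A n)) \<longlonglongrightarrow> 0"
      by (elim exE conjE) (rule that)
    have "prob {\<omega> \<in> space M. \<delta> \<le> norm (X n \<omega> - Y n \<omega>)} \<le> prob (A n)" for n
      by (rule finite_measure_mono) (use A(1) in \<open>simp_all add: Y_def dist_norm\<close>)
    then show ?thesis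
      by (intro real_tendsto_sandwich[OF _ _ tendsto_const A(2)]) simp_all
  qed
  have charX: "(\<lambda>n. expectation (\<lambda>\<omega>. cos (u \<bullet> X n \<omega> + c))) \<longlonglongrightarrow> (\<integral>x. cos (u \<bullet> x + c) \<partial>N)" for u c
  proof -
    have "(\<lambda>n. expectation (\<lambda>\<omega>. cos (u \<bullet> X n \<omega> + c)) - expectation (\<lambda>\<omega>. cos (u \<bullet> Y n \<omega> + c))) \<longlonglongrightarrow> 0"
    proof (rule LIMSEQ_I)
      fix r :: real assume r: "r > 0"
      \<comment> \<open>Makes \<open>norm u * \<delta> \<le> r / 2\<close>, where the added 1 covers
        \<open>u = 0\<close>. The other half of \<open>r\<close> is left for the exceptional event,
        on which cosines differ by at most 2.\<close>
      define \<delta> where "\<delta> = r / (2 * (norm u + 1))"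
      have \<delta>: "\<delta> > 0" using r by (auto simp: \<delta>_def intro!: divide_pos_pos add_nonneg_pos)
      have \<delta>u: "norm u * \<delta> \<le> r / 2"
      proof -
        have "norm u / (norm u + 1) \<le> 1" by (simp add: divide_le_eq add_nonneg_pos)
        from mult_left_mono[OF this, of "r / 2"] r show ?thesis by (simp add: \<delta>_def mult.commute)
      qed
      from LIMSEQ_D[OF XY[OF \<delta>], of "r/4"] r obtain n0 where
        n0: "\<And>n. n \<ge> n0 \<Longrightarrow> prob {\<omega> \<in> space M. \<delta> \<le> norm (X n \<omega> - Y n \<omega>)} < r/4" by auto
      show "\<exists>n0. \<forall>n\<ge>n0. norm (expectation (\<lambda>\<omega>. cos (u \<bullet> X n \<omega> + c)) - expectation (\<lambda>\<omega>. cos (u \<bullet> Y n \<omega> + c)) - 0) < r"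
      proof (intro exI[of _ n0] allI impI)
        fix n assume n: "n0 \<le> n"
        define A where "A = {\<omega> \<in> space M. \<delta> \<le> norm (X n \<omega> - Y n \<omega>)}"
        have A: "A \<in> events" unfolding A_def by measurable
        have int: "integrable M (\<lambda>\<omega>. cos (u \<bullet> X n \<omega> + c))" "integrable M (\<lambda>\<omega>. cos (u \<bullet> Y n \<omega> + c))"
          by (auto intro!: integrable_const_bound[where B=1])
        have "\<bar>expectation (\<lambda>\<omega>. cos (u \<bullet> X n \<omega> + c)) - expectation (\<lambda>\<omega>. cos (u \<bullet> Y n \<omega> + c))\<bar> =
           \<bar>expectation (\<lambda>\<omega>. cos (u \<bullet> X n \<omega> + c) - cos (u \<bullet> Y n \<omega> + c))\<bar>"
          using int by simp
        also have "\<dots> \<le> expectation (\<lambda>\<omega>. \<bar>cos (u \<bullet> X n \<omega> + c) - cos (u \<bullet> Y n \<omega> + c)\<bar>)"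
          by (rule integral_abs_bound)
        also have "\<dots> \<le> expectation (\<lambda>\<omega>. norm u * \<delta> + 2 * indicator A \<omega>)"
        proof (rule integral_mono)
          show "integrable M (\<lambda>\<omega>. \<bar>cos (u \<bullet> X n \<omega> + c) - cos (u \<bullet> Y n \<omega> + c)\<bar>)" using int by auto
          show "integrable M (\<lambda>\<omega>. norm u * \<delta> + 2 * indicator A \<omega>)"
            using A by (intro Bochner_Integration.integrable_add integrable_const integrable_mult_right
               integrable_real_indicator) (simp_all add: less_top[symmetric])
          fix \<omega> assume \<omega>: "\<omega> \<in> space M"
          show "\<bar>cos (u \<bullet> X n \<omega> + c) - cos (u \<bullet> Y n \<omega> + c)\<bar> \<le> norm u * \<delta> + 2 * indicator A \<omega>"
          proof (cases "\<omega> \<in> A")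
            case True
            have "\<bar>cos (u \<bullet> X n \<omega> + c) - cos (u \<bullet> Y n \<omega> + c)\<bar> \<le> 2"
              using abs_cos_le_one[of "u \<bullet> X n \<omega> + c"] abs_cos_le_one[of "u \<bullet> Y n \<omega> + c"] by linarith
            moreover have "0 \<le> norm u * \<delta>" using \<delta> by simp
            ultimately show ?thesis using True by simp
          next
            case False
            have "\<bar>cos (u \<bullet> X n \<omega> + c) - cos (u \<bullet> Y n \<omega> + c)\<bar> \<le> \<bar>u \<bullet> (X n \<omega> - Y n \<omega>)\<bar>"
              using cos_lipschitz[of "u \<bullet> X n \<omega> + c" "u \<bullet> Y n \<omega> + c"] by (simp add: inner_diff_right)
            also have "\<dots> \<le> norm u * norm (X n \<omega> - Y n \<omega>)" by (rule Cauchy_Schwarz_ineq2)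
            also have "\<dots> \<le> norm u * \<delta>" using False \<omega> by (intro mult_left_mono) (auto simp: A_def)
            finally show ?thesis using False by simp
          qed
        qed
        also have "\<dots> = norm u * \<delta> + 2 * prob A"
          using A by (subst Bochner_Integration.integral_add) (simp_all add: prob_space less_top[symmetric])
        also have "\<dots> < r" using n0[OF n] \<delta>u r by (simp add: A_def)
        finally show "norm (expectation (\<lambda>\<omega>. cos (u \<bullet> X n \<omega> + c)) - expectation (\<lambda>\<omega>. cos (u \<bullet> Y n \<omega> + c)) - 0) < r"
          by simp
      qed
    qed
    from tendsto_add[OF this charY[of u c]] show ?thesis by simp
  qed
  have tight: "\<exists>R. \<forall>\<^sub>F n in sequentially. prob {\<omega> \<in> space M. R < norm (X n \<omega>)} \<le> e" if e: "e > 0" for e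
  proof -
    define s where "s = (\<integral>z. (norm (g z))\<^sup>2 \<partial>F)"
    have s: "s \<ge> 0" by (simp add: s_def)
    \<comment> \<open>Chosen so that Chebyshev's bound \<open>s / R\<^sup>2\<close> is at most
      \<open>e / 2\<close>; the added 1 keeps \<open>R\<close> positive when
      \<open>s = 0\<close>.\<close>
    define R where "R = sqrt (2 * (s + 1) / e)"
    have R: "R > 0" "R\<^sup>2 = 2 * (s + 1) / e" using s e by (auto simp: R_def)
    have pY: "prob {\<omega> \<in> space M. R \<le> norm (Y n \<omega>)} \<le> e / 2" for n
    proof -
      have "prob {\<omega> \<in> space M. R \<le> norm (Y n \<omega>)} \<le> expectation (\<lambda>\<omega>. (norm (Y n \<omega>))\<^sup>2) / R\<^sup>2"
        using root_n_avg_second_moment[OF g sq g0, of n] R(1) by (intro prob_norm_ge_le) (auto simp: Y_def)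
      also have "\<dots> \<le> s / R\<^sup>2"
        using root_n_avg_second_moment(2)[OF g sq g0, of n] by (intro divide_right_mono) (auto simp: Y_def s_def)
      also have "\<dots> \<le> e / 2"
        unfolding R(2) using s e by (simp add: field_simps)
      finally show ?thesis .
    qed
    have "\<forall>\<^sub>F n in sequentially. prob {\<omega> \<in> space M. 1 \<le> norm (X n \<omega> - Y n \<omega>)} < e / 2"
      using order_tendstoD(2)[OF XY[of 1], of "e/2"] e by simp
    then have "\<forall>\<^sub>F n in sequentially. prob {\<omega> \<in> space M. R + 1 < norm (X n \<omega>)} \<le> e"
    proof eventually_elim
      case (elim n)
      have "prob {\<omega> \<in> space M. R + 1 < norm (X n \<omega>)} \<le>
          prob ({\<omega> \<in> space M. R \<le> norm (Y n \<omega>)} \<union> {\<omega> \<in> space M. 1 \<le> norm (X n \<omega> - Y n \<omega>)})"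
      proof (rule finite_measure_mono)
        show "{\<omega> \<in> space M. R + 1 < norm (X n \<omega>)} \<subseteq>
          {\<omega> \<in> space M. R \<le> norm (Y n \<omega>)} \<union> {\<omega> \<in> space M. 1 \<le> norm (X n \<omega> - Y n \<omega>)}"
        proof (intro subsetI UnCI)
          fix \<omega> assume "\<omega> \<in> {\<omega> \<in> space M. R + 1 < norm (X n \<omega>)}"
            "\<omega> \<notin> {\<omega> \<in> space M. 1 \<le> norm (X n \<omega> - Y n \<omega>)}"
          then show "\<omega> \<in> {\<omega> \<in> space M. R \<le> norm (Y n \<omega>)}"
            using norm_triangle_sub[of "X n \<omega>" "Y n \<omega>"] by auto
        qed
      qed measurable
      also have "\<dots> \<le> prob {\<omega> \<in> space M. R \<le> norm (Y n \<omega>)} + prob {\<omega> \<in> space M. 1 \<le> norm (X n \<omega> - Y n \<omega>)}"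
        by (rule measure_Un_le) measurable
      also have "\<dots> \<le> e" using pY[of n] elim by linarith
      finally show ?case .
    qed
    then show ?thesis by blast
  qed
  have "tendsto_in_distribution M X N"
    by (rule tendsto_in_distribution_trig[OF X N_prob N_sets charX tight])
  with N show ?thesis unfolding asymptotically_normal_def V_def by blast
qed

end

section \<open>Inverse function estimates and differentiability\<close>

lemma matrix_inv_inverse:
  fixes A :: "real^'n^'n"
  assumes "invertible A"
  shows "A ** matrix_inv A = mat 1" "matrix_inv A ** A = mat 1"
  using assms unfolding invertible_def matrix_inv_def by (metis (mono_tags, lifting) someI_ex)+

lemma matrix_inv_mult_vec:
  fixes A :: "real^'n^'n"
  assumes "invertible A"
  shows "A *v (matrix_inv A *v x) = x" "matrix_inv A *v (A *v x) = x"
  using matrix_inv_inverse[OF assms] by (simp_all add: matrix_vector_mul_assoc)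

lemma matrix_vector_mult_uminus: "(- N) *v y = - (N *v (y :: real^'k))" "N *v (- y) = - (N *v y)"
  using matrix_vector_mult_diff_rdistrib[of 0 N y] matrix_vector_mult_diff_distrib[of N 0 y] by simp_all

lemma matrix_mult_uminus:
  fixes N :: "real^'n^'m"
  shows "(- N) ** R = - (N ** R)" "N ** (- R) = - (N ** R)"
  by (simp_all add: matrix_matrix_mult_def vec_eq_iff sum_negf)

lemma transpose_uminus: "transpose (- N) = - transpose (N :: real^'n^'m)"
  by (simp add: transpose_def vec_eq_iff)

lemma matrix_inv_uminus:
  fixes N :: "real^'n^'n"
  assumes "invertible N"
  shows "matrix_inv (- N) = - matrix_inv N"
proof -
  have "invertible (- N)"
    unfolding invertible_def using matrix_inv_inverse[OF assms]
    by (intro exI[of _ "- matrix_inv N"]) (simp add: matrix_mult_uminus)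
  then have "matrix_inv (- N) ** ((- N) ** (- matrix_inv N)) = - matrix_inv N"
    by (simp only: matrix_mul_assoc matrix_inv_inverse matrix_mul_lid)
  then show ?thesis by (simp add: matrix_mult_uminus matrix_inv_inverse[OF assms])
qed

lemma invertibleI_injective:
  fixes A :: "real^'n^'n"
  assumes "\<And>x. A *v x = 0 \<Longrightarrow> x = 0"
  shows "invertible A"
  using assms matrix_left_invertible_ker[of A] by (simp add: invertible_left_inverse)

lemma invertibleI_surjective:
  fixes A :: "real^'n^'n"
  assumes "\<And>y. \<exists>x. A *v x = y"
  shows "invertible A"
proof -
  have "surj (\<lambda>x. A *v x)" using assms unfolding surj_def by metis
  then show ?thesis
    using matrix_right_invertible_surjective[of A] by (simp add: invertible_right_inverse)
qed

text \<open>Invertibility as an inequality, the form that survives small perturbations;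
  \<open>K\<close> bounds the norm of the inverse.\<close>

lemma invertible_lower_bound:
  fixes B :: "real^'n^'n"
  assumes "invertible B"
  obtains K where "K > 0" "\<And>x. norm x \<le> K * norm (B *v x)"
proof -
  obtain K where K: "K > 0" "\<And>x. norm (matrix_inv B *v x) \<le> norm x * K"
    using bounded_linear.pos_bounded[OF matrix_vector_mul_bounded_linear, of "matrix_inv B"] by blast
  have "norm x \<le> K * norm (B *v x)" for x
    using K(2)[of "B *v x"] matrix_inv_mult_vec(2)[OF assms, of x] by (simp add: mult.commute)
  with K(1) show thesis by (rule that)
qed

text \<open>Presents the entries of the inverse as quotients of polynomials in the entries of
  \<open>A\<close>; differentiability and continuity of the inversion are read off from
  this.\<close>

lemma matrix_inv_cramer:
  fixes A :: "real^'n^'n"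
  assumes "det A \<noteq> 0"
  shows "matrix_inv A = (\<chi> k j. det (\<chi> r c. if c = k then axis j 1 $ r else A $ r $ c) / det A)"
proof -
  have inv: "invertible A" using assms by (simp add: invertible_det_nz)
  have "column j (matrix_inv A) = (\<chi> k. det (\<chi> r c. if c = k then axis j 1 $ r else A $ r $ c) / det A)" for j
  proof -
    have "A *v (matrix_inv A *v axis j 1) = axis j 1" by (rule matrix_inv_mult_vec(1)[OF inv])
    then show ?thesis
      using cramer[OF assms, of "matrix_inv A *v axis j 1" "axis j 1"] by (simp add: matrix_vector_mult_basis)
  qed
  then show ?thesis by (simp add: vec_eq_iff column_def)
qed

lemma det_differentiable:
  fixes A :: "'s::real_normed_vector \<Rightarrow> real^'n^'n"
  assumes "\<And>i j. (\<lambda>s. A s $ i $ j) differentiable (at x)"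
  shows "(\<lambda>s. det (A s)) differentiable (at x)"
proof -
  from assms obtain A' where "\<And>i j. ((\<lambda>s. A s $ i $ j) has_derivative A' i j) (at x)"
    unfolding differentiable_def by metis
  then have "(\<lambda>s. \<Prod>i\<in>UNIV. A s $ i $ p i) differentiable (at x)" for p
    unfolding differentiable_def by (intro exI) (rule has_derivative_prod, blast)
  then show ?thesis
    unfolding det_def by (intro differentiable_sum differentiable_mult differentiable_const) auto
qed

lemma differentiable_vecI:
  fixes f :: "'s::real_normed_vector \<Rightarrow> ('v::euclidean_space)^'n"
  assumes "\<And>i. (\<lambda>s. f s $ i) differentiable (at x)"
  shows "f differentiable (at x)"
  unfolding differentiable_componentwise_within[of f]
proof
  fix b :: "'v^'n" assume "b \<in> Basis"
  then obtain i c where b: "b = axis i c" by (auto simp: Basis_vec_def)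
  show "(\<lambda>s. f s \<bullet> b) differentiable (at x)"
    using differentiable_inner[OF assms[of i], of "\<lambda>_. c"] by (simp add: b inner_axis)
qed

lemma matrix_inv_differentiable:
  fixes A :: "'s::real_normed_vector \<Rightarrow> real^'n^'n"
  assumes A: "\<And>i j. (\<lambda>s. A s $ i $ j) differentiable (at x)" and inv: "invertible (A x)"
  shows "(\<lambda>s. matrix_inv (A s)) differentiable (at x)"
proof -
  have det: "(\<lambda>s. det (A s)) differentiable (at x)" by (rule det_differentiable[OF A])
  have nz: "det (A x) \<noteq> 0" using inv by (simp add: invertible_det_nz)
  have "isCont (\<lambda>s. det (A s)) x" by (rule differentiable_imp_continuous_within[OF det])
  then have "\<forall>\<^sub>F s in at x. det (A s) \<noteq> 0" using nz by (auto simp: isCont_def dest: tendsto_imp_eventually_ne)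
  then obtain d where d: "d > 0" "\<And>s. dist s x < d \<Longrightarrow> det (A s) \<noteq> 0"
    unfolding eventually_at using nz by (metis UNIV_I)
  have "(\<lambda>s. (\<chi> k j. det (\<chi> r c. if c = k then axis j 1 $ r else A s $ r $ c) / det (A s)) :: real^'n^'n)
      differentiable (at x)"
  proof (intro differentiable_vecI)
    fix k j
    have "(\<lambda>s. det (\<chi> r c. if c = k then axis j 1 $ r else A s $ r $ c)) differentiable (at x)"
    proof (rule det_differentiable)
      fix i ja
      show "(\<lambda>s. (\<chi> r c. if c = k then axis j 1 $ r else A s $ r $ c) $ i $ ja) differentiable (at x)"
        by (cases "ja = k") (simp_all add: A)
    qed
    then show "(\<lambda>s. (\<chi> k j. det (\<chi> r c. if c = k then axis j 1 $ r else A s $ r $ c) / det (A s)) $ k $ j)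
      differentiable (at x)"
      using det nz by (auto intro: differentiable_divide)
  qed
  then show ?thesis
    by (rule differentiable_transform_within[OF _ d(1)]) (auto simp: d(2) matrix_inv_cramer)
qed

lemma isCont_matrix_inv:
  fixes B :: "real^'n^'n"
  assumes "invertible B"
  shows "isCont matrix_inv B"
proof -
  have "(\<lambda>A::real^'n^'n. matrix_inv A) differentiable (at B)"
  proof (rule matrix_inv_differentiable[of "\<lambda>A. A", OF _ assms])
    fix i j :: 'n
    have "bounded_linear (\<lambda>A::real^'n^'n. A $ i $ j)"
      by (rule bounded_linear_compose[OF bounded_linear_vec_nth bounded_linear_vec_nth])
    then show "(\<lambda>A::real^'n^'n. A $ i $ j) differentiable (at B)"
      by (rule bounded_linear_imp_differentiable)
  qed
  then show ?thesis by (rule differentiable_imp_continuous_within)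
qed

section \<open>Zeros of maps whose derivative stays close to a fixed matrix\<close>

definition deriv_close :: "(real^'m \<Rightarrow> real^'m) \<Rightarrow> real^'m^'m \<Rightarrow> real \<Rightarrow> (real^'m) set \<Rightarrow> bool" where
  "deriv_close f B \<epsilon> S \<longleftrightarrow>
    (\<forall>a\<in>S. f differentiable (at a) \<and> (\<forall>x. norm ((jacobian f (at a) - B) *v x) \<le> \<epsilon> * norm x))"

lemma deriv_close_subset: "deriv_close f B \<epsilon> S \<Longrightarrow> T \<subseteq> S \<Longrightarrow> deriv_close f B \<epsilon> T"
  unfolding deriv_close_def by blast

text \<open>The mean value inequality for \<open>f - B\<close>, whose derivative has operator norm
  at most \<open>\<epsilon>\<close> on the convex set \<open>S\<close>.\<close>

lemma deriv_close_linearization: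
  assumes "convex S" "deriv_close f B \<epsilon> S" "a \<in> S" "b \<in> S"
  shows "norm (f b - f a - B *v (b - a)) \<le> \<epsilon> * norm (b - a)"
proof -
  have "norm ((f b - B *v b) - (f a - B *v a)) \<le> \<epsilon> * norm (b - a)"
  proof (rule differentiable_bound[OF assms(1) _ _ assms(4,3)])
    fix x assume x: "x \<in> S"
    have "(f has_derivative (\<lambda>h. jacobian f (at x) *v h)) (at x)"
      using assms(2) x by (simp add: deriv_close_def jacobian_works)
    then show "((\<lambda>y. f y - B *v y) has_derivative (\<lambda>h. jacobian f (at x) *v h - B *v h)) (at x within S)"
      by (rule has_derivative_diff[OF has_derivative_at_withinI
          bounded_linear_imp_has_derivative[OF matrix_vector_mul_bounded_linear]])
    show "onorm (\<lambda>h. jacobian f (at x) *v h - B *v h) \<le> \<epsilon>"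
      using assms(2) x
      by (intro onorm_le) (simp add: deriv_close_def matrix_vector_mult_diff_rdistrib)
  qed
  then show ?thesis by (simp add: matrix_vector_mult_diff_distrib algebra_simps)
qed

text \<open>The lower bound for \<open>B\<close> passes to increments of \<open>f\<close>: as
  \<open>K * \<epsilon> \<le> 1/2\<close>, the linearization error is absorbed into half of the
  left-hand side, which doubles the constant. This gives both uniqueness of a zero and a bound on
  its distance from any other point.\<close>

lemma deriv_close_injective:
  assumes "convex S" "deriv_close f B \<epsilon> S" "a \<in> S" "b \<in> S"
    and K: "K > 0" "\<And>x. norm x \<le> K * norm (B *v x)" "K * \<epsilon> \<le> 1/2"
  shows "norm (b - a) \<le> 2 * K * norm (f b - f a)"
proof -
  have "norm (B *v (b - a)) \<le> norm (f b - f a) + norm (f b - f a - B *v (b - a))"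
    using norm_triangle_ineq4[of "f b - f a" "f b - f a - B *v (b - a)"] by simp
  then have "norm (B *v (b - a)) \<le> norm (f b - f a) + \<epsilon> * norm (b - a)"
    using deriv_close_linearization[OF assms(1-4)] by linarith
  with K(1) have "K * norm (B *v (b - a)) \<le> K * (norm (f b - f a) + \<epsilon> * norm (b - a))"
    by (intro mult_left_mono) auto
  with K(2)[of "b - a"] have "norm (b - a) \<le> K * norm (f b - f a) + (K * \<epsilon>) * norm (b - a)"
    by (simp add: algebra_simps)
  moreover have "(K * \<epsilon>) * norm (b - a) \<le> 1/2 * norm (b - a)"
    using K(3) by (intro mult_right_mono) auto
  ultimately show ?thesis by simp
qed

lemma deriv_close_invertible:
  assumes "deriv_close f B \<epsilon> S" "a \<in> S"
    and K: "K > 0" "\<And>x. norm x \<le> K * norm (B *v x)" "K * \<epsilon> \<le> 1/2"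
  shows "norm x \<le> 2 * K * norm (jacobian f (at a) *v x)" "invertible (jacobian f (at a))"
proof -
  show *: "norm x \<le> 2 * K * norm (jacobian f (at a) *v x)" for x
  proof -
    have "norm ((jacobian f (at a) - B) *v x) \<le> \<epsilon> * norm x"
      using assms(1,2) by (simp add: deriv_close_def)
    then have "norm (B *v x) \<le> norm (jacobian f (at a) *v x) + \<epsilon> * norm x"
      using norm_triangle_ineq4[of "jacobian f (at a) *v x" "(jacobian f (at a) - B) *v x"]
      by (simp add: matrix_vector_mult_diff_rdistrib)
    with K(1) have "K * norm (B *v x) \<le> K * (norm (jacobian f (at a) *v x) + \<epsilon> * norm x)"
      by (intro mult_left_mono) auto
    with K(2)[of x] have "norm x \<le> K * norm (jacobian f (at a) *v x) + (K * \<epsilon>) * norm x"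
      by (simp add: algebra_simps)
    moreover have "(K * \<epsilon>) * norm x \<le> 1/2 * norm x"
      using K(3) by (intro mult_right_mono) auto
    ultimately show ?thesis by simp
  qed
  show "invertible (jacobian f (at a))"
    using *  by (intro invertibleI_injective) (metis mult_zero_right norm_zero norm_le_zero_iff)
qed

text \<open>Newton's iteration with the fixed matrix \<open>B\<close> is a contraction of the ball.\<close>

lemma deriv_close_root:
  fixes f :: "real^'m \<Rightarrow> real^'m"
  assumes dc: "deriv_close f B \<epsilon> (cball a0 \<delta>)" and "\<epsilon> \<ge> 0" and B: "invertible B"
    and K: "K > 0" "\<And>x. norm x \<le> K * norm (B *v x)" "K * \<epsilon> \<le> 1/2"
    and small: "2 * K * norm (f a0) \<le> \<delta>"
  obtains a where "a \<in> cball a0 \<delta>" "f a = 0" "norm (a - a0) \<le> 2 * K * norm (f a0)"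
proof -
  define T where "T x = x - matrix_inv B *v f x" for x
  have \<delta>: "\<delta> \<ge> 0" using small K(1) by (meson norm_ge_zero mult_nonneg_nonneg order_trans zero_le_numeral less_imp_le)
  have bound: "norm (matrix_inv B *v y) \<le> K * norm y" for y
    using K(2)[of "matrix_inv B *v y"] by (simp add: matrix_inv_mult_vec(1)[OF B])
  have contr: "norm (T x - T y) \<le> 1/2 * norm (x - y)" if "x \<in> cball a0 \<delta>" "y \<in> cball a0 \<delta>" for x y
  proof -
    have "T x - T y = - (matrix_inv B *v (f x - f y - B *v (x - y)))"
      using matrix_inv_mult_vec(2)[OF B, of "x - y"]
      by (simp add: T_def matrix_vector_mult_diff_distrib)
    then have "norm (T x - T y) \<le> K * norm (f x - f y - B *v (x - y))" using bound by simp
    also have "\<dots> \<le> K * (\<epsilon> * norm (x - y))"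
      using deriv_close_linearization[OF convex_cball dc that(2,1)] K(1) by (intro mult_left_mono) auto
    also have "\<dots> \<le> 1/2 * norm (x - y)"
      using mult_right_mono[OF K(3), of "norm (x - y)"] by (simp add: mult.assoc)
    finally show ?thesis .
  qed
  \<comment> \<open>The centre moves by at most half the radius and the contraction factor 1/2
    accounts for the other half, so the ball is mapped into itself.\<close>
  have T0: "norm (T a0 - a0) \<le> \<delta> / 2" using bound[of "f a0"] small by (simp add: T_def)
  have maps: "T ` cball a0 \<delta> \<subseteq> cball a0 \<delta>"
  proof (intro subsetI, elim imageE)
    fix y x assume y: "y = T x" and x: "x \<in> cball a0 \<delta>"
    have "norm (T x - a0) \<le> norm (T x - T a0) + norm (T a0 - a0)"
      by (metis diff_add_cancel diff_diff_eq2 norm_triangle_ineq add_diff_eq)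
    also have "\<dots> \<le> 1/2 * norm (x - a0) + \<delta>/2"
      using contr[OF x, of a0] \<delta> T0 by (intro add_mono) auto
    also have "\<dots> \<le> \<delta>" using x by (simp add: dist_norm norm_minus_commute)
    finally show "y \<in> cball a0 \<delta>" by (simp add: y dist_norm norm_minus_commute)
  qed
  have "\<exists>!x. x \<in> cball a0 \<delta> \<and> T x = x"
  proof (rule Banach_fix[where c="1/2"])
    show "Topological_Spaces.complete (cball a0 \<delta>)" by (simp add: complete_eq_closed)
    show "cball a0 \<delta> \<noteq> {}" using \<delta> by simp
    show "dist (T x) (T y) \<le> 1/2 * dist x y" if "x \<in> cball a0 \<delta>" "y \<in> cball a0 \<delta>" for x y
      using contr[OF that] by (simp add: dist_norm)
  qed (use maps in auto)
  then obtain a where a: "a \<in> cball a0 \<delta>" "T a = a" by blast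
  then have "f a = 0" using matrix_inv_mult_vec(1)[OF B, of "f a"] by (simp add: T_def)
  moreover have "norm (a - a0) \<le> 2 * K * norm (f a0)"
    using deriv_close_injective[OF convex_cball dc _ a(1) K, of a0] \<delta> \<open>f a = 0\<close> by simp
  ultimately show thesis using a(1) that by blast
qed

section \<open>Calculus of continuously differentiable functions\<close>

definition C1_on :: "('a::euclidean_space \<Rightarrow> 'b::real_normed_vector) \<Rightarrow> 'a set \<Rightarrow> bool" where
  "C1_on f S \<longleftrightarrow> (\<forall>x\<in>S. f differentiable (at x)) \<and>
     (\<forall>v. continuous_on S (\<lambda>x. frechet_derivative f (at x) v))"

lemma C1_onI:
  assumes "\<And>x. x \<in> S \<Longrightarrow> (f has_derivative f' x) (at x)" "\<And>v. continuous_on S (\<lambda>x. f' x v)"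
  shows "C1_on f S"
proof -
  have "frechet_derivative f (at x) = f' x" if "x \<in> S" for x
    using frechet_derivative_at[OF assms(1)[OF that]] by simp
  then show ?thesis
    unfolding C1_on_def using assms by (auto simp: differentiable_def intro: continuous_on_eq)
qed

lemma C1_onD:
  assumes "C1_on f S"
  shows "x \<in> S \<Longrightarrow> (f has_derivative frechet_derivative f (at x)) (at x)"
    "continuous_on S (\<lambda>x. frechet_derivative f (at x) v)" "continuous_on S f"
proof -
  show *: "x \<in> S \<Longrightarrow> (f has_derivative frechet_derivative f (at x)) (at x)" for x
    using assms by (simp add: C1_on_def frechet_derivative_works)
  show "continuous_on S (\<lambda>x. frechet_derivative f (at x) v)" using assms by (simp add: C1_on_def)
  show "continuous_on S f"
    using * by (meson continuous_at_imp_continuous_on has_derivative_continuous)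
qed

lemma C1_on_subset: "C1_on f S \<Longrightarrow> T \<subseteq> S \<Longrightarrow> C1_on f T"
  unfolding C1_on_def by (meson continuous_on_subset subsetD)

lemma C1_on_cong:
  assumes "open S" "\<And>x. x \<in> S \<Longrightarrow> f x = g x" "C1_on f S"
  shows "C1_on g S"
proof (rule C1_onI)
  fix x assume "x \<in> S"
  then show "(g has_derivative frechet_derivative f (at x)) (at x)"
    using has_derivative_transform_within_open[OF C1_onD(1)[OF assms(3)] assms(1) _ assms(2)] by simp
qed (rule C1_onD(2)[OF assms(3)])

lemma C1_on_const: "C1_on (\<lambda>_. c) S"
  by (rule C1_onI[where f'="\<lambda>_ _. 0"]) auto

lemma C1_on_add: "C1_on f S \<Longrightarrow> C1_on g S \<Longrightarrow> C1_on (\<lambda>x. f x + g x) S"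
  by (rule C1_onI[where f'="\<lambda>x v. frechet_derivative f (at x) v + frechet_derivative g (at x) v"])
     (auto intro!: has_derivative_add continuous_on_add C1_onD(1,2))

lemma C1_on_mult:
  fixes f g :: "'a::euclidean_space \<Rightarrow> real"
  shows "C1_on f S \<Longrightarrow> C1_on g S \<Longrightarrow> C1_on (\<lambda>x. f x * g x) S"
  by (rule C1_onI[where f'="\<lambda>x v. f x * frechet_derivative g (at x) v + frechet_derivative f (at x) v * g x"])
     (auto intro!: has_derivative_mult continuous_on_add continuous_on_mult C1_onD(1,2) intro: C1_onD(3))

lemma C1_on_sum: "(\<And>i. i \<in> I \<Longrightarrow> C1_on (f i) S) \<Longrightarrow> C1_on (\<lambda>x. \<Sum>i\<in>I. f i x) S"
  by (induction I rule: infinite_finite_induct) (auto intro: C1_on_const C1_on_add)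

lemma C1_on_compose_linear:
  assumes "C1_on f T" "bounded_linear g" "g ` S \<subseteq> T"
  shows "C1_on (\<lambda>x. f (g x)) S"
proof (rule C1_onI[where f'="\<lambda>x v. frechet_derivative f (at (g x)) (g v)"])
  fix x assume x: "x \<in> S"
  show "((\<lambda>x. f (g x)) has_derivative (\<lambda>v. frechet_derivative f (at (g x)) (g v))) (at x)"
    using has_derivative_compose[OF bounded_linear_imp_has_derivative[OF assms(2)] C1_onD(1)[OF assms(1)]] x assms(3)
    by blast
next
  fix v
  show "continuous_on S (\<lambda>x. frechet_derivative f (at (g x)) (g v))"
    by (rule continuous_on_compose2[OF C1_onD(2)[OF assms(1)] linear_continuous_on[OF assms(2)] assms(3)])
qed

lemma C1_on_linear: "bounded_linear f \<Longrightarrow> C1_on f S"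
  by (rule C1_onI[where f'="\<lambda>_. f"]) (auto intro: bounded_linear_imp_has_derivative)

lemma has_derivative_vecI:
  fixes f :: "'a::real_normed_vector \<Rightarrow> real^'n"
  assumes "\<And>i. ((\<lambda>x. f x $ i) has_derivative (\<lambda>v. f' v $ i)) (at x)"
  shows "(f has_derivative f') (at x)"
  unfolding has_derivative_componentwise_within[of f]
  using assms by (auto simp: Basis_vec_def inner_axis)

lemma has_derivative_vec_nth:
  fixes f :: "'a::real_normed_vector \<Rightarrow> ('b::real_normed_vector)^'n"
  shows "(f has_derivative f') (at x) \<Longrightarrow> ((\<lambda>x. f x $ i) has_derivative (\<lambda>v. f' v $ i)) (at x)"
  by (rule bounded_linear.has_derivative[OF bounded_linear_vec_nth])

lemma C1_on_vecI:
  fixes f :: "'a::euclidean_space \<Rightarrow> real^'n"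
  assumes "\<And>i. C1_on (\<lambda>x. f x $ i) S"
  shows "C1_on f S"
  by (rule C1_onI[where f'="\<lambda>x v. \<chi> i. frechet_derivative (\<lambda>x. f x $ i) (at x) v"])
     (auto intro!: has_derivative_vecI continuous_on_vec_lambda C1_onD(1,2)[OF assms])

definition C2_on :: "('a::euclidean_space \<Rightarrow> real) \<Rightarrow> 'a set \<Rightarrow> bool" where
  "C2_on f S \<longleftrightarrow> C1_on f S \<and> (\<forall>b\<in>Basis. C1_on (\<lambda>x. frechet_derivative f (at x) b) S)"

text \<open>Partial derivatives that are themselves differentiable are continuous, and every
  directional derivative is a fixed linear combination of them.\<close>

lemma C1_on_if_times_differentiable:
  assumes "times_differentiable_on (Suc (Suc k)) f S"
  shows "C1_on f S"
proof (rule C1_onI)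
  fix x assume "x \<in> S"
  then show "(f has_derivative frechet_derivative f (at x)) (at x)"
    using assms by (simp add: frechet_derivative_works)
next
  fix v
  have cont: "continuous_on S (\<lambda>x. \<Sum>b\<in>Basis. (v \<bullet> b) *\<^sub>R frechet_derivative f (at x) b)"
    using assms
    by (intro continuous_on_sum continuous_on_scaleR continuous_on_const)
       (auto intro!: continuous_at_imp_continuous_on differentiable_imp_continuous_within)
  have eq: "frechet_derivative f (at x) v = (\<Sum>b\<in>Basis. (v \<bullet> b) *\<^sub>R frechet_derivative f (at x) b)"
    if "x \<in> S" for x
  proof -
    have lin: "linear (frechet_derivative f (at x))"
      using assms that by (auto intro: linear_frechet_derivative)
    have "frechet_derivative f (at x) (\<Sum>b\<in>Basis. (v \<bullet> b) *\<^sub>R b) =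
        (\<Sum>b\<in>Basis. (v \<bullet> b) *\<^sub>R frechet_derivative f (at x) b)"
      by (simp only: linear_sum[OF lin] linear_scale[OF lin])
    then show ?thesis by (simp only: euclidean_representation)
  qed
  show "continuous_on S (\<lambda>x. frechet_derivative f (at x) v)"
    by (rule continuous_on_eq[OF cont eq[symmetric]])
qed

lemma C2_on_if_times_differentiable:
  assumes "times_differentiable_on 3 f S"
  shows "C2_on f S"
  unfolding C2_on_def
proof (intro conjI ballI)
  note * = assms[unfolded numeral_3_eq_3]
  show "C1_on f S" by (rule C1_on_if_times_differentiable[OF *])
  fix b :: 'a assume "b \<in> Basis"
  then show "C1_on (\<lambda>x. frechet_derivative f (at x) b) S"
    using *[unfolded times_differentiable_on.simps(2)[of "Suc (Suc 0)"]]
    by (intro C1_on_if_times_differentiable[where k=0]) blast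
qed

lemma C2_on_add:
  assumes "open S" "C2_on f S" "C2_on g S"
  shows "C2_on (\<lambda>x. f x + g x) S"
proof -
  have C1: "C1_on f S" "C1_on g S" using assms(2,3) by (auto simp: C2_on_def)
  have "C1_on (\<lambda>x. frechet_derivative (\<lambda>x. f x + g x) (at x) b) S" if "b \<in> Basis" for b
  proof (rule C1_on_cong[OF assms(1)])
    show "C1_on (\<lambda>x. frechet_derivative f (at x) b + frechet_derivative g (at x) b) S"
      using assms that by (intro C1_on_add) (auto simp: C2_on_def)
    fix x assume "x \<in> S"
    then show "frechet_derivative f (at x) b + frechet_derivative g (at x) b =
        frechet_derivative (\<lambda>x. f x + g x) (at x) b"
      using fun_cong[OF frechet_derivative_at[OF has_derivative_add[OF C1_onD(1)[OF C1(1)] C1_onD(1)[OF C1(2)]]], of x b]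
      by simp
  qed
  then show ?thesis using assms by (auto simp: C2_on_def intro: C1_on_add)
qed

lemma C2_on_const: "C2_on (\<lambda>_. c) S"
  unfolding C2_on_def by (simp add: C1_on_const)

lemma C2_on_scale:
  assumes "open S" "C2_on f S"
  shows "C2_on (\<lambda>x. c * f x) S"
proof -
  have C1: "C1_on f S" using assms(2) by (auto simp: C2_on_def)
  have "C1_on (\<lambda>x. frechet_derivative (\<lambda>x. c * f x) (at x) b) S" if "b \<in> Basis" for b
  proof (rule C1_on_cong[OF assms(1)])
    show "C1_on (\<lambda>x. c * frechet_derivative f (at x) b) S"
      using assms that by (intro C1_on_mult C1_on_const) (auto simp: C2_on_def)
    fix x assume "x \<in> S"
    then show "c * frechet_derivative f (at x) b = frechet_derivative (\<lambda>x. c * f x) (at x) b"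
      using fun_cong[OF frechet_derivative_at[OF has_derivative_mult_right[OF C1_onD(1)[OF C1]]], of x c b]
      by simp
  qed
  then show ?thesis using assms by (auto simp: C2_on_def intro: C1_on_mult C1_on_const)
qed

lemma C2_on_sum:
  assumes "open S" "\<And>i. i \<in> I \<Longrightarrow> C2_on (f i) S"
  shows "C2_on (\<lambda>x. \<Sum>i\<in>I. f i x) S"
  using assms(2)
  by (induction I rule: infinite_finite_induct) (auto intro: C2_on_const C2_on_add[OF assms(1)])

section \<open>Symmetry of second derivatives\<close>

lemma second_difference_mean_value:
  fixes f :: "'a::euclidean_space \<Rightarrow> real"
  assumes "C2_on f S" "b \<in> Basis" "h > 0"
    and S: "\<And>s t. 0 \<le> s \<Longrightarrow> s \<le> h \<Longrightarrow> 0 \<le> t \<Longrightarrow> t \<le> h \<Longrightarrow> x + s *\<^sub>R b + t *\<^sub>R c \<in> S"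
  obtains s t where "0 < s" "s < h" "0 < t" "t < h"
    "f (x + h *\<^sub>R b + h *\<^sub>R c) - f (x + h *\<^sub>R b) - f (x + h *\<^sub>R c) + f x =
      h * (h * frechet_derivative (\<lambda>x. frechet_derivative f (at x) b) (at (x + s *\<^sub>R b + t *\<^sub>R c)) c)"
proof -
  let ?fb = "\<lambda>x. frechet_derivative f (at x) b"
  have f: "(f has_derivative frechet_derivative f (at y)) (at y)" if "y \<in> S" for y
    using assms(1) that by (auto simp: C2_on_def intro: C1_onD)
  have fb: "(?fb has_derivative frechet_derivative ?fb (at y)) (at y)" if "y \<in> S" for y
    using C1_onD(1)[of ?fb S y] assms(1,2) that by (simp add: C2_on_def)
  have lin: "linear (frechet_derivative f (at y))" "linear (frechet_derivative ?fb (at y))" if "y \<in> S" for y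
    using f[OF that] fb[OF that] has_derivative_linear by blast+
  define u where "u s = f (x + s *\<^sub>R b + h *\<^sub>R c) - f (x + s *\<^sub>R b)" for s
  have "\<exists>s\<in>{0<..<h}. u h - u 0 =
     (\<lambda>r. frechet_derivative f (at (x + s *\<^sub>R b + h *\<^sub>R c)) (r *\<^sub>R b) - frechet_derivative f (at (x + s *\<^sub>R b)) (r *\<^sub>R b)) (h - 0)"
  proof (rule mvt_simple[OF assms(3)])
    fix s assume s: "0 \<le> s" "s \<le> h"
    have y: "x + s *\<^sub>R b + h *\<^sub>R c \<in> S" "x + s *\<^sub>R b \<in> S"
      using S[OF s, of h] S[OF s, of 0] assms(3) by auto
    have g1: "((\<lambda>s. x + s *\<^sub>R b + h *\<^sub>R c) has_derivative (\<lambda>r. r *\<^sub>R b)) (at s within {0..h})"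
      by (auto intro!: derivative_eq_intros)
    have g2: "((\<lambda>s. x + s *\<^sub>R b) has_derivative (\<lambda>r. r *\<^sub>R b)) (at s within {0..h})"
      by (auto intro!: derivative_eq_intros)
    show "(u has_derivative (\<lambda>r. frechet_derivative f (at (x + s *\<^sub>R b + h *\<^sub>R c)) (r *\<^sub>R b) -
        frechet_derivative f (at (x + s *\<^sub>R b)) (r *\<^sub>R b))) (at s within {0..h})"
      unfolding u_def
      by (intro has_derivative_diff has_derivative_compose[OF g1 f[OF y(1)]] has_derivative_compose[OF g2 f[OF y(2)]])
  qed
  then obtain s where s: "0 < s" "s < h"
    "u h - u 0 = frechet_derivative f (at (x + s *\<^sub>R b + h *\<^sub>R c)) (h *\<^sub>R b) - frechet_derivative f (at (x + s *\<^sub>R b)) (h *\<^sub>R b)"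
    by auto
  have y: "x + s *\<^sub>R b + h *\<^sub>R c \<in> S" "x + s *\<^sub>R b \<in> S"
    using S[of s h] S[of s 0] assms(3) s by auto
  have eq1: "u h - u 0 = h * (?fb (x + s *\<^sub>R b + h *\<^sub>R c) - ?fb (x + s *\<^sub>R b))"
    unfolding s(3) using lin(1)[OF y(1)] lin(1)[OF y(2)] by (simp add: linear_scale algebra_simps)
  have "\<exists>t\<in>{0<..<h}. ?fb (x + s *\<^sub>R b + h *\<^sub>R c) - ?fb (x + s *\<^sub>R b + 0 *\<^sub>R c) =
     (\<lambda>r. frechet_derivative ?fb (at (x + s *\<^sub>R b + t *\<^sub>R c)) (r *\<^sub>R c)) (h - 0)"
  proof (rule mvt_simple[OF assms(3)])
    fix t assume t: "0 \<le> t" "t \<le> h"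
    have y: "x + s *\<^sub>R b + t *\<^sub>R c \<in> S" using S[of s t] t s by auto
    have g: "((\<lambda>t. x + s *\<^sub>R b + t *\<^sub>R c) has_derivative (\<lambda>r. r *\<^sub>R c)) (at t within {0..h})"
      by (auto intro!: derivative_eq_intros)
    show "((\<lambda>t. ?fb (x + s *\<^sub>R b + t *\<^sub>R c)) has_derivative
        (\<lambda>r. frechet_derivative ?fb (at (x + s *\<^sub>R b + t *\<^sub>R c)) (r *\<^sub>R c))) (at t within {0..h})"
      by (rule has_derivative_compose[OF g fb[OF y]])
  qed
  then obtain t where t: "0 < t" "t < h"
    "?fb (x + s *\<^sub>R b + h *\<^sub>R c) - ?fb (x + s *\<^sub>R b) = frechet_derivative ?fb (at (x + s *\<^sub>R b + t *\<^sub>R c)) (h *\<^sub>R c)"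
    by auto
  have y: "x + s *\<^sub>R b + t *\<^sub>R c \<in> S" using S[of s t] t s by auto
  have "u h - u 0 = h * (h * frechet_derivative ?fb (at (x + s *\<^sub>R b + t *\<^sub>R c)) c)"
    unfolding eq1 t(3) using lin(2)[OF y] by (simp add: linear_scale)
  then show thesis using s t by (intro that[of s t]) (auto simp: u_def)
qed

text \<open>The second difference of \<open>f\<close> along \<open>b\<close> and \<open>c\<close>
  does not depend on their order. Two applications of the mean value theorem turn it into
  \<open>h * h\<close> times either mixed derivative at a point near \<open>x\<close>, and
  continuity of both mixed derivatives brings them back to \<open>x\<close>.\<close>

lemma C2_on_symmetric:
  fixes f :: "'a::euclidean_space \<Rightarrow> real"
  assumes C2: "C2_on f S" and "open S" "x \<in> S" and b: "b \<in> Basis" and c: "c \<in> Basis"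
  shows "frechet_derivative (\<lambda>x. frechet_derivative f (at x) b) (at x) c =
    frechet_derivative (\<lambda>x. frechet_derivative f (at x) c) (at x) b" (is "?F b c x = ?F c b x")
proof (rule ccontr)
  assume ne: "?F b c x \<noteq> ?F c b x"
  \<comment> \<open>Half the gap: a common value cannot lie within \<open>e\<close> of both mixed
    derivatives at \<open>x\<close>.\<close>
  define e where "e = \<bar>?F b c x - ?F c b x\<bar> / 2"
  have e: "e > 0" using ne by (simp add: e_def)
  have cont: "isCont (?F b c) x" "isCont (?F c b) x"
    using C1_onD(2)[of "\<lambda>x. frechet_derivative f (at x) b" S c]
      C1_onD(2)[of "\<lambda>x. frechet_derivative f (at x) c" S b] C2 b c assms(2,3)
    by (auto simp: C2_on_def continuous_on_eq_continuous_at)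
  obtain d1 where d1: "d1 > 0" "\<And>y. dist y x < d1 \<Longrightarrow> dist (?F b c y) (?F b c x) < e"
    using cont(1) e unfolding continuous_at_eps_delta by blast
  obtain d2 where d2: "d2 > 0" "\<And>y. dist y x < d2 \<Longrightarrow> dist (?F c b y) (?F c b x) < e"
    using cont(2) e unfolding continuous_at_eps_delta by blast
  obtain d3 where d3: "d3 > 0" "\<And>y. dist y x < d3 \<Longrightarrow> y \<in> S"
    using assms(2,3) unfolding open_dist by blast
  \<comment> \<open>The parallelogram of side \<open>h\<close> at \<open>x\<close> lies within
    distance \<open>2 * h\<close>, hence well inside the three balls.\<close>
  define h where "h = min d1 (min d2 d3) / 4"
  have h: "h > 0" "4 * h \<le> d1" "4 * h \<le> d2" "4 * h \<le> d3" using d1 d2 d3 by (auto simp: h_def)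
  have near: "dist (x + s *\<^sub>R u + t *\<^sub>R v) x < 4 * h"
    if "0 \<le> s" "s \<le> h" "0 \<le> t" "t \<le> h" "norm u = 1" "norm v = 1" for s t and u v :: 'a
  proof -
    have "dist (x + s *\<^sub>R u + t *\<^sub>R v) x \<le> norm (s *\<^sub>R u) + norm (t *\<^sub>R v)"
      using norm_triangle_ineq[of "s *\<^sub>R u" "t *\<^sub>R v"] by (simp add: dist_norm algebra_simps)
    then show ?thesis using that h by simp
  qed
  have inS: "x + s *\<^sub>R u + t *\<^sub>R v \<in> S"
    if "norm u = 1" "norm v = 1" "0 \<le> s" "s \<le> h" "0 \<le> t" "t \<le> h" for s t and u v :: 'a
    using near[OF that(3-6,1,2)] h(4) by (intro d3(2)) linarith
  have nb: "norm b = 1" "norm c = 1" using b c by auto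
  obtain s t where st: "0 < s" "s < h" "0 < t" "t < h"
    "f (x + h *\<^sub>R b + h *\<^sub>R c) - f (x + h *\<^sub>R b) - f (x + h *\<^sub>R c) + f x = h * (h * ?F b c (x + s *\<^sub>R b + t *\<^sub>R c))"
    by (rule second_difference_mean_value[OF C2 b h(1) inS[OF nb]])
  obtain s' t' where st': "0 < s'" "s' < h" "0 < t'" "t' < h"
    "f (x + h *\<^sub>R c + h *\<^sub>R b) - f (x + h *\<^sub>R c) - f (x + h *\<^sub>R b) + f x = h * (h * ?F c b (x + s' *\<^sub>R c + t' *\<^sub>R b))"
    by (rule second_difference_mean_value[OF C2 c h(1) inS[OF nb(2,1)]])
  have "x + h *\<^sub>R c + h *\<^sub>R b = x + h *\<^sub>R b + h *\<^sub>R c" by (simp add: algebra_simps)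
  from st(5) st'(5)[unfolded this] have "h * (h * ?F b c (x + s *\<^sub>R b + t *\<^sub>R c)) = h * (h * ?F c b (x + s' *\<^sub>R c + t' *\<^sub>R b))"
    by linarith
  then have eq: "?F b c (x + s *\<^sub>R b + t *\<^sub>R c) = ?F c b (x + s' *\<^sub>R c + t' *\<^sub>R b)" using h by simp
  have "dist (?F b c (x + s *\<^sub>R b + t *\<^sub>R c)) (?F b c x) < e"
    using near[of s t b c] st nb h by (intro d1(2)) auto
  moreover have "dist (?F c b (x + s' *\<^sub>R c + t' *\<^sub>R b)) (?F c b x) < e"
    using near[of s' t' c b] st' nb h by (intro d2(2)) auto
  moreover have "\<bar>u - v\<bar> < \<bar>v - w\<bar> / 2 \<Longrightarrow> \<bar>u - w\<bar> < \<bar>v - w\<bar> / 2 \<Longrightarrow> False" for u v w :: real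
    by (simp add: abs_if split: if_splits)
  ultimately show False unfolding eq dist_real_def e_def by blast
qed

section \<open>A uniform law of large numbers\<close>

text \<open>A derivative as the limit of a sequence of quotients, ready for limits of measurable
  functions and for dominated convergence.\<close>

lemma has_derivative_quotient_limit:
  fixes f :: "'a::real_normed_vector \<Rightarrow> real"
  assumes "(f has_derivative f') (at x)"
  shows "(\<lambda>n. (f (x + inverse (real (Suc n)) *\<^sub>R e) - f x) / inverse (real (Suc n))) \<longlonglongrightarrow> f' e"
proof -
  have "((\<lambda>t. x + t *\<^sub>R e) has_derivative (\<lambda>t. t *\<^sub>R e)) (at (0::real))"
    by (auto intro!: derivative_eq_intros)
  from has_derivative_compose[OF this, of f f'] assms
  have "((\<lambda>t. f (x + t *\<^sub>R e)) has_derivative (\<lambda>t. f' (t *\<^sub>R e))) (at (0::real))" by simp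
  moreover have "(\<lambda>t. f' (t *\<^sub>R e)) = (*) (f' e)"
    using linear_scale[OF has_derivative_linear[OF assms]] by (simp add: fun_eq_iff mult.commute)
  ultimately have "((\<lambda>t. f (x + t *\<^sub>R e)) has_field_derivative f' e) (at (0::real))"
    by (simp add: has_field_derivative_def)
  then have "((\<lambda>t. (f (x + t *\<^sub>R e) - f x) / t) \<longlongrightarrow> f' e) (at (0::real))"
    by (simp add: DERIV_def)
  moreover have "filterlim (\<lambda>n. inverse (real (Suc n))) (at 0) sequentially"
    using LIMSEQ_inverse_real_of_nat by (simp add: filterlim_at)
  ultimately show ?thesis by (rule filterlim_compose)
qed

text \<open>A limit of measurable difference quotients. Measurability in \<open>z\<close> is known
  at points of \<open>V\<close> only, so a quotient whose second point is outside \<open>V\<close>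
  is set to 0; this happens for finitely many \<open>n\<close>.\<close>

lemma frechet_derivative_measurable:
  fixes f :: "'z \<Rightarrow> 'a::real_normed_vector \<Rightarrow> real"
  assumes V: "open V" "x \<in> V" and d: "\<And>z. (f z has_derivative f' z) (at x)"
    and meas: "\<And>y. y \<in> V \<Longrightarrow> (\<lambda>z. f z y) \<in> borel_measurable F"
  shows "(\<lambda>z. f' z v) \<in> borel_measurable F"
proof -
  define y where "y n = x + inverse (real (Suc n)) *\<^sub>R v" for n
  define q where "q n z = (if y n \<in> V then (f z (y n) - f z x) / inverse (real (Suc n)) else 0)" for n z
  have "y \<longlonglongrightarrow> x + 0 *\<^sub>R v"
    unfolding y_def by (intro tendsto_intros LIMSEQ_inverse_real_of_nat)
  then have ev: "\<forall>\<^sub>F n in sequentially. y n \<in> V"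
    using topological_tendstoD[of y x sequentially V] V by simp
  show ?thesis
  proof (rule borel_measurable_LIMSEQ_real)
    show "q n \<in> borel_measurable F" for n
      using meas[of "y n"] meas[OF V(2)] by (cases "y n \<in> V") (simp_all add: q_def[abs_def])
    fix z
    have "(\<lambda>n. (f z (y n) - f z x) / inverse (real (Suc n))) \<longlonglongrightarrow> f' z v"
      unfolding y_def by (rule has_derivative_quotient_limit[OF d])
    then show "(\<lambda>n. q n z) \<longlonglongrightarrow> f' z v"
      by (rule Lim_transform_eventually) (use ev in \<open>auto elim!: eventually_mono simp: q_def\<close>)
  qed
qed

lemma vec_measurableI:
  fixes f :: "'z \<Rightarrow> real^'n"
  assumes "\<And>i. (\<lambda>z. f z $ i) \<in> borel_measurable F"
  shows "f \<in> borel_measurable F"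
  unfolding borel_measurable_euclidean_space[of f] using assms by (auto simp: Basis_vec_def inner_axis)

lemma vec_nth_measurable:
  fixes f :: "'z \<Rightarrow> real^'n"
  shows "f \<in> borel_measurable F \<Longrightarrow> (\<lambda>z. f z $ i) \<in> borel_measurable F"
  by (rule borel_measurable_continuous_on[OF linear_continuous_on[OF bounded_linear_vec_nth]])

lemma directional_mean_value_bound:
  fixes f :: "'a::real_normed_vector \<Rightarrow> real"
  assumes "t > 0" and f: "\<And>s. 0 \<le> s \<Longrightarrow> s \<le> t \<Longrightarrow> (f has_derivative f' (x + s *\<^sub>R e)) (at (x + s *\<^sub>R e))"
    and bound: "\<And>s. 0 \<le> s \<Longrightarrow> s \<le> t \<Longrightarrow> \<bar>f' (x + s *\<^sub>R e) e\<bar> \<le> C"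
  shows "\<bar>(f (x + t *\<^sub>R e) - f x) / t\<bar> \<le> C"
proof -
  have "\<exists>s\<in>{0<..<t}. f (x + t *\<^sub>R e) - f (x + 0 *\<^sub>R e) = (\<lambda>r. f' (x + s *\<^sub>R e) (r *\<^sub>R e)) (t - 0)"
  proof (rule mvt_simple[OF assms(1)])
    fix s assume s: "0 \<le> s" "s \<le> t"
    have "((\<lambda>s. x + s *\<^sub>R e) has_derivative (\<lambda>r. r *\<^sub>R e)) (at s within {0..t})"
      by (auto intro!: derivative_eq_intros)
    from has_derivative_compose[OF this f[OF s]]
    show "((\<lambda>s. f (x + s *\<^sub>R e)) has_derivative (\<lambda>r. f' (x + s *\<^sub>R e) (r *\<^sub>R e))) (at s within {0..t})" .
  qed
  then obtain s where s: "0 < s" "s < t" "f (x + t *\<^sub>R e) - f x = f' (x + s *\<^sub>R e) (t *\<^sub>R e)" by auto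
  then have "f (x + t *\<^sub>R e) - f x = t * f' (x + s *\<^sub>R e) e"
    using linear_scale[OF has_derivative_linear[OF f[of s]]] by simp
  then show ?thesis using bound[of s] s assms(1) by simp
qed

text \<open>Events that depend on the tolerance are merged into one sequence: at stage
  \<open>n\<close> take the union of those belonging to the first \<open>n + 1\<close> tolerances.
  It eventually exceeds each single bound.\<close>

lemma (in prob_space) with_prob_to_oneI_eventually_ge:
  assumes "\<And>\<eta>. \<eta> > 0 \<Longrightarrow> \<exists>A. (\<forall>n. A n \<in> events \<and> (\<forall>\<omega>\<in>A n. P n \<omega>)) \<and> (\<forall>\<^sub>F n in sequentially. 1 - \<eta> \<le> prob (A n))"
  shows "with_prob_to_one M P"
proof -
  have "\<exists>A. (\<forall>n. A n \<in> events \<and> (\<forall>\<omega>\<in>A n. P n \<omega>)) \<and> (\<forall>\<^sub>F n in sequentially. 1 - inverse (real (Suc k)) \<le> prob (A n))" for k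
    by (rule assms) simp
  then obtain A where A: "\<And>k n. A k n \<in> events" "\<And>k n \<omega>. \<omega> \<in> A k n \<Longrightarrow> P n \<omega>"
    "\<And>k. \<forall>\<^sub>F n in sequentially. 1 - inverse (real (Suc k)) \<le> prob (A k n)"
    by metis
  define B where "B n = (\<Union>k\<le>n. A k n)" for n
  have B: "B n \<in> events" for n using A(1) by (auto simp: B_def)
  have "(\<lambda>n. prob (B n)) \<longlonglongrightarrow> 1"
  proof (rule LIMSEQ_I)
    fix r :: real assume "r > 0"
    then obtain k where k: "inverse (real (Suc k)) < r" using reals_Archimedean by blast
    have "\<forall>\<^sub>F n in sequentially. norm (prob (B n) - 1) < r"
      using A(3)[of k] eventually_ge_at_top[of k]
    proof eventually_elim
      case (elim n)
      have "prob (A k n) \<le> prob (B n)"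
        by (rule finite_measure_mono) (use elim B in \<open>auto simp: B_def\<close>)
      then show ?case using elim k prob_le_1[of "B n"] by simp
    qed
    then show "\<exists>n0. \<forall>n\<ge>n0. norm (prob (B n) - 1) < r" by (simp add: eventually_sequentially)
  qed
  moreover have "P n \<omega>" if "\<omega> \<in> B n" for n \<omega> using that A(2) by (auto simp: B_def)
  ultimately show ?thesis using B by (intro with_prob_to_oneI)
qed

text \<open>The rule that o_p(1) times O_p(1) is o_p(1), with boundedness in probability supplied by
  a uniform second moment.\<close>

lemma (in prob_space) tendsto_in_prob_small_multiple:
  fixes R :: "nat \<Rightarrow> 'a \<Rightarrow> 'v::euclidean_space" and Y :: "nat \<Rightarrow> 'a \<Rightarrow> 'u::euclidean_space"
  assumes R: "\<And>\<epsilon>. \<epsilon> > 0 \<Longrightarrow> with_prob_to_one M (\<lambda>n \<omega>. norm (R n \<omega>) \<le> \<epsilon> * norm (Y n \<omega>))"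
    and Y [measurable]: "\<And>n. Y n \<in> borel_measurable M" and Y_int: "\<And>n. integrable M (\<lambda>\<omega>. (norm (Y n \<omega>))\<^sup>2)"
    and Y_bound: "\<And>n. expectation (\<lambda>\<omega>. (norm (Y n \<omega>))\<^sup>2) \<le> C"
  shows "tendsto_in_prob M R 0"
  unfolding tendsto_in_prob_iff
proof (intro allI impI, rule with_prob_to_oneI_eventually_ge)
  fix \<epsilon> \<eta> :: real assume \<epsilon>: "\<epsilon> > 0" and \<eta>: "\<eta> > 0"
  have C: "C \<ge> 0" using Y_bound[of 0] by (meson Bochner_Integration.integral_nonneg order_trans zero_le_power2)
  \<comment> \<open>Makes Chebyshev's bound \<open>C / T\<^sup>2\<close> at most
    \<open>\<eta> / 2\<close>. On \<open>norm (Y n \<omega>) < T\<close> the factor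
    \<open>\<epsilon> / T\<close> then gives a remainder below \<open>\<epsilon>\<close>.\<close>
  define T where "T = sqrt (2 * (C + 1) / \<eta>)"
  have T: "T > 0" "T\<^sup>2 = 2 * (C + 1) / \<eta>" using C \<eta> by (auto simp: T_def)
  have "\<epsilon> / T > 0" using \<epsilon> T by simp
  from R[OF this] obtain A where A: "\<And>n. A n \<in> events" "\<And>n \<omega>. \<omega> \<in> A n \<Longrightarrow> norm (R n \<omega>) \<le> \<epsilon> / T * norm (Y n \<omega>)"
    "(\<lambda>n. prob (A n)) \<longlonglongrightarrow> 1"
    unfolding with_prob_to_one_def by blast
  define B where "B n = A n - {\<omega> \<in> space M. T \<le> norm (Y n \<omega>)}" for n
  have B: "B n \<in> events" for n unfolding B_def using A(1) by measurable
  have "dist (R n \<omega>) 0 < \<epsilon>" if "\<omega> \<in> B n" for n \<omega>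
  proof -
    have "\<omega> \<in> A n" "norm (Y n \<omega>) < T" using that A(1) sets.sets_into_space by (auto simp: B_def)
    then have "norm (R n \<omega>) \<le> \<epsilon> / T * norm (Y n \<omega>)" "\<epsilon> / T * norm (Y n \<omega>) < \<epsilon> / T * T"
      using A(2)[of \<omega> n] mult_strict_left_mono[OF _ \<open>\<epsilon> / T > 0\<close>, of "norm (Y n \<omega>)" T] by blast+
    then show ?thesis using T by simp
  qed
  moreover have "\<forall>\<^sub>F n in sequentially. 1 - \<eta> \<le> prob (B n)"
  proof -
    have "\<forall>\<^sub>F n in sequentially. 1 - \<eta> / 2 < prob (A n)"
      using order_tendstoD(1)[OF A(3)] \<eta> by simp
    then show ?thesis
    proof eventually_elim
      case (elim n)
      have "prob {\<omega> \<in> space M. T \<le> norm (Y n \<omega>)} \<le> expectation (\<lambda>\<omega>. (norm (Y n \<omega>))\<^sup>2) / T\<^sup>2"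
        by (rule prob_norm_ge_le[OF Y Y_int T(1)])
      also have "\<dots> \<le> C / T\<^sup>2" using Y_bound by (intro divide_right_mono) auto
      also have "\<dots> \<le> \<eta> / 2" unfolding T(2) using C \<eta> by (simp add: field_simps)
      finally have p: "prob {\<omega> \<in> space M. T \<le> norm (Y n \<omega>)} \<le> \<eta> / 2" .
      have "prob (A n) \<le> prob (B n \<union> {\<omega> \<in> space M. T \<le> norm (Y n \<omega>)})"
        by (rule finite_measure_mono) (use B[of n] in \<open>auto simp: B_def intro: sets.Un A(1)\<close>)
      also have "\<dots> \<le> prob (B n) + prob {\<omega> \<in> space M. T \<le> norm (Y n \<omega>)}"
        using B by (intro measure_Un_le) auto
      finally show ?case using p elim by linarith
    qed
  qed
  ultimately show "\<exists>A. (\<forall>n. A n \<in> events \<and> (\<forall>\<omega>\<in>A n. dist (R n \<omega>) 0 < \<epsilon>)) \<and> (\<forall>\<^sub>F n in sequentially. 1 - \<eta> \<le> prob (A n))"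
    using B by (intro exI[of _ B]) simp
qed

context iid_sample
begin

text \<open>No Lipschitz condition is needed: by dominated convergence the expected oscillation of
  \<open>f z\<close> over a ball tends to 0 with the radius.\<close>

theorem uniform_law_of_large_numbers:
  fixes f :: "'z \<Rightarrow> 'v::euclidean_space \<Rightarrow> real"
  assumes U: "open U" "a0 \<in> U" and cont: "\<And>z. continuous_on U (f z)"
    and meas: "\<And>a. a \<in> U \<Longrightarrow> (\<lambda>z. f z a) \<in> borel_measurable F"
    and m: "integrable F m" "\<And>z a. a \<in> U \<Longrightarrow> \<bar>f z a\<bar> \<le> m z" and "\<epsilon> > 0"
  obtains \<delta> where "\<delta> > 0" "cball a0 \<delta> \<subseteq> U"
    "with_prob_to_one M (\<lambda>n \<omega>. \<forall>a\<in>cball a0 \<delta>. \<bar>avg (\<lambda>z. f z a) n \<omega> - (\<integral>z. f z a0 \<partial>F)\<bar> < \<epsilon>)"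
proof -
  obtain Q :: "'v set" where Q: "countable Q" "\<And>X. open X \<Longrightarrow> X \<noteq> {} \<Longrightarrow> \<exists>d\<in>Q. d \<in> X"
    by (rule countable_dense_setE) blast
  obtain r where r: "r > 0" "ball a0 r \<subseteq> U" using U open_contains_ball by blast
  define \<rho> where "\<rho> k = r * inverse (real (Suc k))" for k
  have \<rho>: "\<rho> k > 0" "\<rho> k \<le> r" for k
    using r(1) by (auto simp: \<rho>_def field_simps)
  have sub: "ball a0 (\<rho> k) \<subseteq> U" for k using r(2) \<rho>(2)[of k] by (meson ball_subset_ball_iff order_trans subset_ball)
  define osc where "osc a z = \<bar>f z a - f z a0\<bar>" for a z
  \<comment> \<open>The supremum runs over a countable dense set to be measurable in
    \<open>z\<close>; continuity in \<open>a\<close> makes it a bound on the whole ball.\<close>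
  define w where "w k z = (SUP a\<in>Q \<inter> ball a0 (\<rho> k). osc a z)" for k z
  have osc_le: "osc a z \<le> 2 * m z" if "a \<in> U" for a z
    using m(2)[OF that, of z] m(2)[OF U(2), of z] by (simp add: osc_def abs_le_iff)
  have ne: "Q \<inter> ball a0 (\<rho> k) \<noteq> {}" for k using Q(2)[of "ball a0 (\<rho> k)"] \<rho>(1)[of k] by auto
  have bdd: "bdd_above ((\<lambda>a. osc a z) ` (Q \<inter> ball a0 (\<rho> k)))" for k z
    by (rule bdd_aboveI2[of _ _ "2 * m z"]) (use osc_le sub in blast)
  have meas_osc: "osc a \<in> borel_measurable F" if "a \<in> U" for a
    unfolding osc_def using meas[OF that] meas[OF U(2)] by measurable
  have w_meas [measurable]: "w k \<in> borel_measurable F" for k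
    unfolding w_def
  proof (rule borel_measurable_cSUP)
    show "osc a \<in> borel_measurable F" if "a \<in> Q \<inter> ball a0 (\<rho> k)" for a
      using that by (intro meas_osc subsetD[OF sub[of k]]) simp
  qed (use Q(1) bdd in \<open>auto intro: countable_Int1\<close>)
  have w_upper: "osc a z \<le> w k z" if "a \<in> ball a0 (\<rho> k)" for a z k
  proof (rule ccontr)
    assume "\<not> osc a z \<le> w k z"
    then have gt: "w k z < osc a z" by simp
    have "continuous_on (ball a0 (\<rho> k)) (\<lambda>a. osc a z)"
      unfolding osc_def by (intro continuous_intros continuous_on_subset[OF cont sub])
    then have "open ((\<lambda>a. osc a z) -` {w k z<..} \<inter> ball a0 (\<rho> k))"
      using continuous_on_open_vimage[OF open_ball] open_greaterThan by blast
    from Q(2)[OF this] gt that obtain d where "d \<in> Q" "d \<in> ball a0 (\<rho> k)" "w k z < osc d z"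
      by blast
    moreover from this have "osc d z \<le> w k z" unfolding w_def by (intro cSUP_upper bdd) auto
    ultimately show False by simp
  qed
  have w_nonneg: "0 \<le> w k z" for k z
    using w_upper[of a0 k z] \<rho>(1)[of k] by (simp add: osc_def)
  have w_le: "w k z \<le> 2 * m z" for k z
    unfolding w_def by (rule cSUP_least[OF ne]) (use osc_le sub in blast)
  have w_int: "integrable F (w k)" for k
    by (rule Bochner_Integration.integrable_bound[of F "\<lambda>z. 2 * m z"])
       (use m(1) w_le w_nonneg in \<open>auto simp: abs_of_nonneg intro: order_trans[OF _ abs_ge_self]\<close>)
  have "(\<lambda>k. \<integral>z. w k z \<partial>F) \<longlonglongrightarrow> (\<integral>z. 0 \<partial>F)"
  proof (rule integral_dominated_convergence[where w="\<lambda>z. 2 * m z"])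
    show "AE z in F. (\<lambda>k. w k z) \<longlonglongrightarrow> 0"
    proof (intro AE_I2 LIMSEQ_I)
      fix z and e :: real assume e: "e > 0"
      have "isCont (f z) a0" using cont U by (simp add: continuous_on_eq_continuous_at)
      then obtain d where d: "d > 0" "\<And>a. dist a a0 < d \<Longrightarrow> dist (f z a) (f z a0) < e / 2"
        unfolding continuous_at_eps_delta using e by (meson half_gt_zero)
      have "\<rho> \<longlonglongrightarrow> r * 0" unfolding \<rho>_def by (intro tendsto_mult tendsto_const LIMSEQ_inverse_real_of_nat)
      then have "\<forall>\<^sub>F k in sequentially. \<rho> k < d" using order_tendstoD(2)[of \<rho> 0] d(1) by simp
      then obtain k0 where k0: "\<And>k. k \<ge> k0 \<Longrightarrow> \<rho> k < d" by (auto simp: eventually_sequentially)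
      have "w k z \<le> e / 2" if "k \<ge> k0" for k
        unfolding w_def
      proof (rule cSUP_least[OF ne])
        fix a assume "a \<in> Q \<inter> ball a0 (\<rho> k)"
        then show "osc a z \<le> e / 2"
          using d(2)[of a] k0[OF that] by (simp add: osc_def dist_real_def dist_commute)
      qed
      then show "\<exists>k0. \<forall>k\<ge>k0. norm (w k z - 0) < e"
        using w_nonneg e by (intro exI[of _ k0]) (force simp: abs_of_nonneg)
    qed
  qed (use m(1) w_le w_nonneg in \<open>auto simp: abs_of_nonneg\<close>)
  then have "\<forall>\<^sub>F k in sequentially. (\<integral>z. w k z \<partial>F) < \<epsilon> / 3"
    using \<open>\<epsilon> > 0\<close> by (intro order_tendstoD(2)) auto
  then obtain k where k: "(\<integral>z. w k z \<partial>F) < \<epsilon> / 3" by (auto simp: eventually_sequentially)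
  have f_int: "integrable F (\<lambda>z. f z a0)"
    by (rule Bochner_Integration.integrable_bound[OF m(1)])
       (use meas[OF U(2)] m(2)[OF U(2)] in \<open>auto intro: order_trans[OF _ abs_ge_self]\<close>)
  have e3: "\<epsilon> / 3 > 0" using \<open>\<epsilon> > 0\<close> by simp
  show thesis
  proof
    show "\<rho> k / 2 > 0" using \<rho>(1) by simp
    have cb: "cball a0 (\<rho> k / 2) \<subseteq> ball a0 (\<rho> k)" using \<rho>(1)[of k] by (simp add: cball_subset_ball_iff)
    then show "cball a0 (\<rho> k / 2) \<subseteq> U" using sub by blast
    show "with_prob_to_one M (\<lambda>n \<omega>. \<forall>a\<in>cball a0 (\<rho> k / 2). \<bar>avg (\<lambda>z. f z a) n \<omega> - (\<integral>z. f z a0 \<partial>F)\<bar> < \<epsilon>)"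
    proof (rule with_prob_to_one_mono[OF with_prob_to_one_conj[OF
          tendsto_in_probD[OF weak_law_of_large_numbers[OF w_int[of k]] e3]
          tendsto_in_probD[OF weak_law_of_large_numbers[OF f_int] e3]]], intro ballI)
      fix n \<omega> a
      assume h: "dist (avg (w k) n \<omega>) (integral\<^sup>L F (w k)) < \<epsilon> / 3 \<and>
        dist (avg (\<lambda>z. f z a0) n \<omega>) (\<integral>z. f z a0 \<partial>F) < \<epsilon> / 3" and a: "a \<in> cball a0 (\<rho> k / 2)"
      have "\<bar>avg (\<lambda>z. f z a) n \<omega> - avg (\<lambda>z. f z a0) n \<omega>\<bar> = \<bar>\<Sum>i<n. f (Z i \<omega>) a - f (Z i \<omega>) a0\<bar> / real n"
        by (simp add: avg_def sum_subtractf diff_divide_distrib[symmetric] abs_divide)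
      also have "\<dots> \<le> (\<Sum>i<n. w k (Z i \<omega>)) / real n"
        using a cb w_upper
        by (intro divide_right_mono order_trans[OF sum_abs] sum_mono) (auto simp: osc_def[symmetric])
      also have "\<dots> = avg (w k) n \<omega>" by (simp add: avg_def)
      finally have "\<bar>avg (\<lambda>z. f z a) n \<omega> - avg (\<lambda>z. f z a0) n \<omega>\<bar> \<le> avg (w k) n \<omega>" .
      with h k show "\<bar>avg (\<lambda>z. f z a) n \<omega> - (\<integral>z. f z a0 \<partial>F)\<bar> < \<epsilon>"
        unfolding dist_real_def by linarith
    qed
  qed
qed

corollary avg_tendsto_in_prob_plug_in:
  fixes f :: "'z \<Rightarrow> 'v::euclidean_space \<Rightarrow> real"
  assumes "open U" "a0 \<in> U" "\<And>z. continuous_on U (f z)"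
    "\<And>a. a \<in> U \<Longrightarrow> (\<lambda>z. f z a) \<in> borel_measurable F"
    "integrable F m" "\<And>z a. a \<in> U \<Longrightarrow> \<bar>f z a\<bar> \<le> m z"
    and ah: "tendsto_in_prob M ah a0"
  shows "tendsto_in_prob M (\<lambda>n \<omega>. avg (\<lambda>z. f z (ah n \<omega>)) n \<omega>) (\<integral>z. f z a0 \<partial>F)"
  unfolding tendsto_in_prob_iff
proof (intro allI impI)
  fix \<epsilon> :: real assume "\<epsilon> > 0"
  obtain \<delta> where \<delta>: "\<delta> > 0" "cball a0 \<delta> \<subseteq> U"
    "with_prob_to_one M (\<lambda>n \<omega>. \<forall>a\<in>cball a0 \<delta>. \<bar>avg (\<lambda>z. f z a) n \<omega> - (\<integral>z. f z a0 \<partial>F)\<bar> < \<epsilon>)"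
    by (rule uniform_law_of_large_numbers[OF assms(1-6) \<open>\<epsilon> > 0\<close>])
  show "with_prob_to_one M (\<lambda>n \<omega>. dist (avg (\<lambda>z. f z (ah n \<omega>)) n \<omega>) (\<integral>z. f z a0 \<partial>F) < \<epsilon>)"
    by (rule with_prob_to_one_mono[OF with_prob_to_one_conj[OF \<delta>(3) tendsto_in_probD[OF ah \<delta>(1)]]])
       (auto simp: dist_real_def dist_commute)
qed

end

section \<open>Asymptotic normality of estimating equations\<close>

lemma has_derivative_jacobian_eq:
  fixes f :: "real^'m \<Rightarrow> real^'n"
  assumes "(f has_derivative (\<lambda>v. A *v v)) (at x)"
  shows "jacobian f (at x) = A"
  unfolding jacobian_def frechet_derivative_at[OF assms, symmetric] by (rule matrix_of_matrix_vector_mul)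

lemma jacobian_component:
  fixes f :: "real^'m \<Rightarrow> real^'n"
  assumes "f differentiable (at a)"
  shows "jacobian f (at a) $ i $ r = frechet_derivative (\<lambda>x. f x $ i) (at a) (axis r 1)"
    and "jacobian f (at a) $ i $ r = partial r f a $ i"
    and "((\<lambda>x. f x $ i) has_derivative (\<lambda>v. (jacobian f (at a) *v v) $ i)) (at a)"
proof -
  show *: "((\<lambda>x. f x $ i) has_derivative (\<lambda>v. (jacobian f (at a) *v v) $ i)) (at a)"
    using assms by (intro has_derivative_vec_nth) (simp add: jacobian_works)
  show "jacobian f (at a) $ i $ r = frechet_derivative (\<lambda>x. f x $ i) (at a) (axis r 1)"
    unfolding frechet_derivative_at[OF *, symmetric] by (simp add: matrix_vector_mult_basis column_def)
  show "jacobian f (at a) $ i $ r = partial r f a $ i"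
    by (simp add: jacobian_def matrix_def partial_def)
qed

lemma norm_matrix_vector_mult_le:
  fixes A :: "real^'n^'m"
  assumes "\<And>i j. \<bar>A $ i $ j\<bar> \<le> c"
  shows "norm (A *v x) \<le> real CARD('m) * real CARD('n) * c * norm x"
proof -
  have "norm (A *v x) \<le> onorm ((*v) A) * norm x"
    by (rule onorm[OF matrix_vector_mul_bounded_linear])
  also have "\<dots> \<le> (real CARD('m) * real CARD('n) * c) * norm x"
    by (intro mult_right_mono onorm_le_matrix_component assms) auto
  finally show ?thesis .
qed

lemma outer_matrix_mult:
  "outer (A *v x) (C *v y) = A ** outer x y ** transpose C"
proof -
  have "(outer (A *v x) (C *v y)) *v w = (A ** outer x y ** transpose C) *v w" for w
    by (simp add: outer_mult_vec matrix_vector_mul_assoc[symmetric] matrix_vector_mult_scaleR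
        dot_lmul_matrix[symmetric] transpose_matrix_vector inner_commute)
  then show ?thesis by (simp add: matrix_eq)
qed

lemma matrix_add_rdistrib:
  fixes A A' :: "real^'n^'m"
  shows "(A + A') ** C = A ** C + A' ** C"
  by (simp add: matrix_matrix_mult_def vec_eq_iff sum.distrib distrib_right)

lemma linear_sandwich:
  fixes R :: "real^'m^'p"
  shows "linear (\<lambda>X. R ** X ** transpose R)"
  by (rule linearI) (simp_all add: matrix_add_ldistrib matrix_add_rdistrib,
        simp add: matrix_matrix_mult_def vec_eq_iff sum_distrib_left sum_distrib_right mult_ac)

text \<open>Used twice: for \<open>eta\<close> at \<open>\<alpha>0\<close> and, at an endpoint
  \<open>e\<close>, for \<open>\<phi>\<close> with \<lambda> fixed. That the mean vanishes at
  \<open>a0\<close> is not part of the locale, because at an endpoint the centring is given only as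
  a limit of estimates; \<open>mean_zero\<close> derives it.\<close>

locale z_estimation = iid_sample M F Z
  for M :: "'w measure" and F :: "'z measure" and Z :: "nat \<Rightarrow> 'w \<Rightarrow> 'z" +
  fixes h :: "'z \<Rightarrow> real^'m \<Rightarrow> real^'m" and a0 :: "real^'m" and U :: "(real^'m) set"
    and m0 m1 :: "'z \<Rightarrow> real"
  assumes U: "open U" "a0 \<in> U"
    and h_measurable: "\<And>a. a \<in> U \<Longrightarrow> (\<lambda>z. h z a) \<in> borel_measurable F"
    and h_C1: "\<And>z. C1_on (h z) U"
    and m0: "m0 \<in> borel_measurable F" "integrable F (\<lambda>z. (m0 z)\<^sup>2)" "\<And>z a. a \<in> U \<Longrightarrow> norm (h z a) \<le> m0 z"
    and m1: "m1 \<in> borel_measurable F" "integrable F (\<lambda>z. (m1 z)\<^sup>2)"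
      "\<And>z a r. a \<in> U \<Longrightarrow> norm (partial r (h z) a) \<le> m1 z"
    and mean_differentiable: "(\<lambda>a. \<integral>z. h z a \<partial>F) differentiable (at a0)"
    and mean_invertible: "invertible (jacobian (\<lambda>a. \<integral>z. h z a \<partial>F) (at a0))"
begin

definition B :: "real^'m^'m" where "B = jacobian (\<lambda>a. \<integral>z. h z a \<partial>F) (at a0)"

definition f_n :: "nat \<Rightarrow> 'w \<Rightarrow> real^'m \<Rightarrow> real^'m" where
  "f_n n \<omega> a = avg (\<lambda>z. h z a) n \<omega>"

definition K :: "real^'m^'m" where "K = (\<integral>z. outer (h z a0) (h z a0) \<partial>F)"

lemma h_differentiable: "a \<in> U \<Longrightarrow> h z differentiable (at a)"
  using h_C1 by (simp add: C1_on_def)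

lemma B_invertible: "invertible B"
  using mean_invertible by (simp add: B_def)

lemma m1_integrable: "integrable F m1"
proof -
  interpret F: prob_space F by (rule prob_space_F)
  show ?thesis by (rule F.square_integrable_imp_integrable[OF m1(1,2)])
qed

lemma m1_bound: "a \<in> U \<Longrightarrow> \<bar>jacobian (h z) (at a) $ i $ r\<bar> \<le> m1 z"
  using order_trans[OF component_le_norm_cart m1(3)] h_differentiable
  by (simp add: jacobian_component(2))

lemma h_component_derivative:
  "a \<in> U \<Longrightarrow> ((\<lambda>x. h z x $ i) has_derivative (\<lambda>v. (jacobian (h z) (at a) *v v) $ i)) (at a)"
  by (rule jacobian_component(3)[OF h_differentiable])

lemma h_component_measurable: "a \<in> U \<Longrightarrow> (\<lambda>z. h z a $ i) \<in> borel_measurable F"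
  by (rule vec_nth_measurable[OF h_measurable])

lemma jacobian_measurable:
  assumes a: "a \<in> U"
  shows "(\<lambda>z. jacobian (h z) (at a) $ i $ r) \<in> borel_measurable F"
proof -
  have "(\<lambda>z. (jacobian (h z) (at a) *v axis r 1) $ i) \<in> borel_measurable F"
    by (rule frechet_derivative_measurable[where f'="\<lambda>z v. (jacobian (h z) (at a) *v v) $ i",
          OF U(1) a h_component_derivative[OF a] h_component_measurable])
  then show ?thesis by (simp add: matrix_vector_mult_basis column_def)
qed

lemma h_integrable: "a \<in> U \<Longrightarrow> integrable F (\<lambda>z. h z a)"
proof -
  interpret F: prob_space F by (rule prob_space_F)
  assume a: "a \<in> U"
  show ?thesis
    by (rule Bochner_Integration.integrable_bound[OF F.square_integrable_imp_integrable[OF m0(1,2)] h_measurable[OF a]])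
       (use m0(3)[OF a] in \<open>auto intro: order_trans[OF _ abs_ge_self]\<close>)
qed

text \<open>Differentiation under the integral sign. The mean value theorem bounds the difference
  quotients by \<open>m1\<close>, so dominated convergence applies.\<close>

lemma B_component: "B $ i $ r = (\<integral>z. jacobian (h z) (at a0) $ i $ r \<partial>F)"
proof -
  obtain \<rho> where \<rho>: "\<rho> > 0" "cball a0 \<rho> \<subseteq> U" using U open_contains_cball by blast
  \<comment> \<open>The quotients are started at index \<open>n0\<close>, from which on their
    segments stay in \<open>cball a0 \<rho>\<close>, where the envelope is valid.\<close>
  obtain n0 :: nat where n0: "inverse (real (Suc n0)) < \<rho>" using reals_Archimedean[OF \<rho>(1)] by blast
  define t where "t n = inverse (real (Suc n))" for n
  have t: "t n > 0" for n by (simp add: t_def)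
  have t\<rho>: "t n \<le> \<rho>" if "n \<ge> n0" for n
  proof -
    have "t n \<le> inverse (real (Suc n0))" unfolding t_def using that by (intro le_imp_inverse_le) auto
    then show ?thesis using n0 by simp
  qed
  define x where "x n = a0 + t n *\<^sub>R axis r 1" for n
  have inU: "a0 + s *\<^sub>R axis r 1 \<in> U" if "0 \<le> s" "s \<le> \<rho>" for s
    using that \<rho>(2) by (intro subsetD[OF \<rho>(2)]) (simp add: dist_norm)
  have "(\<lambda>n. ((\<integral>z. h z (x n) \<partial>F) $ i - (\<integral>z. h z a0 \<partial>F) $ i) / t n) \<longlonglongrightarrow> (B *v axis r 1) $ i"
    unfolding x_def t_def B_def
    by (rule has_derivative_quotient_limit[OF jacobian_component(3)[OF mean_differentiable]])
  then have "(\<lambda>n. ((\<integral>z. h z (x n) \<partial>F) $ i - (\<integral>z. h z a0 \<partial>F) $ i) / t n) \<longlonglongrightarrow> B $ i $ r"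
    by (simp add: matrix_vector_mult_basis column_def)
  then have lim1: "(\<lambda>n. ((\<integral>z. h z (x (n + n0)) \<partial>F) $ i - (\<integral>z. h z a0 \<partial>F) $ i) / t (n + n0)) \<longlonglongrightarrow> B $ i $ r"
    by (rule LIMSEQ_ignore_initial_segment)
  have xU: "x (n + n0) \<in> U" for n unfolding x_def using t[of "n + n0"] t\<rho>[of "n + n0"] by (intro inU) auto
  have comp: "(\<integral>z. h z a \<partial>F) $ i = (\<integral>z. h z a $ i \<partial>F)" "integrable F (\<lambda>z. h z a $ i)" if "a \<in> U" for a
    using integral_bounded_linear[OF bounded_linear_vec_nth h_integrable[OF that], of i]
      integrable_bounded_linear[OF bounded_linear_vec_nth h_integrable[OF that], of i] by simp_all
  have eq: "((\<integral>z. h z (x (n + n0)) \<partial>F) $ i - (\<integral>z. h z a0 \<partial>F) $ i) / t (n + n0) =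
      (\<integral>z. (h z (x (n + n0)) $ i - h z a0 $ i) / t (n + n0) \<partial>F)" for n
    using comp[OF xU[of n]] comp[OF U(2)] by simp
  have "(\<lambda>n. \<integral>z. (h z (x (n + n0)) $ i - h z a0 $ i) / t (n + n0) \<partial>F) \<longlonglongrightarrow>
      (\<integral>z. jacobian (h z) (at a0) $ i $ r \<partial>F)"
  proof (rule integral_dominated_convergence[where w=m1])
    show "AE z in F. (\<lambda>n. (h z (x (n + n0)) $ i - h z a0 $ i) / t (n + n0)) \<longlonglongrightarrow> jacobian (h z) (at a0) $ i $ r"
    proof (rule AE_I2)
      fix z
      have "(\<lambda>n. (h z (x n) $ i - h z a0 $ i) / t n) \<longlonglongrightarrow> (jacobian (h z) (at a0) *v axis r 1) $ i"
        unfolding x_def t_def by (rule has_derivative_quotient_limit[OF h_component_derivative[OF U(2)]])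
      then have "(\<lambda>n. (h z (x n) $ i - h z a0 $ i) / t n) \<longlonglongrightarrow> jacobian (h z) (at a0) $ i $ r"
        by (simp add: matrix_vector_mult_basis column_def)
      then show "(\<lambda>n. (h z (x (n + n0)) $ i - h z a0 $ i) / t (n + n0)) \<longlonglongrightarrow> jacobian (h z) (at a0) $ i $ r"
        by (rule LIMSEQ_ignore_initial_segment)
    qed
    show "AE z in F. norm ((h z (x (n + n0)) $ i - h z a0 $ i) / t (n + n0)) \<le> m1 z" for n
    proof (rule AE_I2)
      fix z
      have "\<bar>(h z (x (n + n0)) $ i - h z a0 $ i) / t (n + n0)\<bar> \<le> m1 z"
        unfolding x_def
      proof (rule directional_mean_value_bound[OF t, where f'="\<lambda>a v. (jacobian (h z) (at a) *v v) $ i"])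
        fix s assume "0 \<le> s" "s \<le> t (n + n0)"
        then have s: "a0 + s *\<^sub>R axis r 1 \<in> U" using t\<rho>[of "n + n0"] by (intro inU) auto
        show "((\<lambda>a. h z a $ i) has_derivative (\<lambda>v. (jacobian (h z) (at (a0 + s *\<^sub>R axis r 1)) *v v) $ i))
            (at (a0 + s *\<^sub>R axis r 1))"
          by (rule h_component_derivative[OF s])
        show "\<bar>(jacobian (h z) (at (a0 + s *\<^sub>R axis r 1)) *v axis r 1) $ i\<bar> \<le> m1 z"
          using m1_bound[OF s, of z i r] by (simp add: matrix_vector_mult_basis column_def)
      qed
      then show "norm ((h z (x (n + n0)) $ i - h z a0 $ i) / t (n + n0)) \<le> m1 z" by simp
    qed
    show "(\<lambda>z. jacobian (h z) (at a0) $ i $ r) \<in> borel_measurable F" by (rule jacobian_measurable[OF U(2)])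
    show "(\<lambda>z. (h z (x (n + n0)) $ i - h z a0 $ i) / t (n + n0)) \<in> borel_measurable F" for n
      using h_component_measurable[OF xU[of n], of i] h_component_measurable[OF U(2), of i] by simp
  qed (rule m1_integrable)
  with lim1 show ?thesis unfolding eq by (rule LIMSEQ_unique)
qed

lemma jacobian_integrable: "integrable F (\<lambda>z. jacobian (h z) (at a0) $ i $ r)"
proof (rule Bochner_Integration.integrable_bound[OF m1_integrable jacobian_measurable[OF U(2)]])
  show "AE z in F. norm (jacobian (h z) (at a0) $ i $ r) \<le> norm (m1 z)"
    by (rule AE_I2) (simp add: order_trans[OF m1_bound[OF U(2)] abs_ge_self])
qed

lemma B_mult_nth: "(B *v x) $ r = (\<integral>z. (jacobian (h z) (at a0) *v x) $ r \<partial>F)"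
  by (simp add: matrix_vector_mult_def B_component Bochner_Integration.integral_sum jacobian_integrable)

lemma f_n_derivative:
  assumes "a \<in> U"
  shows "(f_n n \<omega> has_derivative (\<lambda>v. avg (\<lambda>z. jacobian (h z) (at a)) n \<omega> *v v)) (at a)"
proof -
  have "(h z has_derivative (\<lambda>v. jacobian (h z) (at a) *v v)) (at a)" for z
    using h_differentiable[OF assms] by (simp add: jacobian_works)
  then have "(f_n n \<omega> has_derivative (\<lambda>v. (1 / real n) *\<^sub>R (\<Sum>i<n. jacobian (h (Z i \<omega>)) (at a) *v v))) (at a)"
    unfolding f_n_def avg_def by (intro has_derivative_scaleR_right has_derivative_sum)
  moreover have "(1 / real n) *\<^sub>R (\<Sum>i<n. jacobian (h (Z i \<omega>)) (at a) *v v) = avg (\<lambda>z. jacobian (h z) (at a)) n \<omega> *v v" for v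
    by (simp add: avg_def matrix_vector_mult_sum_left scaleR_matrix_vector_assoc[symmetric])
  ultimately show ?thesis by simp
qed

lemma f_n_jacobian: "a \<in> U \<Longrightarrow> jacobian (f_n n \<omega>) (at a) = avg (\<lambda>z. jacobian (h z) (at a)) n \<omega>"
  by (rule has_derivative_jacobian_eq[OF f_n_derivative])

lemma f_n_differentiable: "a \<in> U \<Longrightarrow> f_n n \<omega> differentiable (at a)"
  using f_n_derivative differentiable_def by blast

lemma f_n_measurable: "a \<in> U \<Longrightarrow> (\<lambda>\<omega>. f_n n \<omega> a) \<in> borel_measurable M"
  unfolding f_n_def[abs_def] by (rule avg_measurable[OF h_measurable])

lemma jacobian_continuous: "continuous_on U (\<lambda>a. jacobian (h z) (at a) $ i $ r)"
proof -
  have "continuous_on U (\<lambda>a. frechet_derivative (h z) (at a) (axis r 1) $ i)"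
    by (intro continuous_on_component C1_onD(2)[OF h_C1])
  then show ?thesis by (simp add: jacobian_def matrix_def)
qed

text \<open>The uniform law for every entry of the Jacobian. There are finitely many entries, so the
  least of their radii serves all of them. Dividing \<open>\<epsilon>\<close> by the number of
  entries turns entrywise closeness into closeness as operators.\<close>

lemma deriv_close_B:
  assumes "\<epsilon> > 0"
  obtains \<delta> where "\<delta> > 0" "cball a0 \<delta> \<subseteq> U" "with_prob_to_one M (\<lambda>n \<omega>. deriv_close (f_n n \<omega>) B \<epsilon> (cball a0 \<delta>))"
proof -
  define c where "c = \<epsilon> / (real CARD('m) * real CARD('m))"
  have c: "c > 0" "real CARD('m) * real CARD('m) * c = \<epsilon>" using assms by (auto simp: c_def)
  let ?P = "\<lambda>p \<delta>. \<delta> > 0 \<and> cball a0 \<delta> \<subseteq> U \<and> with_prob_to_one M (\<lambda>n \<omega>. \<forall>a\<in>cball a0 \<delta>.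
      \<bar>avg (\<lambda>z. jacobian (h z) (at a) $ fst p $ snd p) n \<omega> - (\<integral>z. jacobian (h z) (at a0) $ fst p $ snd p \<partial>F)\<bar> < c)"
  have "\<exists>\<delta>. ?P p \<delta>" for p
  proof -
    obtain \<delta> where "\<delta> > 0" "cball a0 \<delta> \<subseteq> U" "with_prob_to_one M (\<lambda>n \<omega>. \<forall>a\<in>cball a0 \<delta>.
      \<bar>avg (\<lambda>z. jacobian (h z) (at a) $ fst p $ snd p) n \<omega> - (\<integral>z. jacobian (h z) (at a0) $ fst p $ snd p \<partial>F)\<bar> < c)"
      by (rule uniform_law_of_large_numbers[OF U jacobian_continuous jacobian_measurable m1_integrable m1_bound c(1)])
    then show ?thesis by blast
  qed
  then have "\<exists>\<delta>. \<forall>p. ?P p (\<delta> p)" by (rule choice[OF allI])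
  then obtain \<delta> where "\<forall>p. ?P p (\<delta> p)" by (rule exE)
  then have \<delta>: "?P p (\<delta> p)" for p by (rule spec)
  define d where "d = Min (range \<delta>)"
  have d: "d \<le> \<delta> p" for p unfolding d_def by (intro Min_le) auto
  have "d \<in> range \<delta>" unfolding d_def by (intro Min_in) auto
  then obtain p where "d = \<delta> p" by blast
  then have d0: "d > 0" "cball a0 d \<subseteq> U" using \<delta>[of p] by blast+
  have wp: "with_prob_to_one M (\<lambda>n \<omega>. \<forall>p\<in>UNIV. \<forall>a\<in>cball a0 (\<delta> p).
      \<bar>avg (\<lambda>z. jacobian (h z) (at a) $ fst p $ snd p) n \<omega> - (\<integral>z. jacobian (h z) (at a0) $ fst p $ snd p \<partial>F)\<bar> < c)"
    by (rule with_prob_to_one_finite_all) (use \<delta> in simp_all)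
  have "with_prob_to_one M (\<lambda>n \<omega>. deriv_close (f_n n \<omega>) B \<epsilon> (cball a0 d))"
  proof (rule with_prob_to_one_mono[OF wp])
    fix n \<omega> assume *: "\<forall>p\<in>UNIV. \<forall>a\<in>cball a0 (\<delta> p).
      \<bar>avg (\<lambda>z. jacobian (h z) (at a) $ fst p $ snd p) n \<omega> - (\<integral>z. jacobian (h z) (at a0) $ fst p $ snd p \<partial>F)\<bar> < c"
    show "deriv_close (f_n n \<omega>) B \<epsilon> (cball a0 d)"
      unfolding deriv_close_def
    proof (intro ballI conjI allI)
      fix a x assume a: "a \<in> cball a0 d"
      then have aU: "a \<in> U" using d0 by blast
      then show "f_n n \<omega> differentiable (at a)" by (rule f_n_differentiable)
      have "\<bar>(jacobian (f_n n \<omega>) (at a) - B) $ i $ j\<bar> \<le> c" for i j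
      proof -
        have "a \<in> cball a0 (\<delta> (i, j))" using a d[of "(i, j)"] by auto
        with * have "\<bar>avg (\<lambda>z. jacobian (h z) (at a) $ i $ j) n \<omega> - B $ i $ j\<bar> < c"
          by (force simp: B_component)
        then show ?thesis by (simp add: f_n_jacobian[OF aU] avg_def sum_component)
      qed
      from norm_matrix_vector_mult_le[OF this, of x] c(2)
      show "norm ((jacobian (f_n n \<omega>) (at a) - B) *v x) \<le> \<epsilon> * norm x" by simp
    qed
  qed
  with d0 show thesis by (rule that)
qed

lemma h_square_integrable: "integrable F (\<lambda>z. (norm (h z a0))\<^sup>2)"
proof (rule Bochner_Integration.integrable_bound[OF m0(2)])
  show "(\<lambda>z. (norm (h z a0))\<^sup>2) \<in> borel_measurable F" using h_measurable[OF U(2)] by measurable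
  show "AE z in F. norm ((norm (h z a0))\<^sup>2) \<le> norm ((m0 z)\<^sup>2)"
    using m0(3)[OF U(2)] by (auto intro!: power_mono)
qed

lemma f_n_tendsto_mean: "tendsto_in_prob M (\<lambda>n \<omega>. f_n n \<omega> a0) (\<integral>z. h z a0 \<partial>F)"
  unfolding f_n_def by (rule tendsto_in_prob_avg_vec[OF h_integrable[OF U(2)]])

text \<open>Near \<open>a0\<close> the maps \<open>f_n\<close> share a Lipschitz constant with high
  probability. A zero \<open>ah\<close> close to \<open>a0\<close> therefore makes
  \<open>f_n n \<omega> a0\<close> small, which is incompatible with a nonzero limit. The
  contradiction is that an impossible event would have probability tending to one.\<close>

lemma mean_zero:
  assumes "tendsto_in_prob M ah a0" "with_prob_to_one M (\<lambda>n \<omega>. f_n n \<omega> (ah n \<omega>) = 0)"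
  shows "(\<integral>z. h z a0 \<partial>F) = 0"
proof (rule ccontr)
  assume ne: "(\<integral>z. h z a0 \<partial>F) \<noteq> 0"
  define \<mu> where "\<mu> = (\<integral>z. h z a0 \<partial>F)"
  obtain \<delta> where \<delta>: "\<delta> > 0" "cball a0 \<delta> \<subseteq> U" "with_prob_to_one M (\<lambda>n \<omega>. deriv_close (f_n n \<omega>) B 1 (cball a0 \<delta>))"
    by (rule deriv_close_B[of 1]) auto
  obtain C where C: "C > 0" "\<And>x. norm (B *v x) \<le> norm x * C"
    using bounded_linear.pos_bounded[OF matrix_vector_mul_bounded_linear, of B] by blast
  \<comment> \<open>\<open>C + 1\<close> bounds the Lipschitz constant: \<open>C\<close> from
    \<open>B\<close>, 1 from the linearization error. Thus the value at \<open>a0\<close> stays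
    below \<open>norm \<mu> / 2\<close>.\<close>
  define e where "e = min \<delta> (norm \<mu> / (2 * (C + 1)))"
  have mu: "norm \<mu> > 0" using ne by (simp add: \<mu>_def)
  have e: "e > 0" using mu C(1) \<delta>(1) by (simp add: e_def)
  have "with_prob_to_one M (\<lambda>n \<omega>. False)"
  proof (rule with_prob_to_one_mono[OF with_prob_to_one_conj[OF with_prob_to_one_conj[OF assms(2) \<delta>(3)]
        with_prob_to_one_conj[OF tendsto_in_probD[OF assms(1) e]
          tendsto_in_probD[OF f_n_tendsto_mean[folded \<mu>_def], of "norm \<mu> / 2"]]]])
    fix n \<omega>
    let ?a = "ah n \<omega>"
    assume *: "(f_n n \<omega> ?a = 0 \<and> deriv_close (f_n n \<omega>) B 1 (cball a0 \<delta>)) \<and>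
      dist ?a a0 < e \<and> dist (f_n n \<omega> a0) \<mu> < norm \<mu> / 2"
    then have "norm (f_n n \<omega> ?a - f_n n \<omega> a0 - B *v (?a - a0)) \<le> 1 * norm (?a - a0)"
      using \<delta>(1) by (intro deriv_close_linearization[OF convex_cball]) (auto simp: e_def dist_commute)
    moreover have "f_n n \<omega> ?a - f_n n \<omega> a0 - B *v (?a - a0) = - (f_n n \<omega> a0 + B *v (?a - a0))"
      using * by simp
    ultimately have "norm (f_n n \<omega> a0 + B *v (?a - a0)) \<le> norm (?a - a0)"
      by (simp only: norm_minus_cancel mult_1)
    then have "norm (f_n n \<omega> a0) \<le> norm (?a - a0) + norm (B *v (?a - a0))"
      using norm_triangle_ineq4[of "f_n n \<omega> a0 + B *v (?a - a0)" "B *v (?a - a0)"]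
      unfolding add_diff_cancel_right' by linarith
    also have "\<dots> \<le> norm (?a - a0) * (C + 1)" using C(2)[of "?a - a0"] by (simp add: algebra_simps)
    also have "\<dots> < norm \<mu> / (2 * (C + 1)) * (C + 1)"
      using * C(1) by (intro mult_strict_right_mono) (auto simp: e_def dist_norm)
    also have "\<dots> = norm \<mu> / 2" using C(1) by (simp add: field_simps)
    finally have "norm (f_n n \<omega> a0) < norm \<mu> / 2" .
    moreover have "norm \<mu> \<le> norm (f_n n \<omega> a0) + dist (f_n n \<omega> a0) \<mu>"
      using norm_triangle_sub[of \<mu> "f_n n \<omega> a0"] by (simp add: dist_norm norm_minus_commute)
    ultimately show False using * by linarith
  qed (use mu in auto)
  then obtain A where "\<And>n. A n = {}" "(\<lambda>n. prob (A n)) \<longlonglongrightarrow> 1"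
    unfolding with_prob_to_one_def by auto
  then show False by (simp add: LIMSEQ_const_iff)
qed

text \<open>The deviation of \<open>ah - a0\<close> from one Newton step at \<open>a0\<close> is an
  arbitrarily small multiple of \<open>f_n n \<omega> a0\<close>. After scaling by
  \<open>sqrt n\<close> the latter has bounded second moments, so the deviation is
  negligible.\<close>

lemma linearization:
  assumes ah: "tendsto_in_prob M ah a0" "with_prob_to_one M (\<lambda>n \<omega>. f_n n \<omega> (ah n \<omega>) = 0)"
    and zero: "(\<integral>z. h z a0 \<partial>F) = 0"
  shows "tendsto_in_prob M (\<lambda>n \<omega>. sqrt (real n) *\<^sub>R (ah n \<omega> - a0 + matrix_inv B *v f_n n \<omega> a0)) 0"
proof (rule tendsto_in_prob_small_multiple)
  have eq: "sqrt (real n) *\<^sub>R f_n n \<omega> a0 = sqrt (real n) *\<^sub>R avg (\<lambda>z. h z a0) n \<omega>" for n \<omega>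
    by (simp add: f_n_def)
  note mom = root_n_avg_second_moment[OF h_measurable[OF U(2)] h_square_integrable zero]
  show "(\<lambda>\<omega>. sqrt (real n) *\<^sub>R f_n n \<omega> a0) \<in> borel_measurable M" for n
    using f_n_measurable[OF U(2), of n] by measurable
  show "integrable M (\<lambda>\<omega>. (norm (sqrt (real n) *\<^sub>R f_n n \<omega> a0))\<^sup>2)" for n
    unfolding eq by (rule mom(1))
  show "expectation (\<lambda>\<omega>. (norm (sqrt (real n) *\<^sub>R f_n n \<omega> a0))\<^sup>2) \<le> (\<integral>z. (norm (h z a0))\<^sup>2 \<partial>F)" for n
    unfolding eq by (rule mom(2))
  fix \<epsilon> :: real assume \<epsilon>: "\<epsilon> > 0"
  obtain C where C: "C > 0" "\<And>x. norm x \<le> C * norm (B *v x)"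
    by (rule invertible_lower_bound[OF B_invertible]) blast
  \<comment> \<open>The first term permits absorption in \<open>deriv_close_injective\<close>. In
    the second, one factor \<open>C\<close> comes from inverting \<open>B\<close> and
    \<open>2 * C\<close> from bounding \<open>ah - a0\<close> by the value at
    \<open>a0\<close>.\<close>
  define e where "e = min (1 / (2 * C)) (\<epsilon> / (2 * C * C))"
  have e: "e > 0" "C * e \<le> 1/2" "2 * C * C * e \<le> \<epsilon>"
  proof -
    show "e > 0" using C \<epsilon> by (simp add: e_def)
    have "C * e \<le> C * (1 / (2 * C))" using C by (intro mult_left_mono) (auto simp: e_def)
    then show "C * e \<le> 1/2" using C by simp
    have "2 * C * C * e \<le> 2 * C * C * (\<epsilon> / (2 * C * C))" using C by (intro mult_left_mono) (auto simp: e_def)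
    then show "2 * C * C * e \<le> \<epsilon>" using C by simp
  qed
  obtain \<delta> where \<delta>: "\<delta> > 0" "cball a0 \<delta> \<subseteq> U" "with_prob_to_one M (\<lambda>n \<omega>. deriv_close (f_n n \<omega>) B e (cball a0 \<delta>))"
    by (rule deriv_close_B[OF e(1)])
  show "with_prob_to_one M (\<lambda>n \<omega>. norm (sqrt (real n) *\<^sub>R (ah n \<omega> - a0 + matrix_inv B *v f_n n \<omega> a0)) \<le>
      \<epsilon> * norm (sqrt (real n) *\<^sub>R f_n n \<omega> a0))"
  proof (rule with_prob_to_one_mono[OF with_prob_to_one_conj[OF with_prob_to_one_conj[OF ah(2) \<delta>(3)]
        tendsto_in_probD[OF ah(1) \<delta>(1)]]])
    fix n \<omega>
    let ?a = "ah n \<omega>" and ?f = "f_n n \<omega>"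
    assume *: "(?f ?a = 0 \<and> deriv_close ?f B e (cball a0 \<delta>)) \<and> dist ?a a0 < \<delta>"
    then have aS: "?a \<in> cball a0 \<delta>" "a0 \<in> cball a0 \<delta>" using \<delta>(1) by (auto simp: dist_commute)
    have dc: "deriv_close ?f B e (cball a0 \<delta>)" using * by blast
    have "?f ?a - ?f a0 - B *v (?a - a0) = - (?f a0 + B *v (?a - a0))" using * by simp
    with deriv_close_linearization[OF convex_cball dc aS(2,1)]
    have l1: "norm (?f a0 + B *v (?a - a0)) \<le> e * norm (?a - a0)"
      by (simp only: norm_minus_cancel)
    have l2: "norm (?a - a0) \<le> 2 * C * norm (?f a0)"
      using deriv_close_injective[OF convex_cball dc aS(2,1) C e(2)] * by simp
    have "B *v (?a - a0 + matrix_inv B *v ?f a0) = ?f a0 + B *v (?a - a0)"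
      by (simp add: matrix_vector_right_distrib matrix_inv_mult_vec[OF B_invertible])
    then have "norm (?a - a0 + matrix_inv B *v ?f a0) \<le> C * norm (?f a0 + B *v (?a - a0))"
      using C(2)[of "?a - a0 + matrix_inv B *v ?f a0"] by simp
    also have "\<dots> \<le> C * (e * (2 * C * norm (?f a0)))"
      using l1 l2 C(1) e(1) by (intro mult_left_mono order_trans[OF l1]) auto
    also have "\<dots> = (2 * C * C * e) * norm (?f a0)" by simp
    also have "\<dots> \<le> \<epsilon> * norm (?f a0)" by (intro mult_right_mono e) auto
    finally have "sqrt (real n) * norm (?a - a0 + matrix_inv B *v ?f a0) \<le> sqrt (real n) * (\<epsilon> * norm (?f a0))"
      by (intro mult_left_mono) auto
    then show "norm (sqrt (real n) *\<^sub>R (?a - a0 + matrix_inv B *v ?f a0)) \<le> \<epsilon> * norm (sqrt (real n) *\<^sub>R ?f a0)"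
      by (simp add: mult.left_commute)
  qed
qed

lemma jacobian_plug_in:
  assumes ah: "tendsto_in_prob M ah a0"
  shows "tendsto_in_prob M (\<lambda>n \<omega>. jacobian (f_n n \<omega>) (at (ah n \<omega>))) B"
proof (intro tendsto_in_prob_vec)
  fix i r
  have "tendsto_in_prob M (\<lambda>n \<omega>. avg (\<lambda>z. jacobian (h z) (at (ah n \<omega>)) $ i $ r) n \<omega>)
      (\<integral>z. jacobian (h z) (at a0) $ i $ r \<partial>F)"
    by (rule avg_tendsto_in_prob_plug_in[OF U jacobian_continuous jacobian_measurable m1_integrable m1_bound ah])
  then show "tendsto_in_prob M (\<lambda>n \<omega>. jacobian (f_n n \<omega>) (at (ah n \<omega>)) $ i $ r) (B $ i $ r)"
    unfolding B_component
  proof (rule tendsto_in_prob_cong)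
    show "with_prob_to_one M (\<lambda>n \<omega>. jacobian (f_n n \<omega>) (at (ah n \<omega>)) $ i $ r =
        avg (\<lambda>z. jacobian (h z) (at (ah n \<omega>)) $ i $ r) n \<omega>)"
      by (rule with_prob_to_one_mono[OF tendsto_in_prob_eventually_in[OF ah U]])
         (simp add: f_n_jacobian avg_def sum_component)
  qed
qed

lemma jacobian_plug_in_invertible:
  assumes "tendsto_in_prob M ah a0"
  shows "with_prob_to_one M (\<lambda>n \<omega>. invertible (jacobian (f_n n \<omega>) (at (ah n \<omega>))))"
proof -
  obtain C where C: "C > 0" "\<And>x. norm x \<le> C * norm (B *v x)"
    by (rule invertible_lower_bound[OF B_invertible]) blast
  have e: "1 / (2 * C) > 0" "C * (1 / (2 * C)) \<le> 1/2" using C by auto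
  obtain \<delta> where \<delta>: "\<delta> > 0" "cball a0 \<delta> \<subseteq> U"
    "with_prob_to_one M (\<lambda>n \<omega>. deriv_close (f_n n \<omega>) B (1 / (2 * C)) (cball a0 \<delta>))"
    by (rule deriv_close_B[OF e(1)])
  show ?thesis
  proof (rule with_prob_to_one_mono[OF with_prob_to_one_conj[OF \<delta>(3) tendsto_in_probD[OF assms \<delta>(1)]]])
    fix n \<omega>
    assume *: "deriv_close (f_n n \<omega>) B (1 / (2 * C)) (cball a0 \<delta>) \<and> dist (ah n \<omega>) a0 < \<delta>"
    then have "ah n \<omega> \<in> cball a0 \<delta>" by (simp add: dist_commute)
    with * show "invertible (jacobian (f_n n \<omega>) (at (ah n \<omega>)))"
      using deriv_close_invertible(2)[OF _ _ C e(2)] by blast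
  qed
qed

lemma outer_plug_in:
  assumes ah: "tendsto_in_prob M ah a0"
  shows "tendsto_in_prob M (\<lambda>n \<omega>. avg (\<lambda>z. outer (h z (ah n \<omega>)) (h z (ah n \<omega>))) n \<omega>) K"
proof (intro tendsto_in_prob_vec)
  fix i r
  have "bounded_linear (\<lambda>A::real^'m^'m. A $ i $ r)"
    by (rule bounded_linear_compose[OF bounded_linear_vec_nth bounded_linear_vec_nth])
  from integral_bounded_linear[OF this outer_integrable[OF h_measurable[OF U(2)] h_square_integrable]]
  have K: "K $ i $ r = (\<integral>z. h z a0 $ i * h z a0 $ r \<partial>F)" by (simp add: K_def outer_def)
  have hc: "continuous_on U (\<lambda>a. h z a $ j)" for z j
    by (intro continuous_on_component C1_onD(3)[OF h_C1])
  have "tendsto_in_prob M (\<lambda>n \<omega>. avg (\<lambda>z. h z (ah n \<omega>) $ i * h z (ah n \<omega>) $ r) n \<omega>)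
      (\<integral>z. h z a0 $ i * h z a0 $ r \<partial>F)"
  proof (rule avg_tendsto_in_prob_plug_in[OF U _ _ m0(2) _ ah])
    show "continuous_on U (\<lambda>a. h z a $ i * h z a $ r)" for z by (intro continuous_on_mult hc)
    show "(\<lambda>z. h z a $ i * h z a $ r) \<in> borel_measurable F" if "a \<in> U" for a
      by (intro borel_measurable_times h_component_measurable that)
    show "\<bar>h z a $ i * h z a $ r\<bar> \<le> (m0 z)\<^sup>2" if "a \<in> U" for z a
      unfolding abs_mult power2_eq_square
      using order_trans[OF component_le_norm_cart m0(3)[OF that]] by (intro mult_mono) (auto intro: order_trans[OF abs_ge_zero])
  qed
  then show "tendsto_in_prob M (\<lambda>n \<omega>. avg (\<lambda>z. outer (h z (ah n \<omega>)) (h z (ah n \<omega>))) n \<omega> $ i $ r) (K $ i $ r)"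
    by (simp add: K avg_def sum_component outer_def)
qed

text \<open>\<open>P\<close> extracts the parameters of interest. By linearization the projected
  estimator behaves like an average of the influence function
  \<open>- (P ** matrix_inv B) *v h z a0\<close>, whose covariance is \<open>V\<close>. Consistency
  of the plug-in version is continuity of the sandwich at \<open>(B, K)\<close>.\<close>

theorem asymptotically_normal_estimator:
  fixes P :: "real^'m^'p"
  assumes ah: "tendsto_in_prob M ah a0" "with_prob_to_one M (\<lambda>n \<omega>. f_n n \<omega> (ah n \<omega>) = 0)"
    and meas: "\<And>n. (\<lambda>\<omega>. sqrt (real n) *\<^sub>R (P *v (ah n \<omega> - a0))) \<in> borel_measurable M"
  defines "V \<equiv> (P ** matrix_inv B) ** K ** transpose (P ** matrix_inv B)"
  shows "asymptotically_normal M (\<lambda>n \<omega>. sqrt (real n) *\<^sub>R (P *v (ah n \<omega> - a0))) V"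
    and "tendsto_in_prob M (\<lambda>n \<omega>. (P ** matrix_inv (jacobian (f_n n \<omega>) (at (ah n \<omega>)))) **
        avg (\<lambda>z. outer (h z (ah n \<omega>)) (h z (ah n \<omega>))) n \<omega> **
        transpose (P ** matrix_inv (jacobian (f_n n \<omega>) (at (ah n \<omega>))))) V"
proof -
  have zero: "(\<integral>z. h z a0 \<partial>F) = 0" by (rule mean_zero[OF ah])
  have bl: "bounded_linear ((*v) A)" for A :: "real^'x^'y" by (rule matrix_vector_mul_bounded_linear)
  define g where "g z = - ((P ** matrix_inv B) *v h z a0)" for z
  have h_meas: "(\<lambda>z. h z a0) \<in> borel_measurable F" by (rule h_measurable[OF U(2)])
  have g_meas: "g \<in> borel_measurable F"
    unfolding g_def[abs_def]
    by (intro borel_measurable_uminus borel_measurable_continuous_on[OF linear_continuous_on[OF bl] h_meas])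
  obtain C where C: "C > 0" "\<And>x. norm ((P ** matrix_inv B) *v x) \<le> norm x * C"
    using bounded_linear.pos_bounded[OF bl, of "P ** matrix_inv B"] by blast
  have g_sq: "integrable F (\<lambda>z. (norm (g z))\<^sup>2)"
  proof (rule Bochner_Integration.integrable_bound)
    show "integrable F (\<lambda>z. (norm (h z a0))\<^sup>2 * C\<^sup>2)" using h_square_integrable by simp
    show "(\<lambda>z. (norm (g z))\<^sup>2) \<in> borel_measurable F" using g_meas by measurable
    show "AE z in F. norm ((norm (g z))\<^sup>2) \<le> norm ((norm (h z a0))\<^sup>2 * C\<^sup>2)"
      using C(2) by (auto simp: g_def power_mult_distrib[symmetric] intro!: power_mono)
  qed
  have g_zero: "(\<integral>z. g z \<partial>F) = 0"
    using integral_bounded_linear[OF bl h_integrable[OF U(2)], of "P ** matrix_inv B"] zero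
    by (simp add: g_def)
  have lin: "tendsto_in_prob M (\<lambda>n \<omega>. sqrt (real n) *\<^sub>R (P *v (ah n \<omega> - a0)) - sqrt (real n) *\<^sub>R avg g n \<omega>) 0"
  proof -
    have "isCont ((*v) P) 0" using bl linear_continuous_at by blast
    from tendsto_in_prob_isCont[OF linearization[OF ah zero] this]
    have "tendsto_in_prob M (\<lambda>n \<omega>. P *v (sqrt (real n) *\<^sub>R (ah n \<omega> - a0 + matrix_inv B *v f_n n \<omega> a0))) 0"
      by simp
    moreover have "avg g n \<omega> = - (P *v (matrix_inv B *v f_n n \<omega> a0))" for n \<omega>
    proof -
      have "(P ** matrix_inv B) *v (\<Sum>i<n. h (Z i \<omega>) a0) = (\<Sum>i<n. (P ** matrix_inv B) *v h (Z i \<omega>) a0)"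
        by (rule linear_sum[OF bounded_linear.linear[OF bl]])
      then show ?thesis
        by (simp add: f_n_def avg_def g_def matrix_vector_mult_scaleR matrix_vector_mul_assoc sum_negf)
    qed
    then have "P *v (sqrt (real n) *\<^sub>R (ah n \<omega> - a0 + matrix_inv B *v f_n n \<omega> a0)) =
        sqrt (real n) *\<^sub>R (P *v (ah n \<omega> - a0)) - sqrt (real n) *\<^sub>R avg g n \<omega>" for n \<omega>
      by (simp add: matrix_vector_mult_scaleR matrix_vector_right_distrib scaleR_add_right)
    ultimately show ?thesis by simp
  qed
  have "outer (g z) (g z) = (P ** matrix_inv B) ** outer (h z a0) (h z a0) ** transpose (P ** matrix_inv B)" for z
    unfolding outer_matrix_mult[symmetric] by (simp add: g_def outer_def)
  moreover have "(\<integral>z. (P ** matrix_inv B) ** outer (h z a0) (h z a0) ** transpose (P ** matrix_inv B) \<partial>F) = V"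
    using integral_bounded_linear[OF linear_sandwich[THEN linear_conv_bounded_linear[THEN iffD1]]
        outer_integrable[OF h_meas h_square_integrable]]
    by (simp add: V_def K_def)
  ultimately show "asymptotically_normal M (\<lambda>n \<omega>. sqrt (real n) *\<^sub>R (P *v (ah n \<omega> - a0))) V"
    using asymptotically_normalI[OF g_meas g_sq g_zero meas lin] by simp
  define G where "G p = (P ** matrix_inv (fst p)) ** snd p ** transpose (P ** matrix_inv (fst p))"
    for p :: "(real^'m^'m) \<times> (real^'m^'m)"
  have "isCont G (B, K)"
  proof -
    have fst: "continuous (at (B, K)) (\<lambda>p. matrix_inv (fst p))"
      by (rule continuous_at_compose[OF continuous_fst[OF continuous_ident], of _ matrix_inv, unfolded o_def])
         (simp add: isCont_matrix_inv[OF B_invertible])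
    have inv: "((\<lambda>p. matrix_inv (fst p) $ i $ j) \<longlongrightarrow> matrix_inv (fst (B, K)) $ i $ j) (at (B, K))" for i j
      using fst unfolding isCont_def by (intro tendsto_vec_nth)
    have snd: "((\<lambda>p. snd p $ i $ j) \<longlongrightarrow> snd (B, K) $ i $ j) (at (B, K))" for i j :: 'm
      by (intro tendsto_vec_nth tendsto_snd tendsto_ident_at)
    show ?thesis
      unfolding isCont_def G_def matrix_matrix_mult_def transpose_def vec_lambda_beta
      by (intro tendsto_vec_lambda tendsto_sum tendsto_mult tendsto_const inv snd)
  qed
  from tendsto_in_prob_isCont[OF tendsto_in_prob_Pair[OF jacobian_plug_in[OF ah(1)] outer_plug_in[OF ah(1)]] this]
  show "tendsto_in_prob M (\<lambda>n \<omega>. (P ** matrix_inv (jacobian (f_n n \<omega>) (at (ah n \<omega>)))) **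
        avg (\<lambda>z. outer (h z (ah n \<omega>)) (h z (ah n \<omega>))) n \<omega> **
        transpose (P ** matrix_inv (jacobian (f_n n \<omega>) (at (ah n \<omega>))))) V"
    by (simp add: G_def V_def)
qed

text \<open>On a large event the Newton root exists and is unique in a small ball. It is also the
  limit of the first points, in an enumeration of a countable dense set, where the map is nearly
  zero; this makes it measurable. Its distance from \<open>a0\<close> is at most a multiple of
  \<open>f_n n \<omega> a0\<close>, which tends to 0 in probability.\<close>

theorem measurable_consistent_root:
  assumes zero: "(\<integral>z. h z a0 \<partial>F) = 0" and V: "open V" "a0 \<in> V"
  obtains s where "\<And>n. s n \<in> borel_measurable M" "\<And>n \<omega>. s n \<omega> \<in> V"
    "with_prob_to_one M (\<lambda>n \<omega>. f_n n \<omega> (s n \<omega>) = 0)" "tendsto_in_prob M s a0"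
proof -
  obtain C where C: "C > 0" "\<And>x. norm x \<le> C * norm (B *v x)"
    by (rule invertible_lower_bound[OF B_invertible]) blast
  define e where "e = 1 / (2 * C)"
  have e: "e > 0" "C * e \<le> 1/2" using C by (auto simp: e_def)
  obtain \<delta>1 where \<delta>1: "\<delta>1 > 0" "cball a0 \<delta>1 \<subseteq> U" "with_prob_to_one M (\<lambda>n \<omega>. deriv_close (f_n n \<omega>) B e (cball a0 \<delta>1))"
    by (rule deriv_close_B[OF e(1)])
  obtain \<delta>2 where \<delta>2: "\<delta>2 > 0" "cball a0 \<delta>2 \<subseteq> V" using V open_contains_cball by blast
  define \<delta> where "\<delta> = min \<delta>1 \<delta>2"
  have \<delta>: "\<delta> > 0" "cball a0 \<delta> \<subseteq> U" "cball a0 \<delta> \<subseteq> V" "cball a0 \<delta> \<subseteq> cball a0 \<delta>1"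
    using \<delta>1 \<delta>2 by (auto simp: \<delta>_def)
  have "\<delta> / (2 * C) > 0" using \<delta> C by simp
  from with_prob_to_one_conj[OF \<delta>1(3) tendsto_in_probD[OF f_n_tendsto_mean this]]
  obtain A where A: "\<And>n. A n \<in> events" "(\<lambda>n. prob (A n)) \<longlonglongrightarrow> 1"
    "\<And>n \<omega>. \<omega> \<in> A n \<Longrightarrow> deriv_close (f_n n \<omega>) B e (cball a0 \<delta>1)"
    "\<And>n \<omega>. \<omega> \<in> A n \<Longrightarrow> norm (f_n n \<omega> a0) < \<delta> / (2 * C)"
    unfolding with_prob_to_one_def zero by (auto simp: subset_iff)
  have dc: "deriv_close (f_n n \<omega>) B e (cball a0 \<delta>)" if "\<omega> \<in> A n" for n \<omega>
    by (rule deriv_close_subset[OF A(3)[OF that] \<delta>(4)])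
  have ex_root: "\<exists>a. a \<in> cball a0 \<delta> \<and> f_n n \<omega> a = 0 \<and> norm (a - a0) \<le> 2 * C * norm (f_n n \<omega> a0)" if "\<omega> \<in> A n" for n \<omega>
  proof -
    have "2 * C * norm (f_n n \<omega> a0) \<le> \<delta>" using A(4)[OF that] C(1) by (simp add: field_simps)
    from deriv_close_root[OF dc[OF that] less_imp_le[OF e(1)] B_invertible C e(2) this] show ?thesis by blast
  qed
  define r where "r n \<omega> = (SOME a. a \<in> cball a0 \<delta> \<and> f_n n \<omega> a = 0 \<and> norm (a - a0) \<le> 2 * C * norm (f_n n \<omega> a0))" for n \<omega>
  have r: "r n \<omega> \<in> cball a0 \<delta>" "f_n n \<omega> (r n \<omega>) = 0" "norm (r n \<omega> - a0) \<le> 2 * C * norm (f_n n \<omega> a0)"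
    if "\<omega> \<in> A n" for n \<omega>
    using someI_ex[OF ex_root[OF that]] unfolding r_def by blast+
  \<comment> \<open>The default \<open>a0\<close> keeps the values in \<open>V\<close> for every
    \<omega>, not only on the good events.\<close>
  define s where "s n \<omega> = (if \<omega> \<in> A n then r n \<omega> else a0)" for n \<omega>
  obtain Q :: "(real^'m) set" where Q: "countable Q" "Q \<subseteq> cball a0 \<delta>" "cball a0 \<delta> \<subseteq> closure Q"
    by (rule separable)
  have "Q \<noteq> {}" using Q(3) \<delta>(1) by auto
  define q where "q = from_nat_into Q"
  have q: "q i \<in> Q" "q i \<in> cball a0 \<delta>" "q i \<in> U" for i
    using from_nat_into[OF \<open>Q \<noteq> {}\<close>, of i] Q(2) \<delta>(2) unfolding q_def by blast+
  \<comment> \<open>Off \<open>A n\<close> there may be no such index and the value is arbitrary,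
    yet it is still measurable. On \<open>A n\<close> the inverse Lipschitz bound turns a small
    value of \<open>f_n\<close> into closeness to the root.\<close>
  define N where "N n k \<omega> = (LEAST i. norm (f_n n \<omega> (q i)) < inverse (real (Suc k)))" for n k \<omega>
  have fq [measurable]: "(\<lambda>\<omega>. f_n n \<omega> (q i)) \<in> borel_measurable M" for n i by (rule f_n_measurable[OF q(3)])
  have N: "N n k \<in> M \<rightarrow>\<^sub>M count_space UNIV" for n k
    unfolding N_def by (rule measurable_Least) measurable
  have qN [measurable]: "(\<lambda>\<omega>. q (N n k \<omega>)) \<in> borel_measurable M" for n k
    by (rule measurable_compose[OF N]) simp
  have conv: "(\<lambda>k. q (N n k \<omega>)) \<longlonglongrightarrow> r n \<omega>" if \<omega>: "\<omega> \<in> A n" for n \<omega>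
  proof -
    have ex: "\<exists>i. norm (f_n n \<omega> (q i)) < inverse (real (Suc k))" for k
    proof -
      have "isCont (f_n n \<omega>) (r n \<omega>)"
        using differentiable_imp_continuous_within[OF f_n_differentiable] r(1)[OF \<omega>] \<delta>(2) by blast
      then obtain d where d: "d > 0" "\<And>x. dist x (r n \<omega>) < d \<Longrightarrow> dist (f_n n \<omega> x) 0 < inverse (real (Suc k))"
        unfolding continuous_at_eps_delta r(2)[OF \<omega>] by (metis inverse_positive_iff_positive of_nat_0_less_iff zero_less_Suc)
      have "r n \<omega> \<in> closure Q" using r(1)[OF \<omega>] Q(3) by blast
      then obtain y where y: "y \<in> Q" "dist y (r n \<omega>) < d" using d(1) unfolding closure_approachable by blast
      obtain i where "y = q i" using from_nat_into_surj[OF Q(1) y(1)] unfolding q_def by metis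
      then show ?thesis using d(2)[OF y(2)] by auto
    qed
    have bound: "norm (q (N n k \<omega>) - r n \<omega>) \<le> 2 * C * inverse (real (Suc k))" for k
    proof -
      have "norm (q (N n k \<omega>) - r n \<omega>) \<le> 2 * C * norm (f_n n \<omega> (q (N n k \<omega>)) - f_n n \<omega> (r n \<omega>))"
        by (rule deriv_close_injective[OF convex_cball dc[OF \<omega>] r(1)[OF \<omega>] q(2) C e(2)])
      also have "norm (f_n n \<omega> (q (N n k \<omega>)) - f_n n \<omega> (r n \<omega>)) \<le> inverse (real (Suc k))"
        using LeastI_ex[OF ex[of k]] r(2)[OF \<omega>] unfolding N_def by simp
      finally show ?thesis using C(1) by (simp add: mult_left_mono)
    qed
    have "(\<lambda>k. 2 * C * inverse (real (Suc k))) \<longlonglongrightarrow> 2 * C * 0"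
      by (intro tendsto_mult tendsto_const LIMSEQ_inverse_real_of_nat)
    then have "(\<lambda>k. 2 * C * inverse (real (Suc k))) \<longlonglongrightarrow> 0" by simp
    from Lim_null_comparison[OF always_eventually[OF allI[OF bound]] this]
    show ?thesis by (simp add: LIM_zero_iff)
  qed
  show thesis
  proof
    show "s n \<in> borel_measurable M" for n
    proof (rule borel_measurable_LIMSEQ_metric)
      show "(\<lambda>\<omega>. if \<omega> \<in> A n then q (N n k \<omega>) else a0) \<in> borel_measurable M" for k
        using A(1)[of n] by measurable
      fix \<omega>
      show "(\<lambda>k. if \<omega> \<in> A n then q (N n k \<omega>) else a0) \<longlonglongrightarrow> s n \<omega>"
        using conv by (cases "\<omega> \<in> A n") (auto simp: s_def)
    qed
    show "s n \<omega> \<in> V" for n \<omega> using r(1) \<delta>(3) V(2) by (auto simp: s_def)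
    show "with_prob_to_one M (\<lambda>n \<omega>. f_n n \<omega> (s n \<omega>) = 0)"
      by (rule with_prob_to_oneI[OF A(1) _ A(2)]) (simp add: s_def r(2))
    show "tendsto_in_prob M s a0"
      unfolding tendsto_in_prob_iff
    proof (intro allI impI)
      fix \<epsilon> :: real assume "\<epsilon> > 0"
      then have "\<epsilon> / (2 * C) > 0" using C by simp
      from tendsto_in_probD[OF f_n_tendsto_mean this] have "with_prob_to_one M (\<lambda>n \<omega>. norm (f_n n \<omega> a0) < \<epsilon> / (2 * C))"
        by (simp add: zero)
      from with_prob_to_one_conj[OF this with_prob_to_oneI[OF A(1) _ A(2), of "\<lambda>n \<omega>. \<omega> \<in> A n"]]
      show "with_prob_to_one M (\<lambda>n \<omega>. dist (s n \<omega>) a0 < \<epsilon>)"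
      proof (rule with_prob_to_one_mono)
        fix n \<omega> assume *: "norm (f_n n \<omega> a0) < \<epsilon> / (2 * C) \<and> \<omega> \<in> A n"
        then have "2 * C * norm (f_n n \<omega> a0) < \<epsilon>" using C(1) by (simp add: field_simps)
        then show "dist (s n \<omega>) a0 < \<epsilon>" using r(3)[of \<omega> n] * by (simp add: s_def dist_norm)
      qed
    qed
  qed
qed

end

section \<open>The stacked estimating function\<close>

text \<open>The stacked function with the data point removed. Being linear in the pair of functions,
  it can be applied to the sample means as well, where it gives the sample mean of eta.\<close>

definition eta_fun ::
    "(real^'p \<Rightarrow> real^'q \<Rightarrow> real^'p) \<Rightarrow> (real^'p \<Rightarrow> real) \<Rightarrow> ('p::finite, 'q::finite) stacked \<Rightarrow> ('p, 'q) stacked" where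
  "eta_fun \<Phi> \<Psi> a = stack (\<Phi> (theta_of a) (lambda_of a))
     (transpose (deriv_of a) *v gradient \<Psi> (theta_of a))
     (jacobian (\<lambda>s. \<Phi> s (lambda_of a)) (at (theta_of a)) ** deriv_of a +
      jacobian (\<lambda>m. \<Phi> (theta_of a) m) (at (lambda_of a)))"

lemma eta_eq_eta_fun: "eta \<phi> \<psi> z = eta_fun (\<phi> z) (\<psi> z)"
  by (simp add: fun_eq_iff eta_def eta_fun_def eta2_def eta3_def)

lemma stack_nth [simp]:
  "stack t l D $ Inl i = t $ i" "stack t l D $ Inr (Inl k) = l $ k" "stack t l D $ Inr (Inr (k, i)) = D $ i $ k"
  by (simp_all add: stack_def stack_columns_def)

lemma stacked_of_nth [simp]:
  "theta_of a $ i = a $ Inl i" "lambda_of a $ k = a $ Inr (Inl k)" "deriv_of a $ i $ k = a $ Inr (Inr (k, i))"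
  by (simp_all add: theta_of_def lambda_of_def deriv_of_def)

lemma stacked_index_cases:
  obtains (theta) i where "r = Inl i" | (lambda) k where "r = Inr (Inl k)" | (deriv) k i where "r = Inr (Inr (k, i))"
  by (metis sum.exhaust surj_pair)

lemma stacked_eqI:
  assumes "theta_of a = theta_of b" "lambda_of a = lambda_of b" "deriv_of a = deriv_of b"
  shows "a = b"
  unfolding vec_eq_iff
proof
  fix r
  show "a $ r = b $ r"
    by (cases r rule: stacked_index_cases) (use assms in \<open>metis stacked_of_nth\<close>)+
qed

lemma stack_of [simp]: "stack (theta_of a) (lambda_of a) (deriv_of a) = a"
  by (rule stacked_eqI) simp_all

lemma stacked_zero [simp]: "theta_of 0 = 0" "lambda_of 0 = 0" "deriv_of 0 = 0"
  by (simp_all add: vec_eq_iff)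

lemma stack_add: "stack t l D + stack t' l' D' = stack (t + t') (l + l') (D + D')"
  by (rule stacked_eqI) (simp_all add: vec_eq_iff)

lemma stacked_add [simp]: "theta_of (a + b) = theta_of a + theta_of b"
    "lambda_of (a + b) = lambda_of a + lambda_of b" "deriv_of (a + b) = deriv_of a + deriv_of b"
  by (simp_all add: vec_eq_iff)

lemma bounded_linear_theta_of: "bounded_linear theta_of"
  by (intro linear_conv_bounded_linear[THEN iffD1] linearI) (simp_all add: vec_eq_iff)

lemma bounded_linear_lambda_of: "bounded_linear lambda_of"
  by (intro linear_conv_bounded_linear[THEN iffD1] linearI) (simp_all add: vec_eq_iff)

lemma bounded_linear_theta_lambda: "bounded_linear (\<lambda>a. (theta_of a, lambda_of a))"
  by (intro bounded_linear_Pair bounded_linear_theta_of bounded_linear_lambda_of)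

lemma axis_Pair_Basis: "(axis m 1, 0) \<in> (Basis :: ((real^'p) \<times> (real^'q)) set)"
  "(0, axis k 1) \<in> (Basis :: ((real^'p) \<times> (real^'q)) set)"
  by (simp_all add: Basis_prod_def axis_in_Basis_iff)

lemma axis_sum: "(\<Sum>m\<in>UNIV. x $ m *\<^sub>R axis m (1::real)) = x"
  using basis_expansion[of x] by (simp add: scalar_mult_eq_scaleR)

text \<open>Deterministic; used for \<open>\<phi> z\<close>, \<open>\<psi> z\<close> at each data
  point as well as for their sample means.\<close>

locale smooth_model =
  fixes \<Phi> :: "real^'p \<Rightarrow> real^'q \<Rightarrow> real^'p" and \<Psi> :: "real^'p \<Rightarrow> real" and L :: "(real^'q) set"
  assumes L: "open L"
    and \<Phi>_C2: "\<And>i. C2_on (\<lambda>(t, l). \<Phi> t l $ i) (UNIV \<times> L)"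
    and \<Psi>_C2: "C2_on \<Psi> UNIV"
begin

definition g :: "'p \<Rightarrow> (real^'p) \<times> (real^'q) \<Rightarrow> real" where
  "g i = (\<lambda>(t, l). \<Phi> t l $ i)"

definition dg :: "'p \<Rightarrow> (real^'p) \<times> (real^'q) \<Rightarrow> (real^'p) \<times> (real^'q) \<Rightarrow> real" where
  "dg i u x = frechet_derivative (g i) (at x) u"

text \<open>Direction \<open>u\<close> is differentiated first, \<open>w\<close> second. Working
  with joint derivatives on the product makes all partial Jacobians and Hessians sections of one
  object.\<close>

definition ddg :: "'p \<Rightarrow> (real^'p) \<times> (real^'q) \<Rightarrow> (real^'p) \<times> (real^'q) \<Rightarrow> (real^'p) \<times> (real^'q) \<Rightarrow> real" where
  "ddg i u w x = frechet_derivative (dg i u) (at x) w"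

abbreviation A :: "real^'p \<Rightarrow> real^'q \<Rightarrow> real^'p^'p" where
  "A t l \<equiv> jacobian (\<lambda>s. \<Phi> s l) (at t)"

abbreviation C :: "real^'p \<Rightarrow> real^'q \<Rightarrow> real^'q^'p" where
  "C t l \<equiv> jacobian (\<lambda>m. \<Phi> t m) (at l)"

lemma open_UL: "open (UNIV \<times> L)"
  using L by (intro open_Times) auto

lemma g_C1: "C1_on (g i) (UNIV \<times> L)"
  using \<Phi>_C2 by (simp add: g_def C2_on_def)

lemma dg_C1: "u \<in> Basis \<Longrightarrow> C1_on (dg i u) (UNIV \<times> L)"
  using \<Phi>_C2[of i] unfolding dg_def[abs_def] g_def C2_on_def by blast

lemma g_derivative: "l \<in> L \<Longrightarrow> (g i has_derivative (\<lambda>u. dg i u (t, l))) (at (t, l))"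
  using C1_onD(1)[OF g_C1, of "(t, l)" i] by (simp add: dg_def)

lemma dg_derivative: "u \<in> Basis \<Longrightarrow> l \<in> L \<Longrightarrow> (dg i u has_derivative (\<lambda>w. ddg i u w (t, l))) (at (t, l))"
  using C1_onD(1)[OF dg_C1, of u "(t, l)" i] by (simp add: ddg_def)

lemma section_derivatives:
  fixes f :: "(real^'p) \<times> (real^'q) \<Rightarrow> real"
  assumes "(f has_derivative f') (at (t, l))"
  shows "((\<lambda>s. f (s, l)) has_derivative (\<lambda>u. f' (u, 0))) (at t)"
    "((\<lambda>m. f (t, m)) has_derivative (\<lambda>v. f' (0, v))) (at l)"
proof -
  have "((\<lambda>s. (s, l)) has_derivative (\<lambda>u. (u, 0))) (at t)"
    by (auto intro!: derivative_eq_intros)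
  from has_derivative_compose[OF this, of f f'] assms
  show "((\<lambda>s. f (s, l)) has_derivative (\<lambda>u. f' (u, 0))) (at t)" by simp
  have "((\<lambda>m. (t, m)) has_derivative (\<lambda>v. (0, v))) (at l)"
    by (auto intro!: derivative_eq_intros)
  from has_derivative_compose[OF this, of f f'] assms
  show "((\<lambda>m. f (t, m)) has_derivative (\<lambda>v. f' (0, v))) (at l)" by simp
qed

lemma
  assumes l: "l \<in> L"
  shows \<Phi>_derivative_t: "((\<lambda>s. \<Phi> s l) has_derivative (\<lambda>u. A t l *v u)) (at t)"
    and \<Phi>_derivative_l: "((\<lambda>m. \<Phi> t m) has_derivative (\<lambda>v. C t l *v v)) (at l)"
    and A_nth: "A t l $ i $ m = dg i (axis m 1, 0) (t, l)"
    and C_nth: "C t l $ i $ k = dg i (0, axis k 1) (t, l)"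
proof -
  note sec = section_derivatives[OF g_derivative[OF l, of _ t], unfolded g_def, simplified]
  have dt: "(\<lambda>s. \<Phi> s l) differentiable (at t)" and dl: "(\<lambda>m. \<Phi> t m) differentiable (at l)"
    by (rule differentiable_vecI, use sec differentiable_def in blast)+
  show "((\<lambda>s. \<Phi> s l) has_derivative (\<lambda>u. A t l *v u)) (at t)" using dt by (simp add: jacobian_works)
  show "((\<lambda>m. \<Phi> t m) has_derivative (\<lambda>v. C t l *v v)) (at l)" using dl by (simp add: jacobian_works)
  show "A t l $ i $ m = dg i (axis m 1, 0) (t, l)"
    unfolding jacobian_component(1)[OF dt] frechet_derivative_at[OF sec(1), symmetric] by (simp add: dg_def g_def)
  show "C t l $ i $ k = dg i (0, axis k 1) (t, l)"
    unfolding jacobian_component(1)[OF dl] frechet_derivative_at[OF sec(2), symmetric] by (simp add: dg_def g_def)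
qed

lemma \<Phi>_C1:
  assumes "l \<in> L"
  shows "C1_on (\<lambda>t. \<Phi> t l) UNIV"
proof (rule C1_on_vecI, rule C1_onI)
  fix i t
  show "((\<lambda>t. \<Phi> t l $ i) has_derivative (\<lambda>u. dg i (u, 0) (t, l))) (at t)"
    using section_derivatives(1)[OF g_derivative[OF assms, of i t]] by (simp add: g_def)
next
  fix i v
  have "continuous_on UNIV (\<lambda>t::real^'p. (t, l))" by (intro continuous_intros)
  then show "continuous_on UNIV (\<lambda>t. dg i (v, 0) (t, l))"
    unfolding dg_def using continuous_on_compose2[OF C1_onD(2)[OF g_C1, where v="(v, 0)"]] assms by auto
qed

lemma linear_sum_axis:
  assumes "linear (f :: real^'n \<Rightarrow> real)"
  shows "f x = (\<Sum>m\<in>UNIV. x $ m * f (axis m 1))"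
proof -
  have "f x = f (\<Sum>m\<in>UNIV. x $ m *\<^sub>R axis m 1)" by (simp only: axis_sum)
  also have "\<dots> = (\<Sum>m\<in>UNIV. x $ m * f (axis m 1))"
    by (simp only: linear_sum[OF assms] linear_scale[OF assms] real_scaleR_def)
  finally show ?thesis .
qed

lemma linear_Pair_parts:
  assumes "linear (f :: (real^'p) \<times> (real^'q) \<Rightarrow> real)"
  shows "f (u, v) = f (u, 0) + f (0, v)"
    "f (u, 0) = (\<Sum>m\<in>UNIV. u $ m * f (axis m 1, 0))" "f (0, v) = (\<Sum>k\<in>UNIV. v $ k * f (0, axis k 1))"
proof -
  show "f (u, v) = f (u, 0) + f (0, v)" using linear_add[OF assms, of "(u, 0)" "(0, v)"] by simp
  have "linear (\<lambda>u. f (u, 0))" "linear (\<lambda>v. f (0, v))"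
    using linear_add[OF assms, symmetric] linear_scale[OF assms, symmetric] by (auto intro!: linearI simp: scaleR_Pair)
  from linear_sum_axis[OF this(1), of u] linear_sum_axis[OF this(2), of v]
  show "f (u, 0) = (\<Sum>m\<in>UNIV. u $ m * f (axis m 1, 0))" "f (0, v) = (\<Sum>k\<in>UNIV. v $ k * f (0, axis k 1))" .
qed

lemma dg_eq: "l \<in> L \<Longrightarrow> dg i (u, v) (t, l) = (A t l *v u + C t l *v v) $ i"
proof -
  assume l: "l \<in> L"
  have lin: "linear (\<lambda>u. dg i u (t, l))" by (rule has_derivative_linear[OF g_derivative[OF l]])
  have "dg i (u, v) (t, l) = (\<Sum>m\<in>UNIV. u $ m * dg i (axis m 1, 0) (t, l)) + (\<Sum>k\<in>UNIV. v $ k * dg i (0, axis k 1) (t, l))"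
    using linear_Pair_parts(1)[OF lin, of u v] linear_Pair_parts(2)[OF lin, of u] linear_Pair_parts(3)[OF lin, of v]
    by linarith
  then show ?thesis
    by (simp add: matrix_vector_mult_def A_nth[OF l] C_nth[OF l] mult.commute)
qed

lemma
  assumes l: "l \<in> L"
  shows gradient_\<Phi>_derivative: "(gradient (\<lambda>t. \<Phi> t l $ r) has_derivative (\<lambda>u. hessian (\<lambda>t. \<Phi> t l $ r) t *v u)) (at t)"
    and hessian_\<Phi>_nth: "hessian (\<lambda>t. \<Phi> t l $ r) t $ m $ b = ddg r (axis m 1, 0) (axis b 1, 0) (t, l)"
proof -
  have gr: "gradient (\<lambda>t. \<Phi> t l $ r) t $ m = dg r (axis m 1, 0) (t, l)" for t m
    unfolding gradient_def vec_lambda_beta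
    using frechet_derivative_at[OF section_derivatives(1)[OF g_derivative[OF l, of r t]], symmetric]
    by (simp add: g_def)
  have d: "((\<lambda>t. gradient (\<lambda>t. \<Phi> t l $ r) t $ m) has_derivative (\<lambda>u. ddg r (axis m 1, 0) (u, 0) (t, l))) (at t)" for m
    unfolding gr by (rule section_derivatives(1)[OF dg_derivative[OF axis_Pair_Basis(1) l]])
  have diff: "gradient (\<lambda>t. \<Phi> t l $ r) differentiable (at t)"
    by (rule differentiable_vecI) (use d differentiable_def in blast)
  then show "(gradient (\<lambda>t. \<Phi> t l $ r) has_derivative (\<lambda>u. hessian (\<lambda>t. \<Phi> t l $ r) t *v u)) (at t)"
    unfolding hessian_def by (simp add: jacobian_works)
  show "hessian (\<lambda>t. \<Phi> t l $ r) t $ m $ b = ddg r (axis m 1, 0) (axis b 1, 0) (t, l)"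
    using jacobian_component(1)[OF diff, of m b] unfolding hessian_def frechet_derivative_at[OF d, symmetric] .
qed

lemma gradient_\<Psi>_nth: "gradient \<Psi> t $ i = frechet_derivative \<Psi> (at t) (axis i 1)"
  by (simp add: gradient_def)

lemma gradient_\<Psi>_C1: "C1_on (\<lambda>t. gradient \<Psi> t $ i) UNIV"
  using \<Psi>_C2 unfolding gradient_\<Psi>_nth C2_on_def by (simp add: axis_in_Basis_iff)

lemma gradient_\<Psi>_derivative: "(gradient \<Psi> has_derivative (\<lambda>u. hessian \<Psi> t *v u)) (at t)"
proof -
  have "gradient \<Psi> differentiable (at t)"
    by (rule differentiable_vecI) (use gradient_\<Psi>_C1 in \<open>simp add: C1_on_def\<close>)
  then show ?thesis by (simp add: hessian_def jacobian_works)
qed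

lemma \<Psi>_derivative: "(\<Psi> has_derivative (\<lambda>u. gradient \<Psi> t \<bullet> u)) (at t)"
proof -
  have d: "(\<Psi> has_derivative frechet_derivative \<Psi> (at t)) (at t)"
    using \<Psi>_C2 by (auto simp: C2_on_def intro: C1_onD)
  have "frechet_derivative \<Psi> (at t) u = gradient \<Psi> t \<bullet> u" for u
    using linear_sum_axis[OF has_derivative_linear[OF d], of u]
    by (simp add: inner_vec_def gradient_def mult.commute)
  then have "frechet_derivative \<Psi> (at t) = (\<lambda>u. gradient \<Psi> t \<bullet> u)" by (rule ext)
  with d show ?thesis by (simp only:)
qed

definition dom :: "('p, 'q) stacked set" where "dom = {a. lambda_of a \<in> L}"

lemma open_dom: "open dom"
  unfolding dom_def using continuous_open_vimage[OF L, of lambda_of]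
  by (simp add: vimage_def linear_continuous_at[OF bounded_linear_lambda_of])

lemma eta_fun_nth:
  "eta_fun \<Phi> \<Psi> a $ Inl i = g i (theta_of a, lambda_of a)"
  "eta_fun \<Phi> \<Psi> a $ Inr (Inl k) = (\<Sum>m\<in>UNIV. a $ Inr (Inr (k, m)) * gradient \<Psi> (theta_of a) $ m)"
  "a \<in> dom \<Longrightarrow> eta_fun \<Phi> \<Psi> a $ Inr (Inr (k, i)) =
     (\<Sum>m\<in>UNIV. dg i (axis m 1, 0) (theta_of a, lambda_of a) * a $ Inr (Inr (k, m))) +
     dg i (0, axis k 1) (theta_of a, lambda_of a)"
  by (simp_all add: eta_fun_def g_def dom_def A_nth C_nth matrix_matrix_mult_def matrix_vector_mult_def
      transpose_def mult.commute)

lemma eta_fun_C1: "C1_on (eta_fun \<Phi> \<Psi>) dom"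
proof (rule C1_on_vecI)
  have img: "(\<lambda>a. (theta_of a, lambda_of a)) ` dom \<subseteq> UNIV \<times> L" by (auto simp: dom_def)
  have nth: "C1_on (\<lambda>a::('p,'q) stacked. a $ r) dom" for r
    by (rule C1_on_linear) (rule bounded_linear_vec_nth)
  fix r :: "'p + ('q + ('q \<times> 'p))"
  show "C1_on (\<lambda>a. eta_fun \<Phi> \<Psi> a $ r) dom"
  proof (cases r rule: stacked_index_cases)
    case (theta i)
    show ?thesis unfolding theta eta_fun_nth by (rule C1_on_compose_linear[OF g_C1 bounded_linear_theta_lambda img])
  next
    case (lambda k)
    have "C1_on (\<lambda>a. gradient \<Psi> (theta_of a) $ m) dom" for m
      by (rule C1_on_compose_linear[OF gradient_\<Psi>_C1 bounded_linear_theta_of]) simp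
    then show ?thesis unfolding lambda eta_fun_nth by (intro C1_on_sum C1_on_mult nth)
  next
    case (deriv k i)
    have dgc: "C1_on (\<lambda>a. dg i u (theta_of a, lambda_of a)) dom" if "u \<in> Basis" for u
      by (rule C1_on_compose_linear[OF dg_C1[OF that] bounded_linear_theta_lambda img])
    have "C1_on (\<lambda>a. (\<Sum>m\<in>UNIV. dg i (axis m 1, 0) (theta_of a, lambda_of a) * a $ Inr (Inr (k, m))) +
        dg i (0, axis k 1) (theta_of a, lambda_of a)) dom"
      by (intro C1_on_add C1_on_sum C1_on_mult nth dgc axis_Pair_Basis)
    then show ?thesis
      by (rule C1_on_cong[OF open_dom, rotated]) (simp add: deriv eta_fun_nth(3))
  qed
qed

lemma eta_fun_differentiable: "a \<in> dom \<Longrightarrow> eta_fun \<Phi> \<Psi> differentiable (at a)"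
  using eta_fun_C1 by (simp add: C1_on_def)

section \<open>The Jacobian of the stacked function, block by block\<close>

context
  fixes a :: "('p, 'q) stacked"
  assumes a: "a \<in> dom"
begin

lemma lambda_a: "lambda_of a \<in> L" using a by (simp add: dom_def)

lemma eta_fun_jacobian_nth:
  assumes "((\<lambda>a. eta_fun \<Phi> \<Psi> a $ r) has_derivative d) (at a)"
  shows "(jacobian (eta_fun \<Phi> \<Psi>) (at a) *v x) $ r = d x"
  using has_derivative_unique[OF jacobian_component(3)[OF eta_fun_differentiable[OF a]] assms]
  by (rule fun_cong)

lemma theta_lambda_derivative:
  "((\<lambda>a. (theta_of a, lambda_of a)) has_derivative (\<lambda>x. (theta_of x, lambda_of x))) (at a)"
  by (rule bounded_linear_imp_has_derivative[OF bounded_linear_theta_lambda])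

lemma nth_derivative: "((\<lambda>a. a $ r) has_derivative (\<lambda>x. x $ r)) (at (a::('p,'q) stacked))"
  by (rule bounded_linear_imp_has_derivative[OF bounded_linear_vec_nth])

text \<open>The derivative block of \<open>x\<close> is absent, since the first component of eta
  does not involve D. Block elimination starts from this triangularity.\<close>

lemma eta_fun_jacobian_theta:
  "theta_of (jacobian (eta_fun \<Phi> \<Psi>) (at a) *v x) =
    A (theta_of a) (lambda_of a) *v theta_of x + C (theta_of a) (lambda_of a) *v lambda_of x"
proof -
  have "((\<lambda>a. eta_fun \<Phi> \<Psi> a $ Inl i) has_derivative (\<lambda>x. dg i (theta_of x, lambda_of x) (theta_of a, lambda_of a))) (at a)" for i
    unfolding eta_fun_nth by (rule has_derivative_compose[OF theta_lambda_derivative g_derivative[OF lambda_a]])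
  from eta_fun_jacobian_nth[OF this, of x] show ?thesis
    unfolding vec_eq_iff by (simp only: stacked_of_nth(1) dg_eq[OF lambda_a]) simp
qed

lemma eta_fun_jacobian_lambda:
  "lambda_of (jacobian (eta_fun \<Phi> \<Psi>) (at a) *v x) =
    transpose (deriv_of x) *v gradient \<Psi> (theta_of a) +
    transpose (deriv_of a) *v (hessian \<Psi> (theta_of a) *v theta_of x)"
proof -
  have gr: "((\<lambda>a. gradient \<Psi> (theta_of a) $ m) has_derivative (\<lambda>x. (hessian \<Psi> (theta_of a) *v theta_of x) $ m)) (at a)" for m
    by (rule has_derivative_vec_nth[OF has_derivative_compose[OF
          bounded_linear_imp_has_derivative[OF bounded_linear_theta_of] gradient_\<Psi>_derivative]])
  have "((\<lambda>a. eta_fun \<Phi> \<Psi> a $ Inr (Inl k)) has_derivative (\<lambda>x. \<Sum>m\<in>UNIV.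
      a $ Inr (Inr (k, m)) * (hessian \<Psi> (theta_of a) *v theta_of x) $ m + x $ Inr (Inr (k, m)) * gradient \<Psi> (theta_of a) $ m)) (at a)" for k
    unfolding eta_fun_nth by (intro has_derivative_sum has_derivative_mult nth_derivative gr)
  from eta_fun_jacobian_nth[OF this, of x]
  have Ex: "(jacobian (eta_fun \<Phi> \<Psi>) (at a) *v x) $ Inr (Inl k) = (\<Sum>m\<in>UNIV. a $ Inr (Inr (k, m)) * (hessian \<Psi> (theta_of a) *v theta_of x) $ m +
      x $ Inr (Inr (k, m)) * gradient \<Psi> (theta_of a) $ m)" for k .
  have tr: "(transpose D *v u) $ k = (\<Sum>m\<in>UNIV. D $ m $ k * u $ m)" for D :: "real^'q^'p" and u k
    by (simp add: matrix_vector_mult_def transpose_def)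
  show ?thesis
    unfolding vec_eq_iff vector_add_component tr stacked_of_nth Ex by (simp add: sum.distrib add.commute)
qed

text \<open>The \<theta>-derivative of the j-th column of the third component of eta. For the sample
  means it is the matrix \<open>Wj_hat j\<close>.\<close>

definition W :: "'q \<Rightarrow> real^'p^'p" where
  "W j = (\<chi> r. column j (deriv_of a) v* hessian (\<lambda>t. \<Phi> t (lambda_of a) $ r) (theta_of a)) +
     partial j (\<lambda>s. jacobian (\<lambda>t. \<Phi> t s) (at (theta_of a))) (lambda_of a)"

lemma jacobian_A_derivative:
  "((\<lambda>s. A (theta_of a) s $ i $ b) has_derivative (\<lambda>v. ddg i (axis b 1, 0) (0, v) (theta_of a, lambda_of a))) (at (lambda_of a))"
  using has_derivative_transform_within_open[OF
      section_derivatives(2)[OF dg_derivative[OF axis_Pair_Basis(1)[of b] lambda_a, of i "theta_of a"]] L lambda_a, of "\<lambda>s. A (theta_of a) s $ i $ b"]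
  by (simp add: A_nth)

lemma jacobian_A_differentiable: "(\<lambda>s. A (theta_of a) s) differentiable (at (lambda_of a))"
  by (intro differentiable_vecI) (use jacobian_A_derivative differentiable_def in blast)

lemma partial_A_nth: "partial j (\<lambda>s. A (theta_of a) s) (lambda_of a) $ i $ b =
    ddg i (axis b 1, 0) (0, axis j 1) (theta_of a, lambda_of a)"
proof -
  have d: "((\<lambda>s. A (theta_of a) s) has_derivative frechet_derivative (\<lambda>s. A (theta_of a) s) (at (lambda_of a))) (at (lambda_of a))"
    using jacobian_A_differentiable by (simp add: frechet_derivative_works)
  have "((\<lambda>s. A (theta_of a) s $ i $ b) has_derivative (\<lambda>v. frechet_derivative (\<lambda>s. A (theta_of a) s) (at (lambda_of a)) v $ i $ b)) (at (lambda_of a))"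
    by (intro has_derivative_vec_nth d)
  from has_derivative_unique[OF this jacobian_A_derivative] show ?thesis
    by (simp add: partial_def fun_eq_iff)
qed

text \<open>Directions that move \<lambda> are excluded, so second \<lambda>-derivatives of
  \<open>\<Phi>\<close> never appear; their effect is captured by differentiating along the solution
  curve instead.\<close>

lemma eta_fun_jacobian_deriv:
  assumes "lambda_of x = 0"
  shows "column j (deriv_of (jacobian (eta_fun \<Phi> \<Psi>) (at a) *v x)) =
    W j *v theta_of x + A (theta_of a) (lambda_of a) *v column j (deriv_of x)"
proof -
  define E where "E = jacobian (eta_fun \<Phi> \<Psi>) (at a) *v x"
  let ?p = "(theta_of a, lambda_of a)"
  have dgd: "((\<lambda>a. dg i u (theta_of a, lambda_of a)) has_derivative (\<lambda>x. ddg i u (theta_of x, lambda_of x) ?p)) (at a)"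
    if "u \<in> Basis" for i u
    by (rule has_derivative_compose[OF theta_lambda_derivative dg_derivative[OF that lambda_a]])
  have "((\<lambda>a. (\<Sum>m\<in>UNIV. dg i (axis m 1, 0) (theta_of a, lambda_of a) * a $ Inr (Inr (j, m))) +
      dg i (0, axis j 1) (theta_of a, lambda_of a)) has_derivative
    (\<lambda>x. (\<Sum>m\<in>UNIV. dg i (axis m 1, 0) ?p * x $ Inr (Inr (j, m)) + ddg i (axis m 1, 0) (theta_of x, lambda_of x) ?p * a $ Inr (Inr (j, m))) +
      ddg i (0, axis j 1) (theta_of x, lambda_of x) ?p)) (at a)" for i
    by (intro has_derivative_add has_derivative_sum has_derivative_mult nth_derivative dgd axis_Pair_Basis)
  from has_derivative_transform_within_open[OF this open_dom a] eta_fun_nth(3)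
  have "((\<lambda>a. eta_fun \<Phi> \<Psi> a $ Inr (Inr (j, i))) has_derivative
    (\<lambda>x. (\<Sum>m\<in>UNIV. dg i (axis m 1, 0) ?p * x $ Inr (Inr (j, m)) + ddg i (axis m 1, 0) (theta_of x, lambda_of x) ?p * a $ Inr (Inr (j, m))) +
      ddg i (0, axis j 1) (theta_of x, lambda_of x) ?p)) (at a)" for i
    by (simp add: eta_fun_nth(3))
  from eta_fun_jacobian_nth[OF this, of x, folded E_def] assms
  have Ex: "E $ Inr (Inr (j, i)) = (\<Sum>m\<in>UNIV. dg i (axis m 1, 0) ?p * x $ Inr (Inr (j, m)) +
      ddg i (axis m 1, 0) (theta_of x, 0) ?p * a $ Inr (Inr (j, m))) + ddg i (0, axis j 1) (theta_of x, 0) ?p" for i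
    by simp
  have lin: "linear (\<lambda>w. ddg i u w ?p)" if "u \<in> Basis" for i u
    by (rule has_derivative_linear[OF dg_derivative[OF that lambda_a]])
  have e1: "ddg i (axis m 1, 0) (theta_of x, 0) ?p =
      (\<Sum>b\<in>UNIV. theta_of x $ b * hessian (\<lambda>t. \<Phi> t (lambda_of a) $ i) (theta_of a) $ m $ b)" for i m
    unfolding hessian_\<Phi>_nth[OF lambda_a] by (rule linear_Pair_parts(2)[OF lin[OF axis_Pair_Basis(1)]])
  \<comment> \<open>The derivative of eta yields the \<theta>-derivative of the \<lambda>-Jacobian,
    whereas \<open>W\<close> is written with the \<lambda>-derivative of the
    \<theta>-Jacobian.\<close>
  have sym: "ddg i (0, axis j 1) (axis b 1, 0) ?p = ddg i (axis b 1, 0) (0, axis j 1) ?p" for i b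
    unfolding ddg_def dg_def[abs_def] g_def
    by (rule C2_on_symmetric[OF \<Phi>_C2 open_UL _ axis_Pair_Basis(2) axis_Pair_Basis(1)]) (simp add: lambda_a)
  have e2: "ddg i (0, axis j 1) (theta_of x, 0) ?p =
      (\<Sum>b\<in>UNIV. theta_of x $ b * partial j (\<lambda>s. A (theta_of a) s) (lambda_of a) $ i $ b)" for i
    unfolding partial_A_nth sym[symmetric] by (rule linear_Pair_parts(2)[OF lin[OF axis_Pair_Basis(2)]])
  show ?thesis
    unfolding vec_eq_iff E_def[symmetric]
  proof
    fix i
    have "(\<Sum>m\<in>UNIV. (\<Sum>b\<in>UNIV. theta_of x $ b * hessian (\<lambda>t. \<Phi> t (lambda_of a) $ i) (theta_of a) $ m $ b) * a $ Inr (Inr (j, m))) =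
        (\<Sum>b\<in>UNIV. (column j (deriv_of a) v* hessian (\<lambda>t. \<Phi> t (lambda_of a) $ i) (theta_of a)) $ b * theta_of x $ b)"
      unfolding vector_matrix_mult_def vec_lambda_beta sum_distrib_right
      by (subst sum.swap) (simp add: column_def mult_ac)
    then show "column j (deriv_of E) $ i = (W j *v theta_of x + A (theta_of a) (lambda_of a) *v column j (deriv_of x)) $ i"
      by (simp add: column_def Ex e1 e2 sum.distrib W_def matrix_vector_mult_def A_nth[OF lambda_a]
          distrib_right mult.commute[of "partial _ _ _ $ _ $ _"])
  qed
qed

end

end

lemma eta_measurable:
  assumes smooth: "\<And>y. smooth_model (\<phi> y) (\<psi> y) L"
    and meas_\<phi>: "\<And>t l. l \<in> L \<Longrightarrow> (\<lambda>z. \<phi> z t l) \<in> borel_measurable F"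
    and meas_\<psi>: "\<And>t. (\<lambda>z. \<psi> z t) \<in> borel_measurable F"
    and a: "lambda_of a \<in> L"
  shows "(\<lambda>z. eta \<phi> \<psi> z a) \<in> borel_measurable F"
proof (rule vec_measurableI)
  fix r
  have adom: "a \<in> smooth_model.dom L" using a by (simp add: smooth_model.dom_def[OF smooth])
  have L: "open L" using smooth by (simp add: smooth_model_def)
  have gm: "(\<lambda>z. gradient (\<psi> z) t $ m) \<in> borel_measurable F" for t m
  proof -
    have "(\<lambda>z. gradient (\<psi> z) t \<bullet> axis m 1) \<in> borel_measurable F"
      by (rule frechet_derivative_measurable[where f'="\<lambda>z u. gradient (\<psi> z) t \<bullet> u", OF open_UNIV UNIV_I smooth_model.\<Psi>_derivative[OF smooth] meas_\<psi>])
    then show ?thesis by (simp add: inner_axis)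
  qed
  have dm: "(\<lambda>z. smooth_model.dg (\<phi> z) i u (theta_of a, lambda_of a)) \<in> borel_measurable F" for i u
  proof (rule frechet_derivative_measurable[where V="UNIV \<times> L" and x="(theta_of a, lambda_of a)" and f="\<lambda>z. smooth_model.g (\<phi> z) i"
        and f'="\<lambda>z u. smooth_model.dg (\<phi> z) i u (theta_of a, lambda_of a)" and v=u])
    show "open (UNIV \<times> L)" using L by (intro open_Times) auto
    show "(theta_of a, lambda_of a) \<in> UNIV \<times> L" using a by simp
    show "(smooth_model.g (\<phi> z) i has_derivative (\<lambda>u. smooth_model.dg (\<phi> z) i u (theta_of a, lambda_of a)))
      (at (theta_of a, lambda_of a))" for z
      by (rule smooth_model.g_derivative[OF smooth a])
    show "(\<lambda>z. smooth_model.g (\<phi> z) i y) \<in> borel_measurable F" if "y \<in> UNIV \<times> L" for y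
      using that vec_nth_measurable[OF meas_\<phi>[of "snd y" "fst y"], of i]
      by (simp add: smooth_model.g_def[OF smooth] case_prod_unfold mem_Times_iff)
  qed
  show "(\<lambda>z. eta \<phi> \<psi> z a $ r) \<in> borel_measurable F"
  proof (cases r rule: stacked_index_cases)
    case (theta i)
    then show ?thesis using vec_nth_measurable[OF meas_\<phi>[OF a]] by (simp add: eta_def)
  next
    case (lambda k)
    show ?thesis unfolding lambda eta_eq_eta_fun smooth_model.eta_fun_nth(2)[OF smooth]
      by (intro borel_measurable_sum borel_measurable_times borel_measurable_const gm)
  next
    case (deriv k i)
    show ?thesis unfolding deriv eta_eq_eta_fun smooth_model.eta_fun_nth(3)[OF smooth adom]
      by (intro borel_measurable_sum borel_measurable_times borel_measurable_add borel_measurable_const dm)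
  qed
qed

text \<open>\<open>B2\<close> is \<open>B\<close> with its \<lambda>-rows replaced by the identity
  on \<lambda>. By \<open>b1\<close> and \<open>b3\<close> the \<theta>-rows of \<open>B\<close> are
  \<open>T (\<theta> - D0 \<lambda>)\<close>, and as \<open>B\<close> is onto, so is
  \<open>T\<close>, which is therefore injective. An element of the kernel of \<open>B2\<close> then
  loses its \<lambda>, \<theta> and D blocks one after the other, the last by
  \<open>b2\<close>.\<close>

lemma reduced_jacobian_invertible:
  fixes B :: "real^('p::finite + ('q::finite + ('q \<times> 'p)))^('p + ('q + ('q \<times> 'p)))" and D0 :: "real^'q^'p"
  assumes B: "invertible B"
    and b1: "\<And>X. theta_of (B *v stack 0 0 X) = 0"
    and b2: "\<And>X j. column j (deriv_of (B *v stack 0 0 X)) = theta_of (B *v stack (column j X) 0 0)"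
    and b3: "\<And>v. theta_of (B *v stack (D0 *v v) v 0) = 0"
  obtains B2 where "invertible B2"
    "\<And>x. B2 *v x = stack (theta_of (B *v x)) (lambda_of x) (deriv_of (B *v x))"
proof -
  define T where "T u = theta_of (B *v stack u 0 0)" for u :: "real^'p"
  have lin_stack: "stack (u + u') 0 0 = stack u 0 0 + (stack u' 0 0 :: ('p, 'q) stacked)"
    "stack (c *\<^sub>R u) 0 0 = c *\<^sub>R (stack u 0 0 :: ('p, 'q) stacked)" for u u' :: "real^'p" and c
    by (intro stacked_eqI; simp add: vec_eq_iff)+
  have T_lin: "linear T"
    by (rule linearI) (simp_all add: T_def lin_stack matrix_vector_right_distrib matrix_vector_mult_scaleR vec_eq_iff)
  have theta_B: "theta_of (B *v x) = T (theta_of x - D0 *v lambda_of x)" for x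
  proof -
    have "x = stack (theta_of x - D0 *v lambda_of x) 0 0 + stack (D0 *v lambda_of x) (lambda_of x) 0 + stack 0 0 (deriv_of x)"
      by (rule stacked_eqI) (simp_all add: stack_add)
    then have "B *v x = B *v stack (theta_of x - D0 *v lambda_of x) 0 0 + B *v stack (D0 *v lambda_of x) (lambda_of x) 0 +
        B *v stack 0 0 (deriv_of x)"
      by (metis matrix_vector_right_distrib)
    then show ?thesis by (simp add: b1 b3 T_def)
  qed
  have "surj T"
    unfolding surj_def
  proof
    fix y :: "real^'p"
    have "theta_of (B *v (matrix_inv B *v stack y 0 0)) = y" by (simp add: matrix_inv_mult_vec[OF B])
    then show "\<exists>u. y = T u" unfolding theta_B by metis
  qed
  then have T_inj: "inj T" using linear_surjective_imp_injective[OF T_lin] by blast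
  have T0: "u = 0" if "T u = 0" for u
    using that linear_0[OF T_lin] injD[OF T_inj, of u 0] by simp
  define f where "f x = stack (theta_of (B *v x)) (lambda_of x) (deriv_of (B *v x))" for x
  have "linear f"
    by (rule linearI; rule stacked_eqI; simp add: f_def vec_eq_iff matrix_vector_right_distrib matrix_vector_mult_scaleR)
  then have f: "matrix f *v x = f x" for x using fun_cong[OF matrix_vector_mul(2)] by blast
  have "invertible (matrix f)"
  proof (rule invertibleI_injective)
    fix x assume "matrix f *v x = 0"
    then have "f x = 0" by (simp only: f)
    then have z: "theta_of (f x) = 0" "lambda_of (f x) = 0" "deriv_of (f x) = 0" by simp_all
    then have l: "lambda_of x = 0" by (simp add: f_def)
    have "T (theta_of x) = 0" using z(1) theta_B[of x] by (simp add: f_def l)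
    then have t: "theta_of x = 0" by (rule T0)
    have x: "x = stack 0 0 (deriv_of x)" by (rule stacked_eqI) (simp_all add: t l)
    have "T (column j (deriv_of x)) = 0" for j
    proof -
      have "T (column j (deriv_of x)) = column j (deriv_of (B *v x))"
        unfolding T_def b2[symmetric] x[symmetric] ..
      also have "\<dots> = 0" using z(3) by (simp add: f_def column_def vec_eq_iff)
      finally show ?thesis .
    qed
    then have "column j (deriv_of x) = 0" for j by (rule T0)
    then have "deriv_of x = 0" by (simp add: column_def vec_eq_iff)
    then show "x = 0" using t l by (intro stacked_eqI) simp_all
  qed
  then show thesis using f by (intro that[of "matrix f"]) (simp_all add: f_def)
qed

section \<open>The estimator as a function of the tuning parameter\<close>

lemma norm_stack_lambda: "norm (stack 0 w 0 :: ('p::finite, 'q::finite) stacked) = norm w"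
proof -
  let ?y = "stack 0 w 0 :: ('p, 'q) stacked"
  have zero: "?y $ r = 0" if "r \<notin> range (\<lambda>k. Inr (Inl k))" for r
    using that by (auto simp: stack_def stack_columns_def split: sum.split)
  have "(\<Sum>r\<in>UNIV. (?y $ r)\<^sup>2) = (\<Sum>r\<in>range (\<lambda>k. Inr (Inl k)). (?y $ r)\<^sup>2)"
    by (rule sum.mono_neutral_right) (simp_all add: zero)
  also have "\<dots> = (\<Sum>k\<in>UNIV. (w $ k)\<^sup>2)"
    by (subst sum.reindex) (simp_all add: inj_on_def)
  finally show ?thesis by (simp add: norm_vec_def L2_set_def)
qed

lemma gradient_compose:
  fixes f :: "real^'n \<Rightarrow> real" and h :: "real^'m \<Rightarrow> real^'n"
  assumes f: "(f has_derivative (\<lambda>u. gradient f (h x) \<bullet> u)) (at (h x))"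
    and h: "(h has_derivative (\<lambda>v. H *v v)) (at x)"
  shows "((\<lambda>s. f (h s)) has_derivative (\<lambda>v. (transpose H *v gradient f (h x)) \<bullet> v)) (at x)"
    and "gradient (\<lambda>s. f (h s)) x = transpose H *v gradient f (h x)"
proof -
  show d: "((\<lambda>s. f (h s)) has_derivative (\<lambda>v. (transpose H *v gradient f (h x)) \<bullet> v)) (at x)"
    using has_derivative_compose[OF h f] by (simp add: dot_lmul_matrix[symmetric] transpose_matrix_vector)
  show "gradient (\<lambda>s. f (h s)) x = transpose H *v gradient f (h x)"
    unfolding gradient_def[of "\<lambda>s. f (h s)"] frechet_derivative_at[OF d, symmetric]
    by (simp add: vec_eq_iff inner_axis)
qed

context smooth_model
begin

lemma deriv_of_eta_fun:
  "deriv_of (eta_fun \<Phi> \<Psi> a) = A (theta_of a) (lambda_of a) ** deriv_of a + C (theta_of a) (lambda_of a)"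
  by (simp add: eta_fun_def)

lemma A_differentiable:
  assumes "l \<in> L"
  shows "(\<lambda>s. A t s) differentiable (at l)"
  using jacobian_A_differentiable[of "stack t l 0"] assms by (simp add: dom_def)

text \<open>Where the third block of eta vanishes, \<open>C = - A D\<close>, so the \<theta>-rows of
  the full Jacobian have their range inside that of \<open>A\<close>. The full Jacobian is onto,
  hence so is \<open>A\<close>.\<close>

lemma invertible_A:
  assumes a: "a \<in> dom" and inv: "invertible (jacobian (eta_fun \<Phi> \<Psi>) (at a))"
    and root: "deriv_of (eta_fun \<Phi> \<Psi> a) = 0"
  shows "invertible (A (theta_of a) (lambda_of a))"
proof (rule invertibleI_surjective)
  fix y :: "real^'p"
  let ?J = "jacobian (eta_fun \<Phi> \<Psi>) (at a)"
  obtain x where "?J *v x = stack y 0 0" using matrix_inv_mult_vec(1)[OF inv] by metis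
  then have "A (theta_of a) (lambda_of a) *v theta_of x + C (theta_of a) (lambda_of a) *v lambda_of x = y"
    using eta_fun_jacobian_theta[OF a, of x] by simp
  moreover have "C (theta_of a) (lambda_of a) = - (A (theta_of a) (lambda_of a) ** deriv_of a)"
    using root unfolding deriv_of_eta_fun by (simp add: add_eq_0_iff)
  then have "C (theta_of a) (lambda_of a) *v lambda_of x = A (theta_of a) (lambda_of a) *v (- (deriv_of a *v lambda_of x))"
    by (simp add: matrix_vector_mul_assoc[symmetric] matrix_vector_mult_diff_distrib[of _ 0, simplified]
        matrix_vector_mult_diff_rdistrib[of 0, simplified])
  ultimately have "A (theta_of a) (lambda_of a) *v (theta_of x - deriv_of a *v lambda_of x) = y"
    by (simp add: matrix_vector_right_distrib[symmetric])
  then show "\<exists>x. A (theta_of a) (lambda_of a) *v x = y" by blast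
qed

end

locale solved_model = smooth_model \<Phi> \<Psi> L
  for \<Phi> :: "real^'p \<Rightarrow> real^'q \<Rightarrow> real^'p" and \<Psi> :: "real^'p \<Rightarrow> real" and L :: "(real^'q) set" +
  fixes th :: "real^'q \<Rightarrow> real^'p"
  assumes th_root: "\<And>l t. l \<in> L \<Longrightarrow> \<Phi> t l = 0 \<longleftrightarrow> t = th l"
    and th_differentiable: "\<And>l. l \<in> L \<Longrightarrow> th differentiable (at l)"
begin

definition alpha :: "real^'q \<Rightarrow> ('p, 'q) stacked" where
  "alpha l = stack (th l) l (jacobian th (at l))"

lemma alpha_components [simp]: "theta_of (alpha l) = th l" "lambda_of (alpha l) = l"
  "deriv_of (alpha l) = jacobian th (at l)"
  by (simp_all add: alpha_def)

lemma \<Phi>_th: "l \<in> L \<Longrightarrow> \<Phi> (th l) l = 0"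
  using th_root by blast

lemma alpha_dom: "l \<in> L \<Longrightarrow> alpha l \<in> dom"
  by (simp add: dom_def)

lemma th_derivative: "l \<in> L \<Longrightarrow> (th has_derivative (\<lambda>v. jacobian th (at l) *v v)) (at l)"
  using th_differentiable by (simp add: jacobian_works)

lemma th_Pair_derivative:
  "l \<in> L \<Longrightarrow> ((\<lambda>s. (th s, s)) has_derivative (\<lambda>v. (jacobian th (at l) *v v, v))) (at l)"
  by (intro has_derivative_Pair th_derivative has_derivative_ident)

text \<open>Implicit differentiation of \<open>\<Phi> (th l) l = 0\<close>; it says that the third
  block of eta vanishes on the solution curve.\<close>

lemma jacobian_th_equation:
  assumes l: "l \<in> L"
  shows "A (th l) l ** jacobian th (at l) + C (th l) l = 0"
proof -
  have "(A (th l) l ** jacobian th (at l) + C (th l) l) *v v = 0 *v v" for v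
  proof -
    have "(A (th l) l *v (jacobian th (at l) *v v) + C (th l) l *v v) $ i = 0" for i
    proof -
      have "((\<lambda>s. g i (th s, s)) has_derivative (\<lambda>v. dg i (jacobian th (at l) *v v, v) (th l, l))) (at l)"
        by (rule has_derivative_compose[OF th_Pair_derivative[OF l] g_derivative[OF l]])
      moreover have "((\<lambda>s. g i (th s, s)) has_derivative (\<lambda>v. 0)) (at l)"
        by (rule has_derivative_transform_within_open[OF has_derivative_const[of 0] L l])
           (simp add: g_def \<Phi>_th)
      ultimately have "dg i (jacobian th (at l) *v v, v) (th l, l) = 0"
        using has_derivative_unique by (metis (no_types, lifting))
      then show ?thesis by (simp only: dg_eq[OF l])
    qed
    then show ?thesis
      unfolding vec_eq_iff by (simp add: matrix_vector_mult_add_rdistrib matrix_vector_mul_assoc)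
  qed
  then show ?thesis unfolding matrix_eq by blast
qed

lemmas criterion_derivative = gradient_compose(1)[OF \<Psi>_derivative th_derivative]
lemmas gradient_criterion = gradient_compose(2)[OF \<Psi>_derivative th_derivative]

lemma eta_fun_alpha: "l \<in> L \<Longrightarrow> eta_fun \<Phi> \<Psi> (alpha l) = stack 0 (gradient (\<lambda>s. \<Psi> (th s)) l) 0"
  by (simp add: eta_fun_def \<Phi>_th gradient_criterion jacobian_th_equation)

text \<open>The outer two blocks determine everything from \<lambda>: the first fixes \<theta> by
  uniqueness of the solution, the third is then a linear equation for D with invertible
  matrix.\<close>

lemma root_eq_alpha:
  assumes a: "a \<in> dom" and root: "theta_of (eta_fun \<Phi> \<Psi> a) = 0" "deriv_of (eta_fun \<Phi> \<Psi> a) = 0"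
    and inv: "invertible (A (theta_of a) (lambda_of a))"
  shows "a = alpha (lambda_of a)"
proof -
  have l: "lambda_of a \<in> L" using a by (simp add: dom_def)
  have t: "theta_of a = th (lambda_of a)" using root(1) th_root[OF l] by (simp add: eta_fun_def)
  let ?A = "A (theta_of a) (lambda_of a)"
  have "?A ** deriv_of a = ?A ** jacobian th (at (lambda_of a))"
    using root(2) jacobian_th_equation[OF l] unfolding deriv_of_eta_fun t
    by (metis add_right_cancel)
  then have "matrix_inv ?A ** (?A ** deriv_of a) = matrix_inv ?A ** (?A ** jacobian th (at (lambda_of a)))" by simp
  then have "deriv_of a = jacobian th (at (lambda_of a))"
    by (simp add: matrix_mul_assoc matrix_inv_inverse[OF inv])
  with t show ?thesis by (intro stacked_eqI) simp_all
qed

text \<open>Only one derivative of \<open>th\<close> is given. The second is gained from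
  \<open>D = - matrix_inv A ** C\<close> along the curve, where both factors are differentiable
  because \<open>\<Phi>\<close> is C2.\<close>

lemma jacobian_th_differentiable:
  assumes l: "l \<in> L" and inv: "invertible (A (th l) l)"
  shows "(\<lambda>s. jacobian th (at s)) differentiable (at l)"
proof -
  have dgd: "(\<lambda>s. dg i u (th s, s)) differentiable (at l)" if "u \<in> Basis" for i u
    unfolding differentiable_def
    using has_derivative_compose[OF th_Pair_derivative[OF l] dg_derivative[OF that l]] by blast
  have trans: "f differentiable (at l)" if "h differentiable (at l)" "\<And>s. s \<in> L \<Longrightarrow> h s = f s" for f h :: "real^'q \<Rightarrow> real"
  proof -
    from that(1) obtain h' where "(h has_derivative h') (at l)" unfolding differentiable_def by blast
    from has_derivative_transform_within_open[OF this L l that(2)] show ?thesis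
      unfolding differentiable_def by blast
  qed
  have Ad: "(\<lambda>s. A (th s) s $ i $ m) differentiable (at l)" for i m
    by (rule trans[OF dgd[OF axis_Pair_Basis(1)]]) (simp add: A_nth)
  have Cd: "(\<lambda>s. C (th s) s $ i $ k) differentiable (at l)" for i k
    by (rule trans[OF dgd[OF axis_Pair_Basis(2)]]) (simp add: C_nth)
  have invd: "(\<lambda>s. matrix_inv (A (th s) s) $ i $ m) differentiable (at l)" for i m
  proof -
    have "(\<lambda>s. matrix_inv (A (th s) s)) differentiable (at l)"
      by (rule matrix_inv_differentiable[of "\<lambda>s. A (th s) s", OF Ad inv])
    then obtain D where D: "((\<lambda>s. matrix_inv (A (th s) s)) has_derivative D) (at l)"
      unfolding differentiable_def by blast
    show ?thesis
      unfolding differentiable_def by (rule exI, rule has_derivative_vec_nth[OF has_derivative_vec_nth[OF D]])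
  qed
  have "isCont (\<lambda>s. det (A (th s) s)) l"
    by (rule differentiable_imp_continuous_within[OF det_differentiable[OF Ad]])
  moreover have "det (A (th l) l) \<noteq> 0" using inv by (simp add: invertible_det_nz)
  ultimately obtain d where d: "d > 0" "\<And>s. dist l s < d \<Longrightarrow> det (A (th s) s) \<noteq> 0"
    using continuous_at_avoid by blast
  obtain d' where d': "d' > 0" "ball l d' \<subseteq> L" using L l open_contains_ball by blast
  have eq: "jacobian th (at s) = - (matrix_inv (A (th s) s) ** C (th s) s)" if "dist s l < min d d'" for s
  proof -
    have s: "s \<in> L" "invertible (A (th s) s)"
      using that d(2)[of s] d'(2) by (auto simp: dist_commute invertible_det_nz subset_iff)
    have "A (th s) s ** jacobian th (at s) = - C (th s) s"
      using jacobian_th_equation[OF s(1)] by (simp add: eq_neg_iff_add_eq_0)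
    then have "matrix_inv (A (th s) s) ** (A (th s) s ** jacobian th (at s)) = matrix_inv (A (th s) s) ** (- C (th s) s)"
      by simp
    moreover have "M ** (- N) = - (M ** N)" for M :: "real^'p^'p" and N :: "real^'q^'p"
      by (simp add: matrix_matrix_mult_def vec_eq_iff sum_negf)
    ultimately show ?thesis by (simp add: matrix_mul_assoc matrix_inv_inverse[OF s(2)])
  qed
  show ?thesis
  proof (intro differentiable_vecI)
    fix i k
    have "(\<lambda>s. - (\<Sum>m\<in>UNIV. matrix_inv (A (th s) s) $ i $ m * C (th s) s $ m $ k)) differentiable (at l)"
      by (intro differentiable_minus differentiable_sum finite ballI differentiable_mult invd Cd)
    then show "(\<lambda>s. jacobian th (at s) $ i $ k) differentiable (at l)"
      by (rule differentiable_transform_within[where d="min d d'"])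
         (use d d' in \<open>simp_all add: eq matrix_matrix_mult_def\<close>)
  qed
qed

text \<open>Along \<open>s \<mapsto> alpha s\<close> the outer blocks of \<open>eta_fun\<close> vanish and the middle one is the gradient
  of the criterion. Differentiating this identity replaces an explicit formula for the second
  derivative of \<open>th\<close>.\<close>

lemma criterion_second_derivative:
  assumes l: "l \<in> L" and inv: "invertible (A (th l) l)"
  shows "gradient (\<lambda>s. \<Psi> (th s)) differentiable (at l)"
    and "\<exists>X. jacobian (eta_fun \<Phi> \<Psi>) (at (alpha l)) *v stack (jacobian th (at l) *v v) v X =
      stack 0 (hessian (\<lambda>s. \<Psi> (th s)) l *v v) 0"
proof -
  define X where "X = frechet_derivative (\<lambda>s. jacobian th (at s)) (at l)"
  let ?J = "jacobian (eta_fun \<Phi> \<Psi>) (at (alpha l))"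
  let ?a = "\<lambda>v. stack (jacobian th (at l) *v v) v (X v)"
  have Xd: "((\<lambda>s. jacobian th (at s)) has_derivative X) (at l)"
    unfolding X_def using jacobian_th_differentiable[OF l inv] by (simp add: frechet_derivative_works)
  have ad: "(alpha has_derivative ?a) (at l)"
  proof (rule has_derivative_vecI)
    fix r :: "'p + ('q + ('q \<times> 'p))"
    show "((\<lambda>s. alpha s $ r) has_derivative (\<lambda>v. ?a v $ r)) (at l)"
      by (cases r rule: stacked_index_cases)
         (auto simp: alpha_def intro!: has_derivative_vec_nth th_derivative[OF l] Xd)
  qed
  have "(eta_fun \<Phi> \<Psi> has_derivative (\<lambda>x. ?J *v x)) (at (alpha l))"
    using eta_fun_differentiable[OF alpha_dom[OF l]] by (simp add: jacobian_works)
  from has_derivative_compose[OF ad this]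
  have "((\<lambda>s. eta_fun \<Phi> \<Psi> (alpha s)) has_derivative (\<lambda>v. ?J *v ?a v)) (at l)" .
  from has_derivative_transform_within_open[OF this L l eta_fun_alpha]
  have d: "((\<lambda>s. stack 0 (gradient (\<lambda>s. \<Psi> (th s)) s) 0) has_derivative (\<lambda>v. ?J *v ?a v)) (at l)" by simp
  have nth: "((\<lambda>s. stack 0 (gradient (\<lambda>s. \<Psi> (th s)) s) 0 $ r) has_derivative (\<lambda>v. (?J *v ?a v) $ r)) (at l)" for r
    by (rule has_derivative_vec_nth[OF d])
  have grad: "(gradient (\<lambda>s. \<Psi> (th s)) has_derivative (\<lambda>v. lambda_of (?J *v ?a v))) (at l)"
    by (rule has_derivative_vecI) (use nth[of "Inr (Inl _)"] in simp)
  then show gd: "gradient (\<lambda>s. \<Psi> (th s)) differentiable (at l)" using differentiable_def by blast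
  then have "(gradient (\<lambda>s. \<Psi> (th s)) has_derivative (\<lambda>v. hessian (\<lambda>s. \<Psi> (th s)) l *v v)) (at l)"
    unfolding hessian_def by (simp add: jacobian_works)
  from has_derivative_unique[OF grad this] have lam: "lambda_of (?J *v ?a v) = hessian (\<lambda>s. \<Psi> (th s)) l *v v"
    by (rule fun_cong)
  have zero: "(?J *v ?a v) $ r = 0" if "((\<lambda>s. stack 0 (gradient (\<lambda>s. \<Psi> (th s)) s) 0 $ r)) = (\<lambda>s. 0)" for r
    using has_derivative_unique[OF nth[of r, unfolded that] has_derivative_const] by (rule fun_cong)
  have "?J *v ?a v = stack 0 (hessian (\<lambda>s. \<Psi> (th s)) l *v v) 0"
  proof (rule stacked_eqI)
    show "theta_of (?J *v ?a v) = theta_of (stack 0 (hessian (\<lambda>s. \<Psi> (th s)) l *v v) 0)"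
      unfolding vec_eq_iff stacked_of_nth by (simp add: zero)
    show "deriv_of (?J *v ?a v) = deriv_of (stack 0 (hessian (\<lambda>s. \<Psi> (th s)) l *v v) 0)"
      unfolding vec_eq_iff stacked_of_nth by (simp add: zero)
  qed (simp add: lam)
  then show "\<exists>X. ?J *v stack (jacobian th (at l) *v v) v X = stack 0 (hessian (\<lambda>s. \<Psi> (th s)) l *v v) 0"
    by blast
qed

text \<open>The equation \<open>?J *v \<delta> = - x\<close> is solved by superposition. A direction
  \<open>stack u 0 U\<close> without \<lambda>-component removes the \<theta> and D residuals, with
  \<open>U\<close> found column by column. A tangent \<open>stack (D *v v) v X\<close> of the
  solution curve affects only the middle block, by \<open>Z1 *v v\<close>, and \<open>v\<close> is
  chosen to cancel what is left there.\<close>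

lemma solve_first_block:
  assumes l: "l \<in> L" and inv: "invertible (jacobian (eta_fun \<Phi> \<Psi>) (at (alpha l)))"
  defines "Ji \<equiv> matrix_inv (- A (th l) l)" and "D \<equiv> jacobian th (at l)" and "Z1 \<equiv> hessian (\<lambda>s. \<Psi> (th s)) l"
  shows "invertible (- A (th l) l)"
    and "theta_of (matrix_inv (jacobian (eta_fun \<Phi> \<Psi>) (at (alpha l))) *v x) =
      - (Ji *v theta_of x - D *v (matrix_inv Z1 *v (lambda_of x + transpose D *v (hessian \<Psi> (th l) *v (Ji *v theta_of x)) +
          (\<chi> j. gradient \<Psi> (th l) \<bullet> (Ji *v (column j (deriv_of x) + W (alpha l) j *v (Ji *v theta_of x)))))))"
proof -
  let ?J = "jacobian (eta_fun \<Phi> \<Psi>) (at (alpha l))" and ?b = "gradient \<Psi> (th l)" and ?A = "A (th l) l"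
  have A_inv: "invertible ?A"
    using invertible_A[OF alpha_dom[OF l] inv] eta_fun_alpha[OF l] by simp
  have neg: "(- ?A) *v u = - (?A *v u)" for u
    using matrix_vector_mult_diff_rdistrib[of 0 ?A u] by simp
  show nA: "invertible (- ?A)"
  proof (rule invertibleI_injective)
    fix u assume "(- ?A) *v u = 0"
    then have "matrix_inv ?A *v (?A *v u) = 0" by (simp add: neg)
    then show "u = 0" by (simp add: matrix_inv_mult_vec[OF A_inv])
  qed
  have AJi: "?A *v (Ji *v u) = - u" for u
    using matrix_inv_mult_vec(1)[OF nA, of u] unfolding neg Ji_def by (simp add: minus_equation_iff)
  have key: "\<exists>X. ?J *v stack (D *v v) v X = stack 0 (Z1 *v v) 0" for v
    unfolding D_def Z1_def by (rule criterion_second_derivative(2)[OF l A_inv])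
  \<comment> \<open>A vector \<open>v\<close> in the kernel of \<open>Z1\<close> would give a
    tangent in the kernel of \<open>?J\<close>, and the \<lambda>-component of that tangent is
    \<open>v\<close> itself.\<close>
  have Z1_inv: "invertible Z1"
  proof (rule invertibleI_injective)
    fix v assume "Z1 *v v = 0"
    with key[of v] obtain X where X: "?J *v stack (D *v v) v X = stack 0 0 0" by auto
    have "stack 0 0 0 = (0 :: ('p, 'q) stacked)" by (rule stacked_eqI) simp_all
    with X have "stack (D *v v) v X = 0"
      using matrix_inv_mult_vec(2)[OF inv, of "stack (D *v v) v X"] by simp
    then show "v = 0" by (metis stack_components(2) stacked_zero(2))
  qed
  define u where "u = Ji *v theta_of x"
  \<comment> \<open>Column j solves the j-th D-equation; the sign is right because \<open>Ji\<close>
    inverts \<open>- A\<close>.\<close>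
  define U where "U = (\<chi> i j. (Ji *v (column j (deriv_of x) + W (alpha l) j *v u)) $ i)"
  have U: "column j U = Ji *v (column j (deriv_of x) + W (alpha l) j *v u)" for j
    by (simp add: U_def column_def vec_eq_iff)
  define w where "w = (\<chi> j. ?b \<bullet> (Ji *v (column j (deriv_of x) + W (alpha l) j *v u)))"
  have Ub: "?b v* U = w"
  proof -
    have "(transpose U *v ?b) $ j = ?b \<bullet> column j U" for j
      by (simp add: matrix_vector_mult_def transpose_def inner_vec_def column_def mult.commute)
    then have "transpose U *v ?b = w" by (simp only: w_def U vec_eq_iff vec_lambda_beta) simp
    then show ?thesis by (simp only: transpose_matrix_vector)
  qed
  define v where "v = - (matrix_inv Z1 *v (lambda_of x + transpose D *v (hessian \<Psi> (th l) *v u) + w))"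
  have mneg: "N *v (- y) = - (N *v y)" for N :: "real^'k^'m" and y
    using matrix_vector_mult_diff_distrib[of N 0 y] by simp
  obtain X where X: "?J *v stack (D *v v) v X = stack 0 (Z1 *v v) 0" using key by blast
  have Z1v: "Z1 *v v = - (lambda_of x + transpose D *v (hessian \<Psi> (th l) *v u) + w)"
    unfolding v_def mneg by (simp only: matrix_inv_mult_vec(1)[OF Z1_inv])
  define \<delta> where "\<delta> = stack (D *v v) v X + stack u 0 U"
  have "?J *v \<delta> = - x"
  proof (rule stacked_eqI)
    have split: "?J *v \<delta> = stack 0 (Z1 *v v) 0 + ?J *v stack u 0 U"
      by (simp add: \<delta>_def matrix_vector_right_distrib X)
    have neg_of: "theta_of (- x) = - theta_of x" "lambda_of (- x) = - lambda_of x" "deriv_of (- x) = - deriv_of x"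
      by (simp_all add: vec_eq_iff)
    show "theta_of (?J *v \<delta>) = theta_of (- x)"
      unfolding split neg_of by (simp add: eta_fun_jacobian_theta[OF alpha_dom[OF l]] u_def AJi)
    show "lambda_of (?J *v \<delta>) = lambda_of (- x)"
      unfolding split neg_of
      by (simp add: eta_fun_jacobian_lambda[OF alpha_dom[OF l]] Z1v Ub D_def)
    have "column j (deriv_of (?J *v \<delta>)) = column j (- deriv_of x)" for j
    proof -
      have "column j (deriv_of (?J *v \<delta>)) = column j (deriv_of (?J *v stack u 0 U))"
        unfolding split by (simp add: column_def)
      also have "\<dots> = W (alpha l) j *v u + ?A *v column j U"
        using eta_fun_jacobian_deriv[OF alpha_dom[OF l], of "stack u 0 U" j] by simp
      also have "\<dots> = - column j (deriv_of x)" unfolding U AJi by simp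
      finally show ?thesis by (simp add: column_def vec_eq_iff)
    qed
    then show "deriv_of (?J *v \<delta>) = deriv_of (- x)"
      unfolding neg_of by (simp add: column_def vec_eq_iff)
  qed
  then have "matrix_inv ?J *v x = - \<delta>"
    using matrix_inv_mult_vec(2)[OF inv, of \<delta>] mneg by (metis minus_minus)
  then have "theta_of (matrix_inv ?J *v x) = - (D *v v + u)"
    by (simp add: \<delta>_def vec_eq_iff)
  then show "theta_of (matrix_inv ?J *v x) =
      - (Ji *v theta_of x - D *v (matrix_inv Z1 *v (lambda_of x + transpose D *v (hessian \<Psi> (th l) *v (Ji *v theta_of x)) +
          (\<chi> j. ?b \<bullet> (Ji *v (column j (deriv_of x) + W (alpha l) j *v (Ji *v theta_of x)))))))"
    by (simp add: v_def mneg u_def w_def)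
qed

text \<open>The middle block is replaced by \<open>lambda_of a - l\<close>; the zero of the resulting map is \<open>alpha l\<close>.\<close>

lemma alpha_near:
  fixes B :: "real^('p + ('q + ('q \<times> 'p)))^('p + ('q + ('q \<times> 'p)))"
  assumes dc: "deriv_close (eta_fun \<Phi> \<Psi>) B \<epsilon> (cball a0 \<delta>)" and "\<epsilon> \<ge> 0" and sub: "cball a0 \<delta> \<subseteq> dom"
    and K: "K > 0" "\<And>x. norm x \<le> K * norm (B *v x)" "K * \<epsilon> \<le> 1/2"
    and B2: "invertible B2" "\<And>x. B2 *v x = stack (theta_of (B *v x)) (lambda_of x) (deriv_of (B *v x))"
    and K2: "K2 > 0" "\<And>x. norm x \<le> K2 * norm (B2 *v x)" "K2 * \<epsilon> \<le> 1/2"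
    and small: "2 * K2 * (norm (eta_fun \<Phi> \<Psi> a0) + norm (l - lambda_of a0)) \<le> \<delta>"
  shows "norm (alpha l - a0) \<le> 2 * K2 * (norm (eta_fun \<Phi> \<Psi> a0) + norm (l - lambda_of a0))"
proof -
  let ?f = "eta_fun \<Phi> \<Psi>"
  define G where "G a = stack (theta_of (?f a)) (lambda_of a - l) (deriv_of (?f a))" for a
  define H where "H y x = stack (theta_of y) (lambda_of x) (deriv_of y)" for x y :: "('p, 'q) stacked"
  have norm_le: "norm (stack (theta_of y) 0 (deriv_of y)) \<le> norm y" for y :: "('p, 'q) stacked"
  proof (rule norm_le_componentwise_cart)
    fix r
    show "norm (stack (theta_of y) 0 (deriv_of y) $ r) \<le> norm (y $ r)"
      by (cases r rule: stacked_index_cases) simp_all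
  qed
  have G_deriv: "(G has_derivative (\<lambda>x. H (jacobian ?f (at a) *v x) x)) (at a)" if "a \<in> dom" for a
  proof (rule has_derivative_vecI)
    have fd: "(?f has_derivative (\<lambda>x. jacobian ?f (at a) *v x)) (at a)"
      using eta_fun_differentiable[OF that] by (simp add: jacobian_works)
    fix r :: "'p + ('q + ('q \<times> 'p))"
    show "((\<lambda>a. G a $ r) has_derivative (\<lambda>x. H (jacobian ?f (at a) *v x) x $ r)) (at a)"
    proof (cases r rule: stacked_index_cases)
      case (theta i)
      show ?thesis unfolding theta G_def H_def stack_nth stacked_of_nth by (rule has_derivative_vec_nth[OF fd])
    next
      case (lambda k)
      show ?thesis unfolding lambda G_def H_def stack_nth stacked_of_nth vector_minus_component
        using has_derivative_diff[OF bounded_linear_imp_has_derivative[OF bounded_linear_vec_nth, of "Inr (Inl k)"]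
            has_derivative_const[of "l $ k"]] by simp
    next
      case (deriv k i)
      show ?thesis unfolding deriv G_def H_def stack_nth stacked_of_nth by (rule has_derivative_vec_nth[OF fd])
    qed
  qed
  have G_close: "deriv_close G B2 \<epsilon> (cball a0 \<delta>)"
    unfolding deriv_close_def
  proof (intro ballI conjI allI)
    fix a x assume a: "a \<in> cball a0 \<delta>"
    then have d: "a \<in> dom" using sub by blast
    then show G_diff: "G differentiable (at a)" using G_deriv differentiable_def by blast
    have "jacobian G (at a) *v x = H (jacobian ?f (at a) *v x) x"
      using fun_cong[OF has_derivative_unique[OF G_diff[unfolded jacobian_works] G_deriv[OF d]], of x] .
    then have "(jacobian G (at a) - B2) *v x = stack (theta_of ((jacobian ?f (at a) - B) *v x)) 0 (deriv_of ((jacobian ?f (at a) - B) *v x))"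
      unfolding matrix_vector_mult_diff_rdistrib B2(2)
      by (intro stacked_eqI) (simp_all add: H_def vec_eq_iff)
    then have "norm ((jacobian G (at a) - B2) *v x) \<le> norm ((jacobian ?f (at a) - B) *v x)"
      using norm_le by simp
    also have "\<dots> \<le> \<epsilon> * norm x" using dc a by (simp add: deriv_close_def)
    finally show "norm ((jacobian G (at a) - B2) *v x) \<le> \<epsilon> * norm x" .
  qed
  have G0: "norm (G a0) \<le> norm (?f a0) + norm (l - lambda_of a0)"
  proof -
    have "G a0 = stack (theta_of (?f a0)) 0 (deriv_of (?f a0)) + stack 0 (lambda_of a0 - l) 0"
      by (simp add: G_def stack_add)
    then have tri: "norm (G a0) \<le> norm (stack (theta_of (?f a0)) 0 (deriv_of (?f a0))) +
        norm (stack 0 (lambda_of a0 - l) 0 :: ('p, 'q) stacked)"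
      by (simp add: norm_triangle_ineq)
    have sn: "norm (stack 0 w 0 :: ('p, 'q) stacked) = norm w" for w :: "real^'q"
      by (rule norm_stack_lambda)
    from sn[of "lambda_of a0 - l"] tri norm_le[of "?f a0"] norm_minus_commute[of "lambda_of a0" l]
    show ?thesis by linarith
  qed
  then have sm: "2 * K2 * norm (G a0) \<le> \<delta>"
    using small K2(1) mult_left_mono[OF G0, of "2 * K2"] by linarith
  obtain a where a: "a \<in> cball a0 \<delta>" "G a = 0" "norm (a - a0) \<le> 2 * K2 * norm (G a0)"
    by (rule deriv_close_root[OF G_close assms(2) B2(1) K2 sm])
  have "theta_of (G a) = 0" "lambda_of (G a) = 0" "deriv_of (G a) = 0" using a(2) by simp_all
  then have root: "theta_of (?f a) = 0" "lambda_of a = l" "deriv_of (?f a) = 0" by (simp_all add: G_def)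
  have d: "a \<in> dom" using a(1) sub by blast
  have "invertible (jacobian ?f (at a))" by (rule deriv_close_invertible(2)[OF dc a(1) K])
  then have ae: "a = alpha l"
    using root_eq_alpha[OF d root(1,3) invertible_A[OF d _ root(3)]] root(2) by simp
  show ?thesis using a(3) mult_left_mono[OF G0, of "2 * K2"] K2(1) unfolding ae by linarith
qed

end

section \<open>The plug-in variance estimate\<close>

lemma frechet_derivative_average:
  fixes f :: "nat \<Rightarrow> 'a::real_normed_vector \<Rightarrow> 'b::real_normed_vector"
  assumes "\<And>i. f i differentiable (at x)"
  shows "((\<lambda>x. c *\<^sub>R (\<Sum>i<n. f i x)) has_derivative (\<lambda>v. c *\<^sub>R (\<Sum>i<n. frechet_derivative (f i) (at x) v))) (at x)"
    and "frechet_derivative (\<lambda>x. c *\<^sub>R (\<Sum>i<n. f i x)) (at x) v = c *\<^sub>R (\<Sum>i<n. frechet_derivative (f i) (at x) v)"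
proof -
  show *: "((\<lambda>x. c *\<^sub>R (\<Sum>i<n. f i x)) has_derivative (\<lambda>v. c *\<^sub>R (\<Sum>i<n. frechet_derivative (f i) (at x) v))) (at x)"
    using assms by (intro has_derivative_scaleR_right has_derivative_sum) (simp add: frechet_derivative_works)
  show "frechet_derivative (\<lambda>x. c *\<^sub>R (\<Sum>i<n. f i x)) (at x) v = c *\<^sub>R (\<Sum>i<n. frechet_derivative (f i) (at x) v)"
    using fun_cong[OF frechet_derivative_at[OF *], of v] by simp
qed

lemma differentiable_vec_nth:
  fixes f :: "'a::real_normed_vector \<Rightarrow> ('b::real_normed_vector)^'n"
  shows "f differentiable (at x) \<Longrightarrow> (\<lambda>x. f x $ i) differentiable (at x)"
  unfolding differentiable_def by (elim exE) (rule exI, rule has_derivative_vec_nth)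

lemma jacobian_average:
  fixes f :: "nat \<Rightarrow> real^'k \<Rightarrow> real^'m"
  assumes "\<And>i. f i differentiable (at x)"
  shows "jacobian (\<lambda>x. c *\<^sub>R (\<Sum>i<n. f i x)) (at x) = c *\<^sub>R (\<Sum>i<n. jacobian (f i) (at x))"
proof (rule has_derivative_jacobian_eq)
  have "frechet_derivative (f i) (at x) v = jacobian (f i) (at x) *v v" for i v
    using fun_cong[OF frechet_derivative_at[OF assms[of i, unfolded jacobian_works]], of v] by simp
  then show "((\<lambda>x. c *\<^sub>R (\<Sum>i<n. f i x)) has_derivative (\<lambda>v. (c *\<^sub>R (\<Sum>i<n. jacobian (f i) (at x))) *v v)) (at x)"
    using frechet_derivative_average(1)[of f, OF assms, where c=c and n=n]
    by (simp add: matrix_vector_mult_sum_left scaleR_matrix_vector_assoc[symmetric])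
qed

lemma gradient_average:
  fixes f :: "nat \<Rightarrow> real^'k \<Rightarrow> real"
  assumes "\<And>i. f i differentiable (at x)"
  shows "gradient (\<lambda>x. c * (\<Sum>i<n. f i x)) x = c *\<^sub>R (\<Sum>i<n. gradient (f i) x)"
proof -
  have "frechet_derivative (\<lambda>x. c * (\<Sum>i<n. f i x)) (at x) v = c * (\<Sum>i<n. frechet_derivative (f i) (at x) v)" for v
    using frechet_derivative_average(2)[of f, OF assms, where c=c and n=n and v=v] by (simp only: real_scaleR_def)
  then show ?thesis by (simp add: gradient_def vec_eq_iff sum_component)
qed

lemma hessian_average:
  fixes f :: "nat \<Rightarrow> real^'k \<Rightarrow> real"
  assumes "open S" "x \<in> S" and f: "\<And>i y. y \<in> S \<Longrightarrow> f i differentiable (at y)"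
    and g: "\<And>i. gradient (f i) differentiable (at x)"
  shows "hessian (\<lambda>x. c * (\<Sum>i<n. f i x)) x = c *\<^sub>R (\<Sum>i<n. hessian (f i) x)"
  unfolding hessian_def
proof (rule has_derivative_jacobian_eq, rule has_derivative_transform_within_open[OF _ assms(1,2)])
  show "((\<lambda>x. c *\<^sub>R (\<Sum>i<n. gradient (f i) x)) has_derivative (\<lambda>v. (c *\<^sub>R (\<Sum>i<n. jacobian (gradient (f i)) (at x))) *v v)) (at x)"
  proof -
    have "(\<lambda>x. c *\<^sub>R (\<Sum>i<n. gradient (f i) x)) differentiable (at x)"
      unfolding differentiable_def by (rule exI, rule frechet_derivative_average(1)[of "\<lambda>i. gradient (f i)", OF g])
    then show ?thesis unfolding jacobian_works jacobian_average[of "\<lambda>i. gradient (f i)", OF g] .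
  qed
  show "c *\<^sub>R (\<Sum>i<n. gradient (f i) y) = gradient (\<lambda>x. c * (\<Sum>i<n. f i x)) y" if "y \<in> S" for y
    using gradient_average[of f, OF f[OF that]] by simp
qed

text \<open>One realised sample for which the equations are uniquely solvable and \<open>th\<close>
  is differentiable; no probability enters.\<close>

locale solved_sample = sample \<phi> \<psi> n z th l
  for \<phi> :: "'z \<Rightarrow> real^'p \<Rightarrow> real^'q \<Rightarrow> real^'p" and \<psi> :: "'z \<Rightarrow> real^'p \<Rightarrow> real"
    and n :: nat and z :: "nat \<Rightarrow> 'z" and th :: "real^'q \<Rightarrow> real^'p" and l :: "real^'q" +
  fixes L :: "(real^'q) set"
  assumes smooth: "\<And>y. smooth_model (\<phi> y) (\<psi> y) L"
    and root: "\<And>s t. s \<in> L \<Longrightarrow> Phi_n t s = 0 \<longleftrightarrow> t = th s"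
    and th_diff: "\<And>s. s \<in> L \<Longrightarrow> th differentiable (at s)"
begin

lemma L_open: "open L"
  using smooth by (simp add: smooth_model_def)

sublocale S: solved_model Phi_n Psi_n L th
proof
  show "open L" by (rule L_open)
  have op: "open (UNIV \<times> L)" using L_open by (intro open_Times) auto
  have "C2_on (\<lambda>x. (1 / real n) * (\<Sum>k<n. (\<lambda>(t, l). \<phi> (z k) t l $ i) x)) (UNIV \<times> L)" for i
    using smooth by (intro C2_on_scale C2_on_sum op) (simp add: smooth_model_def)
  moreover have "(\<lambda>(t, l). Phi_n t l $ i) = (\<lambda>x. (1 / real n) * (\<Sum>k<n. (\<lambda>(t, l). \<phi> (z k) t l $ i) x))" for i
    by (simp add: fun_eq_iff Phi_n_def sum_component)
  ultimately show "C2_on (\<lambda>(t, l). Phi_n t l $ i) (UNIV \<times> L)" for i by simp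
  show "C2_on Psi_n UNIV"
    unfolding Psi_n_def[abs_def] using smooth by (intro C2_on_scale C2_on_sum) (simp_all add: smooth_model_def)
qed (use root th_diff in auto)

lemma jacobian_Phi_n:
  assumes "s \<in> L"
  shows "jacobian (\<lambda>t. Phi_n t s) (at t) = (1 / real n) *\<^sub>R (\<Sum>i<n. jacobian (\<lambda>t. \<phi> (z i) t s) (at t))"
    and "jacobian (\<lambda>m. Phi_n t m) (at s) = (1 / real n) *\<^sub>R (\<Sum>i<n. jacobian (\<lambda>m. \<phi> (z i) t m) (at s))"
  unfolding Phi_n_def
  using smooth_model.\<Phi>_derivative_t[OF smooth assms] smooth_model.\<Phi>_derivative_l[OF smooth assms]
  by (intro jacobian_average; unfold differentiable_def; blast)+

lemma \<psi>_differentiable: "\<psi> y differentiable (at t)"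
  using smooth_model.\<Psi>_derivative[OF smooth] differentiable_def by blast

lemma gradient_Psi_n: "gradient Psi_n t = (1 / real n) *\<^sub>R (\<Sum>i<n. gradient (\<psi> (z i)) t)"
  unfolding Psi_n_def[abs_def] by (rule gradient_average) (rule \<psi>_differentiable)

lemma eta_fun_average:
  assumes "lambda_of a \<in> L"
  shows "eta_fun Phi_n Psi_n a = (1 / real n) *\<^sub>R (\<Sum>i<n. eta \<phi> \<psi> (z i) a)"
proof -
  have lin: "theta_of (c *\<^sub>R (\<Sum>i<n. f i)) = c *\<^sub>R (\<Sum>i<n. theta_of (f i))"
    "lambda_of (c *\<^sub>R (\<Sum>i<n. f i)) = c *\<^sub>R (\<Sum>i<n. lambda_of (f i))"
    "deriv_of (c *\<^sub>R (\<Sum>i<n. f i)) = c *\<^sub>R (\<Sum>i<n. deriv_of (f i))"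
    for c and f :: "nat \<Rightarrow> ('p, 'q) stacked"
    by (simp_all add: vec_eq_iff sum_component)
  show ?thesis
  proof (rule stacked_eqI)
    show "theta_of (eta_fun Phi_n Psi_n a) = theta_of ((1 / real n) *\<^sub>R (\<Sum>i<n. eta \<phi> \<psi> (z i) a))"
      unfolding lin eta_eq_eta_fun by (simp add: eta_fun_def Phi_n_def)
    show "lambda_of (eta_fun Phi_n Psi_n a) = lambda_of ((1 / real n) *\<^sub>R (\<Sum>i<n. eta \<phi> \<psi> (z i) a))"
    proof -
      have "linear ((*v) (transpose (deriv_of a)))" by (rule matrix_vector_mul_linear)
      then show ?thesis
        unfolding lin eta_eq_eta_fun eta_fun_def gradient_Psi_n stack_components
        by (simp only: linear_scale linear_sum)
    qed
    have "(c *\<^sub>R (\<Sum>i<n. M i)) ** N + c *\<^sub>R (\<Sum>i<n. R i) = c *\<^sub>R (\<Sum>i<n. M i ** N + R i)"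
      for c :: real and M :: "nat \<Rightarrow> real^'p^'p" and N :: "real^'q^'p" and R
      by (simp add: matrix_eq matrix_vector_mult_add_rdistrib matrix_vector_mul_assoc[symmetric]
          scaleR_matrix_vector_assoc[symmetric] matrix_vector_mult_sum_left sum.distrib scaleR_add_right)
    then show "deriv_of (eta_fun Phi_n Psi_n a) = deriv_of ((1 / real n) *\<^sub>R (\<Sum>i<n. eta \<phi> \<psi> (z i) a))"
      unfolding lin eta_eq_eta_fun eta_fun_def jacobian_Phi_n[OF assms] stack_components .
  qed
qed

section \<open>Identification of the sample quantities with blocks of the Jacobian\<close>

context
  assumes l: "l \<in> L" and inv: "invertible (jacobian (eta_fun Phi_n Psi_n) (at (S.alpha l)))"
begin

lemma J_hat_invertible: "invertible J_hat"
  using S.solve_first_block(1)[OF l inv] by (simp add: J_hat_def)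

text \<open>\<open>J_hat\<close> carries a minus sign, so the implicit equation reads:
  \<lambda>-Jacobian equals \<open>J_hat ** jacobian th (at l)\<close>.\<close>

lemma D_hat_eq: "D_hat = jacobian th (at l)"
proof -
  have "jacobian (\<lambda>t. Phi_n t l) (at (th l)) = - J_hat" by (simp add: J_hat_def)
  then have "jacobian (\<lambda>s. Phi_n (th l) s) (at l) = J_hat ** jacobian th (at l)"
    using S.jacobian_th_equation[OF l]
    by (simp add: matrix_eq matrix_vector_mult_add_rdistrib matrix_vector_mul_assoc[symmetric] matrix_vector_mult_uminus
        add_eq_0_iff)
  then show ?thesis by (simp add: D_hat_def matrix_mul_assoc matrix_inv_inverse[OF J_hat_invertible])
qed

text \<open>\<open>Z1_hat\<close> averages the Hessians of the individual losses, so each summand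
  has to be twice differentiable along \<open>th\<close>. Their gradients are products involving the
  derivative of \<open>th\<close>, which has just been shown to be differentiable.\<close>

lemma Z1_hat_eq: "Z1_hat = hessian (\<lambda>s. Psi_n (th s)) l"
proof -
  have d: "(\<lambda>s. \<psi> (z i) (th s)) differentiable (at s)" if "s \<in> L" for i s
    using differentiable_chain_at[OF th_diff[OF that] \<psi>_differentiable] by (simp add: comp_def)
  have th': "(\<lambda>s. jacobian th (at s)) differentiable (at l)"
    using S.jacobian_th_differentiable[OF l] S.invertible_A[OF S.alpha_dom[OF l] inv] S.eta_fun_alpha[OF l] by simp
  have gd: "gradient (\<lambda>s. \<psi> (z i) (th s)) differentiable (at l)" for i
  proof -
    have gr: "(transpose (jacobian th (at s)) *v gradient (\<psi> (z i)) (th s)) = gradient (\<lambda>s. \<psi> (z i) (th s)) s" if "s \<in> L" for s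
      using gradient_compose(2)[OF smooth_model.\<Psi>_derivative[OF smooth] S.th_derivative[OF that]] by simp
    have "(\<lambda>s. gradient (\<psi> (z i)) (th s)) differentiable (at l)"
      unfolding differentiable_def
      by (rule exI, rule has_derivative_compose[OF S.th_derivative[OF l] smooth_model.gradient_\<Psi>_derivative[OF smooth]])
    then have g1: "(\<lambda>s. gradient (\<psi> (z i)) (th s) $ k) differentiable (at l)" for k
      by (rule differentiable_vec_nth)
    have t1: "(\<lambda>s. jacobian th (at s) $ k $ j) differentiable (at l)" for k j
      by (intro differentiable_vec_nth th')
    have "(\<lambda>s. (transpose (jacobian th (at s)) *v gradient (\<psi> (z i)) (th s)) $ j) differentiable (at l)" for j
      unfolding matrix_vector_mult_def transpose_def vec_lambda_beta
      by (intro differentiable_sum finite ballI differentiable_mult g1 t1)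
    then have "(\<lambda>s. transpose (jacobian th (at s)) *v gradient (\<psi> (z i)) (th s)) differentiable (at l)"
      by (rule differentiable_vecI)
    then obtain D where "((\<lambda>s. transpose (jacobian th (at s)) *v gradient (\<psi> (z i)) (th s)) has_derivative D) (at l)"
      unfolding differentiable_def by blast
    from has_derivative_transform_within_open[OF this L_open l gr] show ?thesis
      unfolding differentiable_def by blast
  qed
  have "hessian (\<lambda>s. (1 / real n) * (\<Sum>i<n. \<psi> (z i) (th s))) l = (1 / real n) *\<^sub>R (\<Sum>i<n. hessian (\<lambda>s. \<psi> (z i) (th s)) l)"
    by (rule hessian_average[OF L_open l d gd])
  then show ?thesis by (simp add: Z1_hat_def Psi_n_def)
qed

lemma Wj_hat_eq: "Wj_hat j = S.W (S.alpha l) j"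
proof -
  have hess: "hessian (\<lambda>t. Phi_n t l $ r) (th l) = (1 / real n) *\<^sub>R (\<Sum>i<n. hessian (\<lambda>t. \<phi> (z i) t l $ r) (th l))" for r
  proof -
    have "hessian (\<lambda>t. (1 / real n) * (\<Sum>i<n. \<phi> (z i) t l $ r)) (th l) = (1 / real n) *\<^sub>R (\<Sum>i<n. hessian (\<lambda>t. \<phi> (z i) t l $ r) (th l))"
    proof (rule hessian_average[OF open_UNIV UNIV_I])
      show "(\<lambda>t. \<phi> (z i) t l $ r) differentiable (at y)" for i y
        unfolding differentiable_def
        using has_derivative_vec_nth[OF smooth_model.\<Phi>_derivative_t[OF smooth l]] by blast
      show "gradient (\<lambda>t. \<phi> (z i) t l $ r) differentiable (at (th l))" for i
        unfolding differentiable_def using smooth_model.gradient_\<Phi>_derivative[OF smooth l] by blast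
    qed
    then show ?thesis by (simp add: Phi_n_def sum_component)
  qed
  have part: "partial j (\<lambda>s. jacobian (\<lambda>t. Phi_n t s) (at (th l))) l =
      (1 / real n) *\<^sub>R (\<Sum>i<n. partial j (\<lambda>s. jacobian (\<lambda>t. \<phi> (z i) t s) (at (th l))) l)"
  proof -
    note d = smooth_model.A_differentiable[OF smooth l]
    have "((\<lambda>s. jacobian (\<lambda>t. Phi_n t s) (at (th l))) has_derivative
        (\<lambda>v. (1 / real n) *\<^sub>R (\<Sum>i<n. frechet_derivative (\<lambda>s. jacobian (\<lambda>t. \<phi> (z i) t s) (at (th l))) (at l) v))) (at l)"
      by (rule has_derivative_transform_within_open[OF frechet_derivative_average(1)[of "\<lambda>i s. jacobian (\<lambda>t. \<phi> (z i) t s) (at (th l))", OF d] L_open l])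
         (simp add: jacobian_Phi_n)
    from fun_cong[OF frechet_derivative_at[OF this], of "axis j 1"] show ?thesis by (simp add: partial_def)
  qed
  have row: "v v* (c *\<^sub>R (\<Sum>i<n. H i)) = c *\<^sub>R (\<Sum>i<n. v v* H i)" for v c and H :: "nat \<Rightarrow> real^'p^'p"
    by (simp add: vector_matrix_mult_def vec_eq_iff sum_component sum_distrib_left sum_distrib_right mult_ac)
       (simp add: sum.swap[of _ UNIV])
  have "S.W (S.alpha l) j = (\<chi> r. (1 / real n) *\<^sub>R (\<Sum>i<n. column j D_hat v* hessian (\<lambda>t. \<phi> (z i) t l $ r) (th l))) +
      (1 / real n) *\<^sub>R (\<Sum>i<n. partial j (\<lambda>s. jacobian (\<lambda>t. \<phi> (z i) t s) (at (th l))) l)"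
    by (simp add: S.W_def[OF S.alpha_dom[OF l]] hess part row D_hat_eq)
  also have "\<dots> = Wj_hat j"
    by (simp add: Wj_hat_def G_hat_def vec_eq_iff sum_component sum.distrib distrib_left)
  finally show ?thesis by simp
qed

text \<open>\<open>solve_first_block\<close> at
  \<open>x = eta \<phi> \<psi> (z i) (S.alpha l)\<close>: the contributions of its \<theta>,
  \<lambda> and D blocks are the terms with \<open>A1_hat\<close>, \<open>A2_hat\<close> and
  \<open>A3_hat\<close>. The transposed \<open>D_hat\<close> inside \<open>A2_hat\<close> is the one
  that forms the \<lambda> block from the gradient.\<close>

lemma v_hat_eq:
  "v_hat i = - theta_of (matrix_inv (jacobian (eta_fun Phi_n Psi_n) (at (S.alpha l))) *v eta \<phi> \<psi> (z i) (S.alpha l))"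
proof -
  let ?x = "eta \<phi> \<psi> (z i) (S.alpha l)"
  let ?Ji = "matrix_inv J_hat" and ?Z = "matrix_inv Z1_hat"
  have x: "theta_of ?x = \<phi> (z i) (th l) l" "lambda_of ?x = transpose D_hat *v gradient (\<psi> (z i)) (th l)"
    "deriv_of ?x = eta3 \<phi> (z i) (th l) l (jacobian th (at l))"
    by (simp_all add: eta_def eta2_def D_hat_eq)
  have Wu: "W_hat *v u = (\<chi> j. b_hat \<bullet> (?Ji *v (Wj_hat j *v u)))" for u
  proof -
    have "(W_hat *v u) $ j = ((b_hat v* ?Ji) v* Wj_hat j) \<bullet> u" for j
      by (simp add: W_hat_def matrix_vector_mult_def inner_vec_def)
    then show ?thesis by (simp add: vec_eq_iff dot_lmul_matrix)
  qed
  \<comment> \<open>Stacking by columns lets the j-th diagonal block of \<open>M_hat\<close> act on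
    the j-th column of \<open>X\<close>, the shape in which the D-equations were solved.\<close>
  have Ms: "M_hat *v stack_columns X = (\<chi> j. b_hat \<bullet> (?Ji *v column j X))" for X :: "real^'q^'p"
  proof -
    have "(M_hat *v stack_columns X) $ j = (b_hat v* ?Ji) \<bullet> column j X" for j
    proof -
      have "(M_hat *v stack_columns X) $ j = (\<Sum>m\<in>(UNIV :: 'q set) \<times> UNIV. (if fst m = j then (b_hat v* ?Ji) $ snd m else 0) * X $ snd m $ fst m)"
        by (simp add: M_hat_def matrix_vector_mult_def stack_columns_def)
      also have "\<dots> = (\<Sum>k\<in>UNIV. \<Sum>i\<in>UNIV. (if k = j then (b_hat v* ?Ji) $ i else 0) * X $ i $ k)"
        by (simp add: sum.cartesian_product case_prod_unfold)
      also have "\<dots> = (\<Sum>k\<in>UNIV. if k = j then (\<Sum>i\<in>UNIV. (b_hat v* ?Ji) $ i * X $ i $ k) else 0)"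
        by (intro sum.cong) auto
      also have "\<dots> = (b_hat v* ?Ji) \<bullet> column j X"
        by (simp add: inner_vec_def column_def)
      finally show ?thesis .
    qed
    then show ?thesis by (simp add: vec_eq_iff dot_lmul_matrix)
  qed
  define u where "u = ?Ji *v \<phi> (z i) (th l) l"
  have "v_hat i = u - D_hat *v (?Z *v (transpose D_hat *v (Z2_hat *v u) + W_hat *v u)) -
      D_hat *v (?Z *v (transpose D_hat *v gradient (\<psi> (z i)) (th l))) -
      D_hat *v (?Z *v (M_hat *v stack_columns (eta3 \<phi> (z i) (th l) l (jacobian th (at l)))))"
    by (simp only: v_hat_def A1_hat_def A2_hat_def A3_hat_def u_def matrix_vector_mult_diff_rdistrib
        matrix_vector_mult_uminus matrix_vector_mul_assoc[symmetric] matrix_vector_mult_add_rdistrib)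
       simp
  also have "\<dots> = u - D_hat *v (?Z *v (transpose D_hat *v gradient (\<psi> (z i)) (th l) + transpose D_hat *v (Z2_hat *v u) +
      (W_hat *v u + M_hat *v stack_columns (eta3 \<phi> (z i) (th l) l (jacobian th (at l))))))"
    by (simp only: matrix_vector_right_distrib) simp
  also have "W_hat *v u + M_hat *v stack_columns (eta3 \<phi> (z i) (th l) l (jacobian th (at l))) =
      (\<chi> j. b_hat \<bullet> (?Ji *v (column j (deriv_of ?x) + Wj_hat j *v u)))"
    unfolding Wu Ms x by (simp add: vec_eq_iff matrix_vector_right_distrib inner_add_right)
  also have "u - D_hat *v (?Z *v (transpose D_hat *v gradient (\<psi> (z i)) (th l) + transpose D_hat *v (Z2_hat *v u) + \<dots>)) =
      - theta_of (matrix_inv (jacobian (eta_fun Phi_n Psi_n) (at (S.alpha l))) *v ?x)"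
    unfolding S.solve_first_block(2)[OF l inv] minus_minus
    by (simp only: J_hat_def[symmetric] D_hat_eq[symmetric] Z1_hat_eq[symmetric] Wj_hat_eq[symmetric]
        b_hat_def[symmetric] Z2_hat_def[symmetric] x u_def[symmetric])
  finally show ?thesis .
qed

text \<open>The summands are images of eta under one matrix up to sign, and the sign disappears in
  the outer product.\<close>

lemma V1_hat_eq:
  fixes P :: "real^('p + ('q + ('q \<times> 'p)))^'p"
  assumes P: "\<And>x. P *v x = theta_of x"
  defines "R \<equiv> P ** matrix_inv (jacobian (eta_fun Phi_n Psi_n) (at (S.alpha l)))"
  shows "V1_hat = R ** ((1 / real n) *\<^sub>R (\<Sum>i<n. outer (eta \<phi> \<psi> (z i) (S.alpha l)) (eta \<phi> \<psi> (z i) (S.alpha l)))) ** transpose R"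
proof -
  have "v_hat i = - (R *v eta \<phi> \<psi> (z i) (S.alpha l))" for i
    unfolding v_hat_eq R_def by (simp add: matrix_vector_mul_assoc[symmetric] P)
  then have "outer (v_hat i) (v_hat i) = R ** outer (eta \<phi> \<psi> (z i) (S.alpha l)) (eta \<phi> \<psi> (z i) (S.alpha l)) ** transpose R" for i
    unfolding outer_matrix_mult[symmetric] by (simp add: outer_def)
  then have V: "V1_hat = (1 / real n) *\<^sub>R (\<Sum>i<n. R ** outer (eta \<phi> \<psi> (z i) (S.alpha l)) (eta \<phi> \<psi> (z i) (S.alpha l)) ** transpose R)"
    by (simp add: V1_hat_def)
  show ?thesis unfolding V linear_scale[OF linear_sandwich] linear_sum[OF linear_sandwich] ..
qed

end

end

theorem theorem4:
  fixes M :: "'w measure"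
    and F :: "(real^'d) measure"
    and Z :: "nat \<Rightarrow> 'w \<Rightarrow> real^'d"
    and \<phi> :: "real^'d \<Rightarrow> real^'p \<Rightarrow> real^'q \<Rightarrow> real^'p"
    and \<psi> :: "real^'d \<Rightarrow> real^'p \<Rightarrow> real"
    and L :: "(real^'q) set"
    and \<theta>hat :: "nat \<Rightarrow> 'w \<Rightarrow> real^'q \<Rightarrow> real^'p"
    and lhat :: "nat \<Rightarrow> 'w \<Rightarrow> real^'q"
    and \<theta> :: "real^'q \<Rightarrow> real^'p"
    and l0 :: "real^'q"
  defines "TE \<equiv> \<lambda>n \<omega>. sample.TE \<psi> n (\<lambda>i. Z i \<omega>) (\<theta>hat n \<omega>)"
    and "\<alpha>0 \<equiv> stack (\<theta> l0) l0 (jacobian \<theta> (at l0))"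
  \<comment> \<open>i.i.d. sample\<close>
  assumes prob: "prob_space M"
    and indep: "prob_space.indep_vars M (\<lambda>_. borel) Z UNIV"
    and distr: "\<And>i. distr M borel (Z i) = F"
  \<comment> \<open>measurability and existence of derivatives, for \<open>\<lambda>\<close> in an open set containing the unit interval\<close>
    and L: "open L" "cbox 0 1 \<subseteq> L"
    and meas_\<phi>: "\<And>t l. l \<in> L \<Longrightarrow> (\<lambda>z. \<phi> z t l) \<in> borel_measurable borel"
    and meas_\<psi>: "\<And>t. (\<lambda>z. \<psi> z t) \<in> borel_measurable borel"
    and diff_\<phi>: "\<And>z j. times_differentiable_on 3 (\<lambda>(t, l). \<phi> z t l $ j) (UNIV \<times> L)"
    and diff_\<psi>: "\<And>z. times_differentiable_on 3 (\<psi> z) UNIV"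
    and diff_\<theta>: "\<And>j. times_differentiable_on 3 (\<lambda>l. \<theta> l $ j) L"
    and diff_\<theta>hat: "\<forall>\<^sub>F n in sequentially. AE \<omega> in M. \<forall>l\<in>L. \<theta>hat n \<omega> differentiable (at l)"
  \<comment> \<open>\<open>\<theta>hat\<close>, \<open>\<theta>\<close> solve the sample and population equations; \<open>lhat\<close> minimises \<open>TE\<close>\<close>
    and \<theta>hat: "\<forall>\<^sub>F n in sequentially. AE \<omega> in M.
               \<forall>l\<in>L. \<forall>t. sample.Phi_n \<phi> n (\<lambda>i. Z i \<omega>) t l = 0 \<longleftrightarrow> t = \<theta>hat n \<omega> l"
    and \<theta>: "\<And>l t. l \<in> L \<Longrightarrow> has_bochner_integral F (\<lambda>z. \<phi> z t l) 0 \<longleftrightarrow> t = \<theta> l"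
    and meas_lhat: "\<And>n. lhat n \<in> borel_measurable M"
    and meas_\<theta>hat: "\<And>n. (\<lambda>\<omega>. \<theta>hat n \<omega> (lhat n \<omega>)) \<in> borel_measurable M"
    and lhat: "\<And>n \<omega>. \<omega> \<in> space M \<Longrightarrow> lhat n \<omega> \<in> cbox 0 1"
            "\<forall>\<^sub>F n in sequentially. AE \<omega> in M. \<forall>l\<in>cbox 0 1. TE n \<omega> (lhat n \<omega>) \<le> TE n \<omega> l"
  \<comment> \<open>unique solutions and regularity of the stacked estimating function\<close>
    and unique_TE: "unique_op_root_n_solution M L (\<lambda>n \<omega>. gradient (TE n \<omega>))"
    and l0: "l0 \<in> L"
    and unique_\<alpha>0: "\<And>a. lambda_of a \<in> L \<Longrightarrow>
                      has_bochner_integral F (\<lambda>z. eta \<phi> \<psi> z a) 0 \<longleftrightarrow> a = \<alpha>0"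
    and regular: "regular_estimating_function F (eta \<phi> \<psi>) \<alpha>0"
  \<comment> \<open>bounds for the partial derivatives of the quantities entering the plug-in estimates\<close>
    and bounded: "plug_in_partials_bounded \<phi> \<psi> \<theta> \<alpha>0"
  shows
    "(with_prob_to_one M (\<lambda>n \<omega>. lhat n \<omega> \<in> interior (cbox 0 1)) \<longrightarrow>
        (\<exists>V. asymptotically_normal M
               (\<lambda>n \<omega>. sqrt (real n) *\<^sub>R (\<theta>hat n \<omega> (lhat n \<omega>) - \<theta> l0)) V \<and>
             tendsto_in_prob M
               (\<lambda>n \<omega>. sample.V1_hat \<phi> \<psi> n (\<lambda>i. Z i \<omega>) (\<theta>hat n \<omega>) (lhat n \<omega>)) V)) \<and>
     (\<forall>e\<in>{0, 1}. \<forall>\<theta>0.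
        with_prob_to_one M (\<lambda>n \<omega>. lhat n \<omega> = e \<and> gradient (TE n \<omega>) e \<noteq> 0) \<and>
        tendsto_in_prob M (\<lambda>n \<omega>. \<theta>hat n \<omega> e) \<theta>0 \<and>
        regular_estimating_function F (\<lambda>z t. \<phi> z t e) \<theta>0 \<longrightarrow>
        (\<exists>V. asymptotically_normal M
               (\<lambda>n \<omega>. sqrt (real n) *\<^sub>R (\<theta>hat n \<omega> (lhat n \<omega>) - \<theta>0)) V \<and>
             tendsto_in_prob M
               (\<lambda>n \<omega>. sample.V2_hat \<phi> n (\<lambda>i. Z i \<omega>) (\<theta>hat n \<omega>) (lhat n \<omega>)) V))"
proof -
  have sets_F [measurable_cong]: "sets F = sets borel" using distr[of 0] by (metis sets_distr)
  interpret iid_sample M F Z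
  proof (intro iid_sample.intro iid_sample_axioms.intro prob)
    show "prob_space.indep_vars M (\<lambda>_. F) Z UNIV"
      using indep sets_F measurable_cong_sets[OF refl sets_F, of M] by (simp add: prob_space.indep_vars_def[OF prob])
    show "distr M F (Z i) = F" for i
      using distr[of i] distr_cong[OF refl sets_F, of M "Z i" "Z i"] by simp
  qed
  have borel_F: "f \<in> borel_measurable F" if "f \<in> borel_measurable borel"
    for f :: "real^'d \<Rightarrow> 'v::topological_space"
    using that measurable_cong_sets[OF sets_F refl, of borel] by simp
  have smooth: "smooth_model (\<phi> y) (\<psi> y) L" for y
    by standard (auto intro: L C2_on_if_times_differentiable diff_\<phi> diff_\<psi>)
  \<comment> \<open>The event on which the sample equations are uniquely solvable over all of
    \<open>L\<close> with differentiable solution; there all deterministic results apply.\<close>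
  define good where "good n \<omega> \<longleftrightarrow>
      (\<forall>l\<in>L. \<forall>t. sample.Phi_n \<phi> n (\<lambda>i. Z i \<omega>) t l = 0 \<longleftrightarrow> t = \<theta>hat n \<omega> l) \<and>
      (\<forall>l\<in>L. \<theta>hat n \<omega> differentiable (at l))" for n \<omega>
  have wp_good: "with_prob_to_one M good"
    unfolding good_def[abs_def]
    by (rule with_prob_to_one_conj[OF with_prob_to_one_AE[OF \<theta>hat] with_prob_to_one_AE[OF diff_\<theta>hat]])
  have solved: "solved_sample \<phi> \<psi> n (\<lambda>i. Z i \<omega>) (\<theta>hat n \<omega>) L" if "good n \<omega>" for n \<omega>
    by (rule solved_sample.intro[OF smooth]) (use that in \<open>auto simp: good_def\<close>)
  have lhat_L: "lhat n \<omega> \<in> L" if "\<omega> \<in> space M" for n \<omega>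
    using lhat(1)[OF that] L(2) by blast
  have interior_case: "\<exists>V. asymptotically_normal M
               (\<lambda>n \<omega>. sqrt (real n) *\<^sub>R (\<theta>hat n \<omega> (lhat n \<omega>) - \<theta> l0)) V \<and>
             tendsto_in_prob M
               (\<lambda>n \<omega>. sample.V1_hat \<phi> \<psi> n (\<lambda>i. Z i \<omega>) (\<theta>hat n \<omega>) (lhat n \<omega>)) V"
    if inter: "with_prob_to_one M (\<lambda>n \<omega>. lhat n \<omega> \<in> interior (cbox 0 1))"
  proof -
    let ?h = "eta \<phi> \<psi>" and ?Phi = "\<lambda>n \<omega>. sample.Phi_n \<phi> n (\<lambda>i. Z i \<omega>)" and ?Psi = "\<lambda>n \<omega>. sample.Psi_n \<psi> n (\<lambda>i. Z i \<omega>)"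
    define dom where "dom = {a :: ('p, 'q) stacked. lambda_of a \<in> L}"
    have dom_eq: "smooth_model.dom L = dom" by (simp add: dom_def smooth_model.dom_def[OF smooth])
    have open_dom: "open dom" using smooth_model.open_dom[OF smooth] unfolding dom_eq .
    have \<alpha>0_of: "theta_of \<alpha>0 = \<theta> l0" "lambda_of \<alpha>0 = l0" "deriv_of \<alpha>0 = jacobian \<theta> (at l0)"
      by (simp_all add: \<alpha>0_def)
    have \<alpha>0_dom: "\<alpha>0 \<in> dom" using l0 by (simp add: dom_def \<alpha>0_of)
    from regular obtain U1 U2 m0 m1 where reg:
      "\<alpha>0 \<in> U1" "\<forall>a\<in>U1. (\<lambda>a. \<integral>z. ?h z a \<partial>F) differentiable (at a)"
      "invertible (jacobian (\<lambda>a. \<integral>z. ?h z a \<partial>F) (at \<alpha>0))"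
      "open U2" "\<alpha>0 \<in> U2" "m0 \<in> borel_measurable F" "m1 \<in> borel_measurable F"
      "integrable F (\<lambda>z. (m0 z)\<^sup>2)" "integrable F (\<lambda>z. (m1 z)\<^sup>2)"
      "\<forall>z. \<forall>a\<in>U2. norm (?h z a) \<le> m0 z \<and> ?h z differentiable (at a) \<and> (\<forall>r. norm (partial r (?h z) a) \<le> m1 z)"
      unfolding regular_estimating_function_def Let_def by (elim conjE exE) (rule that)
    define U where "U = U2 \<inter> dom"
    have U_dom: "U \<subseteq> dom" by (simp add: U_def)
    interpret E: z_estimation M F Z ?h \<alpha>0 U m0 m1
    proof
      show "open U" "\<alpha>0 \<in> U" using reg(4,5) open_dom \<alpha>0_dom by (auto simp: U_def)
      show "(\<lambda>z. ?h z a) \<in> borel_measurable F" if "a \<in> U" for a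
        using that by (intro eta_measurable[OF smooth] borel_F meas_\<phi> meas_\<psi>) (auto simp: U_def dom_def)
      show "C1_on (?h z) U" for z
        using smooth_model.eta_fun_C1[OF smooth, of z] U_dom unfolding eta_eq_eta_fun dom_eq by (rule C1_on_subset)
    qed (use reg in \<open>auto simp: U_def\<close>)
    have zero: "(\<integral>z. ?h z \<alpha>0 \<partial>F) = 0"
      using unique_\<alpha>0[of \<alpha>0] l0 has_bochner_integral_integral_eq by (auto simp: \<alpha>0_of)
    have TE_eq: "TE n \<omega> = (\<lambda>s. ?Psi n \<omega> (\<theta>hat n \<omega> s))" for n \<omega>
      by (simp add: TE_def sample.TE_def sample.Psi_n_def fun_eq_iff)
    \<comment> \<open>One side averages derivatives, the other differentiates averages; they agree
      where \<lambda> lies in \<open>L\<close>. As \<open>dom\<close> is open, their Jacobians agree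
      on \<open>U\<close> too.\<close>
    have fn_eq: "E.f_n n \<omega> a = eta_fun (?Phi n \<omega>) (?Psi n \<omega>) a" if "good n \<omega>" "a \<in> dom" for n \<omega> a
      using solved_sample.eta_fun_average[OF solved[OF that(1)], of a] that(2)
      by (simp add: E.f_n_def avg_def dom_def)
    have solved_model: "solved_model (?Phi n \<omega>) (?Psi n \<omega>) L (\<theta>hat n \<omega>)" if "good n \<omega>" for n \<omega>
    proof -
      interpret SS: solved_sample \<phi> \<psi> n "\<lambda>i. Z i \<omega>" "\<theta>hat n \<omega>" l0 L by (rule solved[OF that])
      show ?thesis by (rule SS.S.solved_model_axioms)
    qed
    have eta_deriv: "(eta_fun (?Phi n \<omega>) (?Psi n \<omega>) has_derivative (\<lambda>v. jacobian (E.f_n n \<omega>) (at a) *v v)) (at a)"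
      if "good n \<omega>" "a \<in> U" for n \<omega> a
    proof (rule has_derivative_transform_within_open[OF _ open_dom])
      show "(E.f_n n \<omega> has_derivative (\<lambda>v. jacobian (E.f_n n \<omega>) (at a) *v v)) (at a)"
        using E.f_n_differentiable[OF that(2)] by (simp add: jacobian_works)
    qed (use that U_dom fn_eq in auto)
    have jac_eq: "jacobian (eta_fun (?Phi n \<omega>) (?Psi n \<omega>)) (at a) = jacobian (E.f_n n \<omega>) (at a)"
      if "good n \<omega>" "a \<in> U" for n \<omega> a
      by (rule has_derivative_jacobian_eq[OF eta_deriv[OF that]])
    have dc_eq: "deriv_close (eta_fun (?Phi n \<omega>) (?Psi n \<omega>)) E.B \<epsilon> S"
      if "good n \<omega>" "S \<subseteq> U" "deriv_close (E.f_n n \<omega>) E.B \<epsilon> S" for n \<omega> \<epsilon> S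
      unfolding deriv_close_def
    proof (intro ballI conjI allI)
      fix a x assume a: "a \<in> S"
      then have aU: "a \<in> U" using that(2) by blast
      show "eta_fun (?Phi n \<omega>) (?Psi n \<omega>) differentiable (at a)"
        using eta_deriv[OF that(1) aU] differentiable_def by blast
      show "norm ((jacobian (eta_fun (?Phi n \<omega>) (?Psi n \<omega>)) (at a) - E.B) *v x) \<le> \<epsilon> * norm x"
        using that(3) a unfolding jac_eq[OF that(1) aU] deriv_close_def by blast
    qed
    define alpha where "alpha n \<omega> s = stack (\<theta>hat n \<omega> s) s (jacobian (\<theta>hat n \<omega>) (at s))" for n \<omega> s
    have alpha_eq: "solved_model.alpha (\<theta>hat n \<omega>) s = alpha n \<omega> s" if "good n \<omega>" for n \<omega> s
      by (simp add: alpha_def solved_model.alpha_def[OF solved_model[OF that]])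
    have eta_alpha: "eta_fun (?Phi n \<omega>) (?Psi n \<omega>) (alpha n \<omega> s) = stack 0 (gradient (TE n \<omega>) s) 0"
      if "good n \<omega>" "s \<in> L" for n \<omega> s
      using solved_model.eta_fun_alpha[OF solved_model[OF that(1)] that(2)] unfolding alpha_eq[OF that(1)] TE_eq .

    \<comment> \<open>The block structure of the population Jacobian is inherited from each data
      point, since \<open>B\<close> is the mean of the individual Jacobians.\<close>
    have B_theta: "theta_of (E.B *v x) $ i = (\<integral>z. (jacobian (\<lambda>s. \<phi> z s l0) (at (\<theta> l0)) *v theta_of x +
        jacobian (\<lambda>m. \<phi> z (\<theta> l0) m) (at l0) *v lambda_of x) $ i \<partial>F)" for x i
    proof -
      have "(jacobian (?h z) (at \<alpha>0) *v x) $ Inl i = (jacobian (\<lambda>s. \<phi> z s l0) (at (\<theta> l0)) *v theta_of x +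
          jacobian (\<lambda>m. \<phi> z (\<theta> l0) m) (at l0) *v lambda_of x) $ i" for z
        using arg_cong[OF smooth_model.eta_fun_jacobian_theta[OF smooth, of \<alpha>0 z x], of "\<lambda>u. u $ i"] \<alpha>0_dom
        unfolding dom_eq eta_eq_eta_fun \<alpha>0_of by (simp only: stacked_of_nth)
      then show ?thesis unfolding stacked_of_nth E.B_mult_nth by (simp only:)
    qed
    have b1: "theta_of (E.B *v stack 0 0 X) = 0" for X
      unfolding vec_eq_iff B_theta by simp
    have b2: "column j (deriv_of (E.B *v stack 0 0 X)) = theta_of (E.B *v stack (column j X) 0 0)" for j X
      unfolding vec_eq_iff B_theta
    proof
      fix i
      have "(jacobian (?h z) (at \<alpha>0) *v stack 0 0 X) $ Inr (Inr (j, i)) =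
          (jacobian (\<lambda>s. \<phi> z s l0) (at (\<theta> l0)) *v column j X) $ i" for z
        using arg_cong[OF smooth_model.eta_fun_jacobian_deriv[OF smooth, of \<alpha>0 "stack 0 0 X" j z], of "\<lambda>u. u $ i"] \<alpha>0_dom
        unfolding dom_eq eta_eq_eta_fun \<alpha>0_of by (simp add: column_def)
      then show "column j (deriv_of (E.B *v stack 0 0 X)) $ i =
          (\<integral>z. (jacobian (\<lambda>s. \<phi> z s l0) (at (\<theta> l0)) *v theta_of (stack (column j X) 0 0 :: ('p, 'q) stacked) +
        jacobian (\<lambda>m. \<phi> z (\<theta> l0) m) (at l0) *v lambda_of (stack (column j X) 0 0 :: ('p, 'q) stacked)) $ i \<partial>F)"
        by (simp add: column_def E.B_mult_nth)
    qed
    \<comment> \<open>The integrand is a combination of entries of the third block of eta at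
      \<open>\<alpha>0\<close>, all of which have mean zero.\<close>
    have b3: "theta_of (E.B *v stack (jacobian \<theta> (at l0) *v v) v 0) = 0" for v
      unfolding vec_eq_iff B_theta
    proof
      fix i
      have c: "integrable F (\<lambda>z. ?h z \<alpha>0 $ r)" "(\<integral>z. ?h z \<alpha>0 $ r \<partial>F) = 0" for r
        using integrable_bounded_linear[OF bounded_linear_vec_nth E.h_integrable[OF E.U(2)], of r]
          integral_bounded_linear[OF bounded_linear_vec_nth E.h_integrable[OF E.U(2)], of r] zero by simp_all
      have "(jacobian (\<lambda>s. \<phi> z s l0) (at (\<theta> l0)) *v (jacobian \<theta> (at l0) *v v) + jacobian (\<lambda>m. \<phi> z (\<theta> l0) m) (at l0) *v v) $ i =
          (\<Sum>k\<in>UNIV. ?h z \<alpha>0 $ Inr (Inr (k, i)) * v $ k)" for z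
      proof -
        have "(deriv_of (?h z \<alpha>0) *v v) $ i = (\<Sum>k\<in>UNIV. ?h z \<alpha>0 $ Inr (Inr (k, i)) * v $ k)"
          by (simp add: matrix_vector_mult_def)
        moreover have "deriv_of (?h z \<alpha>0) = jacobian (\<lambda>s. \<phi> z s l0) (at (\<theta> l0)) ** jacobian \<theta> (at l0) + jacobian (\<lambda>m. \<phi> z (\<theta> l0) m) (at l0)"
          unfolding eta_eq_eta_fun eta_fun_def \<alpha>0_of by simp
        ultimately show ?thesis
          by (simp add: matrix_vector_mult_add_rdistrib matrix_vector_mul_assoc)
      qed
      then show "(\<integral>z. (jacobian (\<lambda>s. \<phi> z s l0) (at (\<theta> l0)) *v theta_of (stack (jacobian \<theta> (at l0) *v v) v 0 :: ('p, 'q) stacked) +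
        jacobian (\<lambda>m. \<phi> z (\<theta> l0) m) (at l0) *v lambda_of (stack (jacobian \<theta> (at l0) *v v) v 0 :: ('p, 'q) stacked)) $ i \<partial>F) = 0 $ i"
        by (simp add: c Bochner_Integration.integral_sum)
    qed
    obtain B2 where B2: "invertible B2" "\<And>x. B2 *v x = stack (theta_of (E.B *v x)) (lambda_of x) (deriv_of (E.B *v x))"
      by (rule reduced_jacobian_invertible[OF E.B_invertible b1 b2 b3]) blast
    obtain K where K: "K > 0" "\<And>x. norm x \<le> K * norm (E.B *v x)"
      by (rule invertible_lower_bound[OF E.B_invertible]) blast
    obtain K2 where K2: "K2 > 0" "\<And>x. norm x \<le> K2 * norm (B2 *v x)"
      by (rule invertible_lower_bound[OF B2(1)]) blast
    \<comment> \<open>One tolerance for two purposes: with \<open>K\<close> it keeps the sample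
      Jacobians near \<open>\<alpha>0\<close> invertible, with \<open>K2\<close> it solves the
      system with prescribed \<lambda>.\<close>
    define \<epsilon> where "\<epsilon> = min (1 / (2 * K)) (1 / (2 * K2))"
    have \<epsilon>: "\<epsilon> > 0" "K * \<epsilon> \<le> 1/2" "K2 * \<epsilon> \<le> 1/2"
    proof -
      show "\<epsilon> > 0" using K K2 by (simp add: \<epsilon>_def)
      have "K * \<epsilon> \<le> K * (1 / (2 * K))" "K2 * \<epsilon> \<le> K2 * (1 / (2 * K2))"
        using K K2 by (intro mult_left_mono; simp add: \<epsilon>_def)+
      then show "K * \<epsilon> \<le> 1/2" "K2 * \<epsilon> \<le> 1/2" using K(1) K2(1) by simp_all
    qed
    obtain \<delta> where \<delta>: "\<delta> > 0" "cball \<alpha>0 \<delta> \<subseteq> U" "with_prob_to_one M (\<lambda>n \<omega>. deriv_close (E.f_n n \<omega>) E.B \<epsilon> (cball \<alpha>0 \<delta>))"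
      by (rule E.deriv_close_B[OF \<epsilon>(1)])

    have lhat_root: "op_root_n_solution M L (\<lambda>n \<omega>. gradient (TE n \<omega>)) s"
      if "\<And>n. s n \<in> borel_measurable M" "\<And>n \<omega>. \<omega> \<in> space M \<Longrightarrow> s n \<omega> \<in> L"
        and g: "with_prob_to_one M (\<lambda>n \<omega>. gradient (TE n \<omega>) (s n \<omega>) = 0)" for s
      unfolding op_root_n_solution_def
    proof (intro conjI allI ballI)
      show "tendsto_in_prob M (\<lambda>n \<omega>. sqrt (real n) *\<^sub>R gradient (TE n \<omega>) (s n \<omega>)) 0"
        by (rule tendsto_in_prob_cong[OF tendsto_in_prob_const with_prob_to_one_mono[OF g]]) simp
    qed (use that in auto)

    \<comment> \<open>Taking \<open>dom\<close> as the neighbourhood keeps the \<lambda>-component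
      in \<open>L\<close> for every \<omega>, as a competitor in the uniqueness hypothesis must
      be.\<close>
    obtain s where s: "\<And>n. s n \<in> borel_measurable M" "\<And>n \<omega>. s n \<omega> \<in> dom"
      "with_prob_to_one M (\<lambda>n \<omega>. E.f_n n \<omega> (s n \<omega>) = 0)" "tendsto_in_prob M s \<alpha>0"
      by (rule E.measurable_consistent_root[OF zero open_dom \<alpha>0_dom]) blast
    have "op_root_n_solution M L (\<lambda>n \<omega>. gradient (TE n \<omega>)) (\<lambda>n \<omega>. lambda_of (s n \<omega>))"
    proof (rule lhat_root)
      show "(\<lambda>\<omega>. lambda_of (s n \<omega>)) \<in> borel_measurable M" for n
        by (rule borel_measurable_continuous_on[OF linear_continuous_on[OF bounded_linear_lambda_of] s(1)])
      show "lambda_of (s n \<omega>) \<in> L" for n \<omega> using s(2) by (auto simp: dom_def)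
      show "with_prob_to_one M (\<lambda>n \<omega>. gradient (TE n \<omega>) (lambda_of (s n \<omega>)) = 0)"
      proof (rule with_prob_to_one_mono[OF with_prob_to_one_conj[OF with_prob_to_one_conj[OF wp_good s(3)]
            with_prob_to_one_conj[OF \<delta>(3) tendsto_in_probD[OF s(4) \<delta>(1)]]]])
        fix n \<omega>
        let ?a = "s n \<omega>" and ?f = "eta_fun (?Phi n \<omega>) (?Psi n \<omega>)"
        assume *: "(good n \<omega> \<and> E.f_n n \<omega> ?a = 0) \<and> deriv_close (E.f_n n \<omega>) E.B \<epsilon> (cball \<alpha>0 \<delta>) \<and> dist ?a \<alpha>0 < \<delta>"
        then have good: "good n \<omega>" and a: "?a \<in> cball \<alpha>0 \<delta>" by (auto simp: dist_commute)
        interpret SM: solved_model "?Phi n \<omega>" "?Psi n \<omega>" L "\<theta>hat n \<omega>" by (rule solved_model[OF good])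
        have ad: "?a \<in> SM.dom" using s(2) by (simp add: dom_eq)
        have f0: "?f ?a = 0" using * fn_eq[OF good s(2)] by simp
        have "invertible (jacobian ?f (at ?a))"
          using * by (intro deriv_close_invertible(2)[OF dc_eq[OF good \<delta>(2)] a K \<epsilon>(2)]) blast
        \<comment> \<open>A zero of all three blocks lies on the solution curve, where the middle
          block is the gradient of \<open>TE\<close>.\<close>
        then have "?a = SM.alpha (lambda_of ?a)"
          using SM.root_eq_alpha[OF ad _ _ SM.invertible_A[OF ad]] f0 by simp
        then have "?f ?a = stack 0 (gradient (TE n \<omega>) (lambda_of ?a)) 0"
          using eta_alpha[OF good, of "lambda_of ?a"] ad alpha_eq[OF good] by (simp add: dom_eq dom_def)
        then show "gradient (TE n \<omega>) (lambda_of ?a) = 0" unfolding f0 by (metis stack_components(2) stacked_zero(2))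
      qed
    qed
    moreover have grad_lhat: "with_prob_to_one M (\<lambda>n \<omega>. gradient (TE n \<omega>) (lhat n \<omega>) = 0)"
    proof (rule with_prob_to_one_mono[OF with_prob_to_one_conj[OF with_prob_to_one_conj[OF wp_good inter] with_prob_to_one_AE[OF lhat(2)]]])
      fix n \<omega>
      assume \<omega>: "\<omega> \<in> space M" and *: "(good n \<omega> \<and> lhat n \<omega> \<in> interior (cbox 0 1)) \<and> (\<forall>l\<in>cbox 0 1. TE n \<omega> (lhat n \<omega>) \<le> TE n \<omega> l)"
      then have good: "good n \<omega>" by blast
      interpret SM: solved_model "?Phi n \<omega>" "?Psi n \<omega>" L "\<theta>hat n \<omega>" by (rule solved_model[OF good])
      note d = SM.criterion_derivative[OF lhat_L[OF \<omega>], of n]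
      have "(\<lambda>v. (transpose (jacobian (\<theta>hat n \<omega>) (at (lhat n \<omega>))) *v gradient (?Psi n \<omega>) (\<theta>hat n \<omega> (lhat n \<omega>))) \<bullet> v) = (\<lambda>v. 0)"
      proof (rule differential_zero_maxmin[OF _ open_interior d])
        show "lhat n \<omega> \<in> interior (cbox 0 1)" using * by blast
        have "?Psi n \<omega> (\<theta>hat n \<omega> (lhat n \<omega>)) \<le> ?Psi n \<omega> (\<theta>hat n \<omega> y)" if "y \<in> interior (cbox 0 1)" for y
          using * that interior_subset[of "cbox 0 1"] unfolding TE_eq by blast
        then show "(\<forall>y\<in>interior (cbox 0 1). ?Psi n \<omega> (\<theta>hat n \<omega> y) \<le> ?Psi n \<omega> (\<theta>hat n \<omega> (lhat n \<omega>))) \<or>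
            (\<forall>y\<in>interior (cbox 0 1). ?Psi n \<omega> (\<theta>hat n \<omega> (lhat n \<omega>)) \<le> ?Psi n \<omega> (\<theta>hat n \<omega> y))" by blast
      qed
      then have "gradient (TE n \<omega>) (lhat n \<omega>) \<bullet> v = 0" for v
        unfolding TE_eq SM.gradient_criterion[OF lhat_L[OF \<omega>]] by (rule fun_cong)
      then show "gradient (TE n \<omega>) (lhat n \<omega>) = 0" by (metis inner_eq_zero_iff)
    qed
    then have "op_root_n_solution M L (\<lambda>n \<omega>. gradient (TE n \<omega>)) lhat"
      by (intro lhat_root meas_lhat lhat_L)
    ultimately have diff: "tendsto_in_prob M (\<lambda>n \<omega>. lhat n \<omega> - lambda_of (s n \<omega>)) 0"
      using unique_TE unfolding unique_op_root_n_solution_def by blast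
    have lhat_cons: "tendsto_in_prob M lhat l0"
    proof -
      have "isCont (\<lambda>p. fst p + lambda_of (snd p)) ((0 :: real^'q), \<alpha>0)"
        by (intro continuous_add continuous_fst continuous_ident
            continuous_at_compose[OF continuous_snd[OF continuous_ident] linear_continuous_at[OF bounded_linear_lambda_of], unfolded o_def])
      from tendsto_in_prob_isCont[OF tendsto_in_prob_Pair[OF diff s(4)] this] show ?thesis by (simp add: \<alpha>0_of)
    qed

    define ah where "ah n \<omega> = alpha n \<omega> (lhat n \<omega>)" for n \<omega>
    have ah_root: "with_prob_to_one M (\<lambda>n \<omega>. E.f_n n \<omega> (ah n \<omega>) = 0)"
    proof (rule with_prob_to_one_mono[OF with_prob_to_one_conj[OF wp_good grad_lhat]])
      fix n \<omega> assume \<omega>: "\<omega> \<in> space M" and *: "good n \<omega> \<and> gradient (TE n \<omega>) (lhat n \<omega>) = 0"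
      have "ah n \<omega> \<in> dom" using lhat_L[OF \<omega>] by (simp add: ah_def alpha_def dom_def)
      then show "E.f_n n \<omega> (ah n \<omega>) = 0"
        using fn_eq[of n \<omega> "ah n \<omega>"] eta_alpha[of n \<omega> "lhat n \<omega>"] * lhat_L[OF \<omega>]
        by (simp add: ah_def) (rule stacked_eqI; simp)
    qed
    have ah: "tendsto_in_prob M ah \<alpha>0"
      unfolding tendsto_in_prob_iff
    proof (intro allI impI)
      fix r :: real assume r: "r > 0"
      \<comment> \<open>Two errors below \<open>\<eta>\<close>, each multiplied by
        \<open>2 * K2\<close>, add up to at most half of \<open>min \<delta> r\<close>: this meets
        the smallness condition of \<open>alpha_near\<close> and leaves strict inequality with
        \<open>r\<close>.\<close>
      define \<eta> where "\<eta> = min \<delta> r / (8 * K2)"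
      have \<eta>: "\<eta> > 0" using r \<delta>(1) K2(1) by (simp add: \<eta>_def)
      have \<eta>2: "2 * K2 * (\<eta> + \<eta>) = min \<delta> r / 2" using K2(1) by (simp add: \<eta>_def)
      show "with_prob_to_one M (\<lambda>n \<omega>. dist (ah n \<omega>) \<alpha>0 < r)"
      proof (rule with_prob_to_one_mono[OF with_prob_to_one_conj[OF with_prob_to_one_conj[OF wp_good \<delta>(3)]
            with_prob_to_one_conj[OF tendsto_in_probD[OF E.f_n_tendsto_mean \<eta>] tendsto_in_probD[OF lhat_cons \<eta>]]]])
        fix n \<omega>
        let ?f = "eta_fun (?Phi n \<omega>) (?Psi n \<omega>)"
        assume \<omega>: "\<omega> \<in> space M" and *: "(good n \<omega> \<and> deriv_close (E.f_n n \<omega>) E.B \<epsilon> (cball \<alpha>0 \<delta>)) \<and>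
          dist (E.f_n n \<omega> \<alpha>0) (\<integral>z. ?h z \<alpha>0 \<partial>F) < \<eta> \<and> dist (lhat n \<omega>) l0 < \<eta>"
        then have good: "good n \<omega>" and dc: "deriv_close ?f E.B \<epsilon> (cball \<alpha>0 \<delta>)"
          using dc_eq[OF _ \<delta>(2)] by blast+
        interpret SM: solved_model "?Phi n \<omega>" "?Psi n \<omega>" L "\<theta>hat n \<omega>" by (rule solved_model[OF good])
        have "norm (?f \<alpha>0) + norm (lhat n \<omega> - lambda_of \<alpha>0) \<le> \<eta> + \<eta>"
          using * fn_eq[OF good \<alpha>0_dom] by (simp add: zero dist_norm \<alpha>0_of)
        then have b: "2 * K2 * (norm (?f \<alpha>0) + norm (lhat n \<omega> - lambda_of \<alpha>0)) \<le> min \<delta> r / 2"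
          unfolding \<eta>2[symmetric] using K2(1) by (intro mult_left_mono) auto
        have "norm (SM.alpha (lhat n \<omega>) - \<alpha>0) \<le> 2 * K2 * (norm (?f \<alpha>0) + norm (lhat n \<omega> - lambda_of \<alpha>0))"
        proof (rule SM.alpha_near[OF dc less_imp_le[OF \<epsilon>(1)] _ K \<epsilon>(2) B2 K2 \<epsilon>(3)])
          show "cball \<alpha>0 \<delta> \<subseteq> SM.dom" using \<delta>(2) U_dom unfolding dom_eq by blast
          show "2 * K2 * (norm (?f \<alpha>0) + norm (lhat n \<omega> - lambda_of \<alpha>0)) \<le> \<delta>" using b \<delta>(1) r by linarith
        qed
        also have "\<dots> < r" using b \<delta>(1) r by linarith
        finally show "dist (ah n \<omega>) \<alpha>0 < r" by (simp add: ah_def dist_norm alpha_eq[OF good])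
      qed
    qed
    define P where "P = matrix (theta_of :: ('p, 'q) stacked \<Rightarrow> real^'p)"
    have P: "P *v x = theta_of x" for x
      unfolding P_def using fun_cong[OF matrix_vector_mul(3)[OF bounded_linear_theta_of], of x] .
    have P_ah: "sqrt (real n) *\<^sub>R (P *v (ah n \<omega> - \<alpha>0)) = sqrt (real n) *\<^sub>R (\<theta>hat n \<omega> (lhat n \<omega>) - \<theta> l0)" for n \<omega>
    proof -
      have "P *v (ah n \<omega> - \<alpha>0) = P *v ah n \<omega> - P *v \<alpha>0" by (rule matrix_vector_mult_diff_distrib)
      then show ?thesis by (simp add: P ah_def alpha_def \<alpha>0_of)
    qed
    \<comment> \<open>The projection discards the derivative block of \<open>ah\<close>, so
      measurability of \<open>\<theta>hat n \<omega> (lhat n \<omega>)\<close> suffices.\<close>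
    have meas: "(\<lambda>\<omega>. sqrt (real n) *\<^sub>R (P *v (ah n \<omega> - \<alpha>0))) \<in> borel_measurable M" for n
      unfolding P_ah using meas_\<theta>hat[of n] by measurable
    note result = E.asymptotically_normal_estimator[OF ah ah_root meas]
    have "tendsto_in_prob M (\<lambda>n \<omega>. sample.V1_hat \<phi> \<psi> n (\<lambda>i. Z i \<omega>) (\<theta>hat n \<omega>) (lhat n \<omega>))
       ((P ** matrix_inv E.B) ** E.K ** transpose (P ** matrix_inv E.B))"
    proof (rule tendsto_in_prob_cong[OF result(2)],
        rule with_prob_to_one_mono[OF with_prob_to_one_conj[OF with_prob_to_one_conj[OF wp_good
            E.jacobian_plug_in_invertible[OF ah]] tendsto_in_prob_eventually_in[OF ah E.U]]])
      fix n \<omega>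
      assume \<omega>: "\<omega> \<in> space M" and *: "(good n \<omega> \<and> invertible (jacobian (E.f_n n \<omega>) (at (ah n \<omega>)))) \<and> ah n \<omega> \<in> U"
      then have good: "good n \<omega>" by blast
      interpret SS: solved_sample \<phi> \<psi> n "\<lambda>i. Z i \<omega>" "\<theta>hat n \<omega>" "lhat n \<omega>" L by (rule solved[OF good])
      have a: "SS.S.alpha (lhat n \<omega>) = ah n \<omega>" by (simp add: ah_def alpha_eq[OF good])
      have J: "jacobian (eta_fun (?Phi n \<omega>) (?Psi n \<omega>)) (at (ah n \<omega>)) = jacobian (E.f_n n \<omega>) (at (ah n \<omega>))"
        using * by (intro jac_eq) auto
      show "sample.V1_hat \<phi> \<psi> n (\<lambda>i. Z i \<omega>) (\<theta>hat n \<omega>) (lhat n \<omega>) =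
          (P ** matrix_inv (jacobian (E.f_n n \<omega>) (at (ah n \<omega>)))) ** avg (\<lambda>z. outer (?h z (ah n \<omega>)) (?h z (ah n \<omega>))) n \<omega> **
          transpose (P ** matrix_inv (jacobian (E.f_n n \<omega>) (at (ah n \<omega>))))"
        using SS.V1_hat_eq[OF lhat_L[OF \<omega>] _ P] * unfolding a J avg_def by blast
    qed
    with result(1) show ?thesis unfolding P_ah by blast
  qed
  have endpoint_case: "\<exists>V. asymptotically_normal M
               (\<lambda>n \<omega>. sqrt (real n) *\<^sub>R (\<theta>hat n \<omega> (lhat n \<omega>) - \<theta>0)) V \<and>
             tendsto_in_prob M
               (\<lambda>n \<omega>. sample.V2_hat \<phi> n (\<lambda>i. Z i \<omega>) (\<theta>hat n \<omega>) (lhat n \<omega>)) V"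
    if e: "e \<in> {0, 1}" and lhat_e: "with_prob_to_one M (\<lambda>n \<omega>. lhat n \<omega> = e)"
      and cons: "tendsto_in_prob M (\<lambda>n \<omega>. \<theta>hat n \<omega> e) \<theta>0"
      and reg: "regular_estimating_function F (\<lambda>z t. \<phi> z t e) \<theta>0" for e \<theta>0
  proof -
    \<comment> \<open>With \<lambda> frozen at \<open>e\<close> this is an ordinary estimating
      equation in \<theta>: consistency is given, and the choice of \<open>lhat\<close> adds no
      variance.\<close>
    have "e \<in> cbox 0 1" using e by (auto simp: mem_box_cart)
    then have eL: "e \<in> L" using L(2) by blast
    from reg obtain U1 U m0 m1 where reg':
      "\<theta>0 \<in> U1" "\<forall>a\<in>U1. (\<lambda>t. \<integral>z. \<phi> z t e \<partial>F) differentiable (at a)"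
      "invertible (jacobian (\<lambda>t. \<integral>z. \<phi> z t e \<partial>F) (at \<theta>0))"
      "open U" "\<theta>0 \<in> U" "m0 \<in> borel_measurable F" "m1 \<in> borel_measurable F"
      "integrable F (\<lambda>z. (m0 z)\<^sup>2)" "integrable F (\<lambda>z. (m1 z)\<^sup>2)"
      "\<forall>z. \<forall>a\<in>U. norm (\<phi> z a e) \<le> m0 z \<and> (\<lambda>t. \<phi> z t e) differentiable (at a) \<and>
         (\<forall>r. norm (partial r (\<lambda>t. \<phi> z t e) a) \<le> m1 z)"
      unfolding regular_estimating_function_def Let_def by (elim conjE exE) (rule that)
    interpret E: z_estimation M F Z "\<lambda>z t. \<phi> z t e" \<theta>0 U m0 m1
    proof
      show "(\<lambda>z. \<phi> z a e) \<in> borel_measurable F" for a by (rule borel_F[OF meas_\<phi>[OF eL]])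
      show "C1_on (\<lambda>t. \<phi> z t e) U" for z
        using smooth_model.\<Phi>_C1[OF smooth eL] by (rule C1_on_subset) simp
    qed (use reg' in auto)
    have fn: "E.f_n n \<omega> = (\<lambda>t. sample.Phi_n \<phi> n (\<lambda>i. Z i \<omega>) t e)" for n \<omega>
      by (simp add: E.f_n_def avg_def sample.Phi_n_def fun_eq_iff)
    define ah where "ah n \<omega> = \<theta>hat n \<omega> (lhat n \<omega>)" for n \<omega>
    have ah: "tendsto_in_prob M ah \<theta>0"
      by (rule tendsto_in_prob_cong[OF cons with_prob_to_one_mono[OF lhat_e]]) (simp add: ah_def)
    have root: "with_prob_to_one M (\<lambda>n \<omega>. E.f_n n \<omega> (ah n \<omega>) = 0)"
      by (rule with_prob_to_one_mono[OF with_prob_to_one_conj[OF wp_good lhat_e]])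
         (use eL in \<open>auto simp: good_def fn ah_def\<close>)
    have meas: "(\<lambda>\<omega>. sqrt (real n) *\<^sub>R (mat 1 *v (ah n \<omega> - \<theta>0))) \<in> borel_measurable M" for n
      unfolding ah_def matrix_vector_mul_lid using meas_\<theta>hat[of n] by measurable
    note result = E.asymptotically_normal_estimator[OF ah root meas]
    have "tendsto_in_prob M (\<lambda>n \<omega>. sample.V2_hat \<phi> n (\<lambda>i. Z i \<omega>) (\<theta>hat n \<omega>) (lhat n \<omega>))
       ((mat 1 ** matrix_inv E.B) ** E.K ** transpose (mat 1 ** matrix_inv E.B))"
    proof (rule tendsto_in_prob_cong[OF result(2)])
      show "with_prob_to_one M (\<lambda>n \<omega>. sample.V2_hat \<phi> n (\<lambda>i. Z i \<omega>) (\<theta>hat n \<omega>) (lhat n \<omega>) =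
        (mat 1 ** matrix_inv (jacobian (E.f_n n \<omega>) (at (ah n \<omega>)))) **
        avg (\<lambda>z. outer (\<phi> z (ah n \<omega>) e) (\<phi> z (ah n \<omega>) e)) n \<omega> **
        transpose (mat 1 ** matrix_inv (jacobian (E.f_n n \<omega>) (at (ah n \<omega>)))))"
      proof (rule with_prob_to_one_mono[OF with_prob_to_one_conj[OF E.jacobian_plug_in_invertible[OF ah] lhat_e]])
        fix n \<omega>
        let ?J = "jacobian (E.f_n n \<omega>) (at (ah n \<omega>))"
        assume "invertible ?J \<and> lhat n \<omega> = e"
        then have J: "invertible ?J" and le: "lhat n \<omega> = e" by auto
        \<comment> \<open>\<open>J_hat\<close> is the negative of the sample Jacobian; the two signs
          cancel in the sandwich.\<close>
        have "sample.J_hat \<phi> n (\<lambda>i. Z i \<omega>) (\<theta>hat n \<omega>) e = - ?J"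
          by (simp add: sample.J_hat_def fn ah_def le)
        moreover have "sample.K_hat \<phi> n (\<lambda>i. Z i \<omega>) (\<theta>hat n \<omega>) e = avg (\<lambda>z. outer (\<phi> z (ah n \<omega>) e) (\<phi> z (ah n \<omega>) e)) n \<omega>"
          by (simp add: sample.K_hat_def avg_def ah_def le)
        ultimately show "sample.V2_hat \<phi> n (\<lambda>i. Z i \<omega>) (\<theta>hat n \<omega>) (lhat n \<omega>) =
          (mat 1 ** matrix_inv ?J) ** avg (\<lambda>z. outer (\<phi> z (ah n \<omega>) e) (\<phi> z (ah n \<omega>) e)) n \<omega> **
          transpose (mat 1 ** matrix_inv ?J)"
          by (simp add: sample.V2_hat_def le matrix_inv_uminus[OF J] matrix_mult_uminus transpose_uminus)
      qed
    qed
    with result(1) show ?thesis by (auto simp: ah_def)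
  qed
  show ?thesis
  proof (intro conjI impI ballI allI)
    fix e \<theta>0
    assume e: "e \<in> {0, 1}" and *: "with_prob_to_one M (\<lambda>n \<omega>. lhat n \<omega> = e \<and> gradient (TE n \<omega>) e \<noteq> 0) \<and>
        tendsto_in_prob M (\<lambda>n \<omega>. \<theta>hat n \<omega> e) \<theta>0 \<and> regular_estimating_function F (\<lambda>z t. \<phi> z t e) \<theta>0"
    have "with_prob_to_one M (\<lambda>n \<omega>. lhat n \<omega> = e)"
      by (rule with_prob_to_one_mono[OF conjunct1[OF *]]) simp
    then show "\<exists>V. asymptotically_normal M
               (\<lambda>n \<omega>. sqrt (real n) *\<^sub>R (\<theta>hat n \<omega> (lhat n \<omega>) - \<theta>0)) V \<and>
             tendsto_in_prob M
               (\<lambda>n \<omega>. sample.V2_hat \<phi> n (\<lambda>i. Z i \<omega>) (\<theta>hat n \<omega>) (lhat n \<omega>)) V"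
      using endpoint_case[OF e] * by blast
  qed (rule interior_case)
qed

end
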